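(* Let $N\ge 1$ and let $(\Phi_j)_{0\le j\le N}$, $(\Psi_x)_{0\le x\le N}$ be a compatible pair of families of parameter arrays over $\mathbb{C}$ (see context), where $$\Phi_j=(t_x ,t^\star_x(j),\,x=0,\dots,N-j;\ f_x(j), g_x(j),\,x=1,\dots,N-j),$$ $$\Psi_x=(\theta_j(x) ,\theta^\star_j,\,j=0,\dots,N-x;\ \varphi_j(x), \phi_j(x),\,j=1,\dots,N-x),$$ and let $C^{\epsilon,\epsilon'}_{i,j}$, $D^{\epsilon,\epsilon'}_{x,y}$, $F(x,y)$, $G(i,j)$ be the associated coefficients and functions. For $(i,j),(x,y)\in\mathcal D$ put $$T_{i,j}(x,y)=p_{xi}(\Phi_j)\,p_{yj}(\Psi_x)\ \text{ if } x+j\le N,\qquad T_{i,j}(x,y)=0\ \text{ otherwise},$$ and read $T_{i,j}(x,y)$ as $0$ (and omit the corresponding terms below) if $(i,j)\notin\mathcal D$ or $(x,y)\notin\mathcal D$. Then for all $(i,j),(x,y)\in\mathcal D$: (1) (difference relations) $$t^\star_i(j)T_{i,j}(x,y)=\sum_{(\epsilon,\epsilon')\in A_2}D^{\epsilon,\epsilon'}_{x-\epsilon,y-\epsilon'}T_{i,j}(x-\epsilon,y-\epsilon'),$$ $$\theta^\star_jT_{i,j}(x,y)=b_y(\Psi_x^\star)T_{i,j}(x,y+1)+a_y(\Psi_x^\star)T_{i,j}(x,y)+c_y(\Psi_x^\star)T_{i,j}(x,y-1);$$ (2) (recurrence relations) $$t_xT_{i,j}(x,y)=\frac{G(i,j)}{G(i+1,j)}b_i(\Phi_j)T_{i+1,j}(x,y)+a_i(\Phi_j)T_{i,j}(x,y)+\frac{G(i,j)}{G(i-1,j)}c_i(\Phi_j)T_{i-1,j}(x,y),$$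 $$\theta_y(x)T_{i,j}(x,y)=\sum_{(\epsilon,\epsilon')\in A_2}\frac{G(i,j)}{G(i-\epsilon,j-\epsilon')}C^{\epsilon,\epsilon'}_{i-\epsilon,j-\epsilon'}T_{i-\epsilon,j-\epsilon'}(x,y);$$ (3) (degree) for each $(i,j)\in\mathcal D$ there is a bivariate polynomial $P_{i,j}$ of total degree $i+j$, and of degree exactly $j$ in its second variable, such that $T_{i,j}(x,y)=P_{i,j}(t_x,\theta_y(x))$ for all $(x,y)\in\mathcal D$; (4) (orthogonality) for all $(x,y),(x',y')\in\mathcal D$ and all $(i,j),(i',j')\in\mathcal D$, $$\sum_{j=0}^{\min(N-x,N-x')}\sum_{i=0}^{N-j}\frac{1}{G(i,j)}T_{i,j}(x,y)T_{i,j}(x',y')=\delta_{x,x'}\delta_{y,y'}\frac1{F(x,y)},$$ $$\sum_{x=0}^{\min(N-j,N-j')}\sum_{y=0}^{N-x}F(x,y)T_{i,j}(x,y)T_{i',j'}(x,y)=\delta_{i,i'}\delta_{j,j'}G(i,j).$$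
   Context: $N\ge1$ is an integer, $\mathcal D=\{(x,y)\in\mathbb{Z}_{\ge0}^2 : x+y\le N\}$, $A_2=\{(0,0),(1,-1),(1,0),(0,1),(-1,1),(-1,0),(0,-1)\}$. **Parameter arrays.** A parameter array of diameter $d\ge0$ is a tuple $\Phi=(\theta_i,\theta^\star_i,i=0,\dots,d;\varphi_j,\phi_j,j=1,\dots,d)$ of complex numbers such that: all $\varphi_i,\phi_i$ are nonzero; the $\theta_i$ are pairwise distinct and the $\theta_i^\star$ are pairwise distinct; for $1\le i\le d$, with $\vartheta_i=\sum_{h=0}^{i-1}\frac{\theta_h-\theta_{d-h}}{\theta_0-\theta_d}$, one has $\varphi_i=\phi_1\vartheta_i+(\theta^\star_i-\theta^\star_0)(\theta_{i-1}-\theta_d)$ and $\phi_i=\varphi_1\vartheta_i+(\theta^\star_i-\theta^\star_0)(\theta_{d-i+1}-\theta_0)$; and $\frac{\theta_{i-2}-\theta_{i+1}}{\theta_{i-1}-\theta_i}$ and $\frac{\theta^\star_{i-2}-\theta^\star_{i+1}}{\theta^\star_{i-1}-\theta^\star_i}$ are equal and independent of $i$ for $2\le i\le d-1$. (These are exactly the parameter arrays of Leonard systems over $\mathbb C$.) Set $\Phi^\star=(\theta^\star_i,\theta_i,i=0,\dots,d;\varphi_j,\phi_{d-j+1},j=1,\dots,d)$, again a parameter array. With $\varphi_0=\varphi_{d+1}=0$ (the corresponding terms being omitted), define $$a_i(\Phi)=\theta_i+\tfrac{\varphi_i}{\theta^\star_i-\theta^\star_{i-1}}+\tfrac{\varphi_{i+1}}{\theta^\star_i-\theta^\star_{i+1}},\quad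 b_i(\Phi)=\varphi_{i+1}\frac{\prod_{h=0}^{i-1}(\theta^\star_i-\theta^\star_h)}{\prod_{h=0}^{i}(\theta^\star_{i+1}-\theta^\star_h)},\quad c_i(\Phi)=\phi_i\frac{\prod_{h=0}^{d-i-1}(\theta^\star_i-\theta^\star_{d-h})}{\prod_{h=0}^{d-i}(\theta^\star_{i-1}-\theta^\star_{d-h})},$$ with $b_{-1}=b_d=c_0=c_{d+1}=0$. Define $$u_i(\lambda)=\sum_{k=0}^i\prod_{j=0}^{k-1}\frac{(\lambda-\theta_j)(\theta^\star_i-\theta^\star_j)}{\varphi_{j+1}},\qquad k_i(\Phi)=\prod_{h=1}^i\frac{\varphi_h}{\phi_h}\cdot\frac{\prod_{h=1}^d(\theta^\star_0-\theta^\star_h)}{\prod_{0\le h\le d,\,h\ne i}(\theta^\star_i-\theta^\star_h)},$$ $$p_{xi}(\Phi)=k_i(\Phi)u_i(\theta_x)\ (0\le x,i\le d),\qquad \nu(\Phi)=\prod_{h=1}^d\frac{(\theta_0-\theta_h)(\theta^\star_0-\theta^\star_h)}{\phi_h}.$$ **Compatibility.** Families $(\Phi_j)$, $(\Psi_x)$ of parameter arrays of the displayed form ($\Phi_j$ of diameter $N-j$, $\Psi_x$ of diameter $N-x$, with $t_x$ independent of $j$ and $\theta_j^\star$ independent of $x$) are *compatible* if there are complex numbers $C^{\epsilon,\epsilon'}_{i,j}$ ($(i,j)\in\mathcal D$, independent of $x,y$) and $D^{\epsilon,\epsilon'}_{x,y}$ ($(x,y)\in\mathcal D$, independent of $i,j$),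 $(\epsilon,\epsilon')\in A_2$ (a superscript $\pm$ stands for $\pm1$; coefficients are set to $0$ when the shifted index $(i+\epsilon,j+\epsilon')$, resp. $(x+\epsilon,y+\epsilon')$, is not in $\mathcal D$), such that for $(i,j)\in\mathcal D$: $$c_{j+1}(\Psi_x)p_{xi}(\Phi_j)=\sum_{\epsilon=-1,0}C^{\epsilon,+}_{i,j}p_{x,i+\epsilon}(\Phi_{j+1})\quad(0\le x\le N-j-1),$$ $$a_j(\Psi_x)p_{xi}(\Phi_j)=\sum_{\epsilon=0,\pm1}C^{\epsilon,0}_{i,j}p_{x,i+\epsilon}(\Phi_j)\quad(0\le x\le N-j),$$ $$b_{j-1}(\Psi_x)p_{xi}(\Phi_j)=\sum_{\epsilon=0,+1}C^{\epsilon,-}_{i,j}p_{x,i+\epsilon}(\Phi_{j-1})\quad(j\ge1,\ 0\le x\le N-j+1),$$ (the last left-hand side being $0$ for $x=N-j+1$); for $(x,y)\in\mathcal D$: $$c_{x+1}(\Phi_j^\star)p_{jy}(\Psi_x^\star)=\frac{\nu(\Psi_x)}{\nu(\Psi_{x+1})}\sum_{\epsilon'=-1,0}D^{+,\epsilon'}_{x,y}p_{j,y+\epsilon'}(\Psi^\star_{x+1})\quad(0\le j\le N-x-1),$$ $$a_x(\Phi_j^\star)p_{jy}(\Psi_x^\star)=\sum_{\epsilon'=0,\pm1}D^{0,\epsilon'}_{x,y}p_{j,y+\epsilon'}(\Psi^\star_x)\quad(0\le j\le N-x),$$ $$b_{x-1}(\Phi_j^\star)p_{jy}(\Psi_x^\star)=\frac{\nu(\Psi_x)}{\nu(\Psi_{x-1})}\sum_{\epsilon'=0,+1}D^{-,\epsilon'}_{x,y}p_{j,y+\epsilon'}(\Psi^\star_{x-1})\quad(x\ge1,\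 0\le j\le N-x+1),$$ (the last left-hand side being $0$ for $j=N-x+1$); and if there are functions $F,G$ on $\mathcal D$, $F$ nowhere zero, with $$\frac{k_i(\Phi_j)}{k_x(\Phi^\star_j)}\,\frac{k_j(\Psi_x)}{k_y(\Psi_x^\star)}\,F(x,y)=\frac{G(i,j)}{\nu(\Psi_x)\nu(\Phi_j)}\qquad\text{for all }(x,y),(i,j)\in\mathcal D\text{ with }x+j\le N$$ (so $G$ is nowhere zero as well). *)

theory Defs
  imports Complex_Main "HOL-Computational_Algebra.Polynomial"
begin

text \<open>
  All indices are integers, so that shifts such as \<open>i - 1\<close> do not truncate and ranges such as
  \<open>{0..i-1}\<close> are empty for \<open>i = 0\<close>. The sequences of a parameter array of diameter \<open>d\<close> are
  functions on all integers; only their values at \<open>0..d\<close> (eigenvalues) and at \<open>1..d\<close>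
  (split sequences) are ever used. The fields are, in order, the diameter, the eigenvalues, the
  dual eigenvalues, and the first (varphi) and second (phi) split sequences.
\<close>

record param_array =
  pa_diam :: int
  pa_eig :: "int \<Rightarrow> complex"
  pa_deig :: "int \<Rightarrow> complex"
  pa_fsplit :: "int \<Rightarrow> complex"
  pa_ssplit :: "int \<Rightarrow> complex"

definition pa_vartheta :: "param_array \<Rightarrow> int \<Rightarrow> complex" where
  "pa_vartheta \<Phi> i =
     (\<Sum>h\<in>{0..i-1}. (pa_eig \<Phi> h - pa_eig \<Phi> (pa_diam \<Phi> - h))
                    / (pa_eig \<Phi> 0 - pa_eig \<Phi> (pa_diam \<Phi>)))"

definition is_param_array :: "param_array \<Rightarrow> bool" where
  "is_param_array \<Phi> \<longleftrightarrow>
    (let d = pa_diam \<Phi>; th = pa_eig \<Phi>; ths = pa_deig \<Phi>; vphi = pa_fsplit \<Phi>; phi = pa_ssplit \<Phi> in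
      0 \<le> d \<and>
      (\<forall>i\<in>{1..d}. vphi i \<noteq> 0 \<and> phi i \<noteq> 0) \<and>
      inj_on th {0..d} \<and> inj_on ths {0..d} \<and>
      (\<forall>i\<in>{1..d}.
         vphi i = phi 1 * pa_vartheta \<Phi> i + (ths i - ths 0) * (th (i-1) - th d) \<and>
         phi i = vphi 1 * pa_vartheta \<Phi> i + (ths i - ths 0) * (th (d-i+1) - th 0)) \<and>
      (\<exists>r. \<forall>i\<in>{2..d-1}.
         (th (i-2) - th (i+1)) / (th (i-1) - th i) = r \<and>
         (ths (i-2) - ths (i+1)) / (ths (i-1) - ths i) = r))"

definition pa_dual :: "param_array \<Rightarrow> param_array" where
  "pa_dual \<Phi> = \<lparr> pa_diam = pa_diam \<Phi>, pa_eig = pa_deig \<Phi>, pa_deig = pa_eig \<Phi>,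
                pa_fsplit = pa_fsplit \<Phi>, pa_ssplit = (\<lambda>j. pa_ssplit \<Phi> (pa_diam \<Phi> - j + 1)) \<rparr>"

definition pa_a :: "param_array \<Rightarrow> int \<Rightarrow> complex" where
  "pa_a \<Phi> i = pa_eig \<Phi> i
     + (if i = 0 then 0 else pa_fsplit \<Phi> i / (pa_deig \<Phi> i - pa_deig \<Phi> (i-1)))
     + (if i = pa_diam \<Phi> then 0 else pa_fsplit \<Phi> (i+1) / (pa_deig \<Phi> i - pa_deig \<Phi> (i+1)))"

definition pa_b :: "param_array \<Rightarrow> int \<Rightarrow> complex" where
  "pa_b \<Phi> i =
     (if i = -1 \<or> i = pa_diam \<Phi> then 0
      else pa_fsplit \<Phi> (i+1) * (\<Prod>h\<in>{0..i-1}. pa_deig \<Phi> i - pa_deig \<Phi> h)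
             / (\<Prod>h\<in>{0..i}. pa_deig \<Phi> (i+1) - pa_deig \<Phi> h))"

definition pa_c :: "param_array \<Rightarrow> int \<Rightarrow> complex" where
  "pa_c \<Phi> i =
     (let d = pa_diam \<Phi> in
      if i = 0 \<or> i = d + 1 then 0
      else pa_ssplit \<Phi> i * (\<Prod>h\<in>{0..d-i-1}. pa_deig \<Phi> i - pa_deig \<Phi> (d-h))
             / (\<Prod>h\<in>{0..d-i}. pa_deig \<Phi> (i-1) - pa_deig \<Phi> (d-h)))"

definition pa_u :: "param_array \<Rightarrow> int \<Rightarrow> complex \<Rightarrow> complex" where
  "pa_u \<Phi> i z =
     (\<Sum>k\<in>{0..i}. \<Prod>j\<in>{0..k-1}.
        (z - pa_eig \<Phi> j) * (pa_deig \<Phi> i - pa_deig \<Phi> j) / pa_fsplit \<Phi> (j+1))"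

definition pa_k :: "param_array \<Rightarrow> int \<Rightarrow> complex" where
  "pa_k \<Phi> i =
     (\<Prod>h\<in>{1..i}. pa_fsplit \<Phi> h / pa_ssplit \<Phi> h)
     * ((\<Prod>h\<in>{1..pa_diam \<Phi>}. pa_deig \<Phi> 0 - pa_deig \<Phi> h)
        / (\<Prod>h\<in>{0..pa_diam \<Phi>} - {i}. pa_deig \<Phi> i - pa_deig \<Phi> h))"

definition pa_p :: "param_array \<Rightarrow> int \<Rightarrow> int \<Rightarrow> complex" where
  "pa_p \<Phi> x i = pa_k \<Phi> i * pa_u \<Phi> i (pa_eig \<Phi> x)"

definition pa_nu :: "param_array \<Rightarrow> complex" where
  "pa_nu \<Phi> = (\<Prod>h\<in>{1..pa_diam \<Phi>}.
     (pa_eig \<Phi> 0 - pa_eig \<Phi> h) * (pa_deig \<Phi> 0 - pa_deig \<Phi> h) / pa_ssplit \<Phi> h)"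

definition triangle :: "int \<Rightarrow> (int \<times> int) set" where
  "triangle N = {(x, y). 0 \<le> x \<and> 0 \<le> y \<and> x + y \<le> N}"

definition A2 :: "(int \<times> int) set" where
  "A2 = {(0,0), (1,-1), (1,0), (0,1), (-1,1), (-1,0), (0,-1)}"

definition zero_outside ::
    "int \<Rightarrow> (int \<Rightarrow> int \<Rightarrow> int \<Rightarrow> int \<Rightarrow> complex) \<Rightarrow> bool" where
  "zero_outside N C \<longleftrightarrow>
     (\<forall>(e,e')\<in>A2. \<forall>(i,j)\<in>triangle N. (i+e, j+e') \<notin> triangle N \<longrightarrow> C e e' i j = 0)"

text \<open>
  The coefficient with superscripts \<open>e, e'\<close> and subscripts \<open>i, j\<close> is written \<open>C e e' i j\<close>.
  In the relations below, a factor whose index is out of range is always multiplied by \<open>0\<close>: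
  either by a coefficient covered by \<^const>\<open>zero_outside\<close>, or by the last entry \<open>b\<^sub>d = 0\<close>.
\<close>

definition C_relations ::
    "int \<Rightarrow> (int \<Rightarrow> param_array) \<Rightarrow> (int \<Rightarrow> param_array)
      \<Rightarrow> (int \<Rightarrow> int \<Rightarrow> int \<Rightarrow> int \<Rightarrow> complex) \<Rightarrow> bool" where
  "C_relations N \<Phi> \<Psi> C \<longleftrightarrow>
     (\<forall>(i,j)\<in>triangle N.
        (\<forall>x\<in>{0..N-j-1}.
           pa_c (\<Psi> x) (j+1) * pa_p (\<Phi> j) x i
             = (\<Sum>e\<in>{-1,0}. C e 1 i j * pa_p (\<Phi> (j+1)) x (i+e))) \<and>
        (\<forall>x\<in>{0..N-j}.
           pa_a (\<Psi> x) j * pa_p (\<Phi> j) x i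
             = (\<Sum>e\<in>{-1,0,1}. C e 0 i j * pa_p (\<Phi> j) x (i+e))) \<and>
        (1 \<le> j \<longrightarrow> (\<forall>x\<in>{0..N-j+1}.
           pa_b (\<Psi> x) (j-1) * pa_p (\<Phi> j) x i
             = (\<Sum>e\<in>{0,1}. C e (-1) i j * pa_p (\<Phi> (j-1)) x (i+e)))))"

definition D_relations ::
    "int \<Rightarrow> (int \<Rightarrow> param_array) \<Rightarrow> (int \<Rightarrow> param_array)
      \<Rightarrow> (int \<Rightarrow> int \<Rightarrow> int \<Rightarrow> int \<Rightarrow> complex) \<Rightarrow> bool" where
  "D_relations N \<Phi> \<Psi> D \<longleftrightarrow>
     (\<forall>(x,y)\<in>triangle N.
        (\<forall>j\<in>{0..N-x-1}.
           pa_c (pa_dual (\<Phi> j)) (x+1) * pa_p (pa_dual (\<Psi> x)) j y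
             = pa_nu (\<Psi> x) / pa_nu (\<Psi> (x+1))
               * (\<Sum>e'\<in>{-1,0}. D 1 e' x y * pa_p (pa_dual (\<Psi> (x+1))) j (y+e'))) \<and>
        (\<forall>j\<in>{0..N-x}.
           pa_a (pa_dual (\<Phi> j)) x * pa_p (pa_dual (\<Psi> x)) j y
             = (\<Sum>e'\<in>{-1,0,1}. D 0 e' x y * pa_p (pa_dual (\<Psi> x)) j (y+e'))) \<and>
        (1 \<le> x \<longrightarrow> (\<forall>j\<in>{0..N-x+1}.
           pa_b (pa_dual (\<Phi> j)) (x-1) * pa_p (pa_dual (\<Psi> x)) j y
             = pa_nu (\<Psi> x) / pa_nu (\<Psi> (x-1))
               * (\<Sum>e'\<in>{0,1}. D (-1) e' x y * pa_p (pa_dual (\<Psi> (x-1))) j (y+e')))))"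

definition FG_relation ::
    "int \<Rightarrow> (int \<Rightarrow> param_array) \<Rightarrow> (int \<Rightarrow> param_array)
      \<Rightarrow> (int \<Rightarrow> int \<Rightarrow> complex) \<Rightarrow> (int \<Rightarrow> int \<Rightarrow> complex) \<Rightarrow> bool" where
  "FG_relation N \<Phi> \<Psi> F G \<longleftrightarrow>
     (\<forall>(x,y)\<in>triangle N. F x y \<noteq> 0) \<and>
     (\<forall>(x,y)\<in>triangle N. \<forall>(i,j)\<in>triangle N. x + j \<le> N \<longrightarrow>
        pa_k (\<Phi> j) i / pa_k (pa_dual (\<Phi> j)) x * (pa_k (\<Psi> x) j / pa_k (pa_dual (\<Psi> x)) y) * F x y
          = G i j / (pa_nu (\<Psi> x) * pa_nu (\<Phi> j)))"

text \<open>The families \<open>\<Phi>\<close>, \<open>\<Psi>\<close> are compatible, with associated data \<open>C, D, F, G\<close>.\<close>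

definition compatible_via ::
    "int \<Rightarrow> (int \<Rightarrow> param_array) \<Rightarrow> (int \<Rightarrow> param_array)
      \<Rightarrow> (int \<Rightarrow> int \<Rightarrow> int \<Rightarrow> int \<Rightarrow> complex) \<Rightarrow> (int \<Rightarrow> int \<Rightarrow> int \<Rightarrow> int \<Rightarrow> complex)
      \<Rightarrow> (int \<Rightarrow> int \<Rightarrow> complex) \<Rightarrow> (int \<Rightarrow> int \<Rightarrow> complex) \<Rightarrow> bool" where
  "compatible_via N \<Phi> \<Psi> C D F G \<longleftrightarrow>
     (\<forall>j\<in>{0..N}. is_param_array (\<Phi> j) \<and> pa_diam (\<Phi> j) = N - j \<and>
        (\<forall>x\<in>{0..N-j}. pa_eig (\<Phi> j) x = pa_eig (\<Phi> 0) x)) \<and>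
     (\<forall>x\<in>{0..N}. is_param_array (\<Psi> x) \<and> pa_diam (\<Psi> x) = N - x \<and>
        (\<forall>j\<in>{0..N-x}. pa_deig (\<Psi> x) j = pa_deig (\<Psi> 0) j)) \<and>
     zero_outside N C \<and> zero_outside N D \<and>
     C_relations N \<Phi> \<Psi> C \<and> D_relations N \<Phi> \<Psi> D \<and> FG_relation N \<Phi> \<Psi> F G"

definition biv_T ::
    "int \<Rightarrow> (int \<Rightarrow> param_array) \<Rightarrow> (int \<Rightarrow> param_array)
      \<Rightarrow> int \<Rightarrow> int \<Rightarrow> int \<Rightarrow> int \<Rightarrow> complex" where
  "biv_T N \<Phi> \<Psi> i j x y =
     (if (i,j) \<in> triangle N \<and> (x,y) \<in> triangle N \<and> x + j \<le> N
      then pa_p (\<Phi> j) x i * pa_p (\<Psi> x) y j else 0)"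

text \<open>
  A bivariate polynomial is a \<open>complex poly poly\<close>: the outer variable is the second one, and
  \<open>coeff (coeff P b) a\<close> is the coefficient of the monomial with exponents \<open>a\<close> (first variable)
  and \<open>b\<close> (second variable). Hence \<open>degree P\<close> is the degree in the second variable. As for
  \<^const>\<open>degree\<close>, the total degree of the zero polynomial is \<open>0\<close>.
\<close>

definition bipoly :: "complex poly poly \<Rightarrow> complex \<Rightarrow> complex \<Rightarrow> complex" where
  "bipoly P u v = poly (poly P [:v:]) u"

definition total_degree :: "complex poly poly \<Rightarrow> nat" where
  "total_degree P = Max (insert 0 {a + b | a b. coeff (coeff P b) a \<noteq> 0})"

end

(*
  For a parameter array with d = diam, let L be the operator on functions of i given by
  L tau_k = theta_k tau_k + varphi_k tau_(k-1), where tau_k(i) = prod_(h<k) (thetastar_i - thetastar_h).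
  The Leonard pair theory rests on one fact: on the reversed basis
  eta_k(i) = prod_(h<k) (thetastar_i - thetastar_(d-h)) it acts as
  L eta_k = theta_k eta_k + phi_(d-k+1) eta_(k-1).
  Being triangular from both ends, L is tridiagonal, with coefficients c_i, a_i, b_i. This gives the
  three-term recurrences, and P P* = nu I follows from self-adjointness of L for the weights k_i;
  the sum of the k_i is nu because the functional f -> sum_i k_i f(i) kills (L - theta_0) f.
  The action on eta_k is a polynomial identity in the connection coefficients between the two bases.
  Both eigenvalue sequences have the form a + b q^n + c q^(-n) with q + 1/q + 1 the common ratio; for
  q not a root of unity of small order the connection coefficients are explicit products, and the
  remaining q follow by continuity.

  For the bivariate functions, P P* = nu I inverts the compatibility relations, which turns the
  three-term relations of Phi_j into relations between the T_(i,j) at neighbouring (x,y). The relation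
  between F and G makes T_(i,j)(x,y) F(x,y) / G(i,j) the function T of the families Psi_x*, Phi_j*,
  so each recurrence relation is a difference relation of the dual families.
*)
theory Submission
  imports Defs
begin

section \<open>Linear recurrences of order three\<close>

text \<open>The passage to the limit needs a curve of data through the given ones. A sequence of
  constant ratio is determined by the ratio and its first three terms, so these terms are kept and
  only q in the ratio q + 1/q + 1 moves. Every term is then continuous in q, and the given sequences
  sit at some nonzero \<open>q0\<close>. The split sequences move along: they enter through their
  defining formulas, with phi_1 as a fixed constant, so that the connection identity becomes an
  equation between functions of q whose only denominators, apart from powers of q, are \<theta>_0 -
  \<theta>_d.

  That vartheta_i depends only on q and d has a second use. It makes vartheta the same for an array
  and its dual, hence the dual is again a parameter array, and half of the relations below are
  obtained from that.

  The degree statement rests on solving the recurrence for \<theta>_y(x) at i = 0 for T_(0,j+1). The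
  coefficient in front is nonzero because inversion exhibits b_j(Psi_0) as a multiple of it.\<close>

fun rec3 :: "complex \<Rightarrow> complex \<Rightarrow> complex \<Rightarrow> complex \<Rightarrow> nat \<Rightarrow> complex" where
  "rec3 q x y z 0 = x"
| "rec3 q x y z (Suc 0) = y"
| "rec3 q x y z (Suc (Suc 0)) = z"
| "rec3 q x y z (Suc (Suc (Suc n))) =
     rec3 q x y z n - (q + 1/q + 1) * (rec3 q x y z (Suc n) - rec3 q x y z (Suc (Suc n)))"

lemma isCont_rec3:
  assumes "q0 \<noteq> 0" shows "isCont (\<lambda>q. rec3 q x y z n) q0"
proof -
  have "isCont (\<lambda>q. rec3 q x y z n) q0 \<and> isCont (\<lambda>q. rec3 q x y z (Suc n)) q0
      \<and> isCont (\<lambda>q. rec3 q x y z (Suc (Suc n))) q0"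
  proof (induction n)
    case (Suc n)
    then have "isCont (\<lambda>q. rec3 q x y z (Suc (Suc (Suc n)))) q0"
      unfolding rec3.simps using assms by (intro continuous_intros) auto
    with Suc show ?case by blast
  qed simp
  then show ?thesis by blast
qed

text \<open>The characteristic polynomial of the recurrence is (X - 1)(X - q)(X - 1/q); the
  hypotheses on \<open>q\<close> make its roots distinct.\<close>

lemma rec3_closed_form:
  assumes "q \<noteq> 0" "q \<noteq> 1" "q^2 \<noteq> 1"
  obtains a b c where "\<And>n. rec3 q x y z n = a + b * q^n + c / q^n"
proof -
  define w where "w = (q^2 - 1) * (q - 1)"
  have w: "w \<noteq> 0" using assms by (simp add: w_def)
  \<comment> \<open>The constants solve y - x = b(q - 1) + c(1/q - 1) and z - y = bq(q - 1) +
    (c/q)(1/q - 1); for instance q(z - y) - (y - x) = wb.\<close>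
  define b where "b = ((z - y) * q - (y - x)) / w"
  define c where "c = q^2 * (q * (y - x) - (z - y)) / - w"
  define a where "a = x - b - c"
  have w': "q^3 - q^2 - q + 1 = w" by (simp add: w_def power2_eq_square power3_eq_cube algebra_simps)
  have 1: "a + b * q + c / q = y"
  proof -
    have "w * q * (a + b * q + c / q - y) = 0"
      using w assms(1) unfolding a_def b_def c_def by (simp add: divide_simps) (simp add: w_def, algebra)
    then show ?thesis using w assms(1) by simp
  qed
  have 2: "a + b * q^2 + c / q^2 = z"
  proof -
    have "w * q * (a + b * q^2 + c / q^2 - z) = 0"
      using w assms(1) unfolding a_def b_def c_def by (simp add: divide_simps) (simp add: w_def, algebra)
    then show ?thesis using w assms(1) by simp
  qed
  have "rec3 q x y z n = a + b * q^n + c / q^n \<and> rec3 q x y z (Suc n) = a + b * q^Suc n + c / q^Suc n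
     \<and> rec3 q x y z (Suc (Suc n)) = a + b * q^Suc (Suc n) + c / q^Suc (Suc n)" for n
  proof (induction n)
    case 0
    show ?case using 1 2 by (simp add: a_def power2_eq_square)
  next
    case (Suc n)
    have *: "rec3 q x y z (Suc (Suc (Suc n))) = a + b * q^Suc (Suc (Suc n)) + c / q^Suc (Suc (Suc n))"
    proof -
      define Q where "Q = q^n"
      have Q: "Q \<noteq> 0" using assms(1) by (simp add: Q_def)
      have "rec3 q x y z (Suc (Suc (Suc n))) = (a + b * Q + c / Q)
          - (q + 1/q + 1) * ((a + b * (q * Q) + c / (q * Q)) - (a + b * (q * (q * Q)) + c / (q * (q * Q))))"
        using Suc unfolding Q_def by simp
      also have "\<dots> = a + b * (q * (q * (q * Q))) + c / (q * (q * (q * Q)))"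
        using assms(1) Q by (simp add: divide_simps) algebra
      finally show ?thesis by (simp add: Q_def)
    qed
    with Suc show ?case by blast
  qed
  then show ?thesis using that by blast
qed

text \<open>Puts the given sequence on the curve of the \<open>rec3 q\<close>. Agreement is claimed
  only up to \<open>d\<close>, where the recurrence is known.\<close>

lemma rec3_exists:
  assumes "\<And>n. n + 3 \<le> d \<Longrightarrow> s (n+3) = s n - r * (s (n+1) - s (n+2))"
    and "r = q + 1/q + 1" "n \<le> d"
  shows "s n = rec3 q (s 0) (s 1) (s 2) n"
  using assms(3)
proof (induction n rule: less_induct)
  case (less n)
  consider "n = 0" | "n = 1" | "n = 2" | m where "n = m + 3"
  proof -
    assume *: "n = 0 \<Longrightarrow> thesis" "n = 1 \<Longrightarrow> thesis" "n = 2 \<Longrightarrow> thesis" "\<And>m. n = m + 3 \<Longrightarrow> thesis"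
    have "n = 0 \<or> n = 1 \<or> n = 2 \<or> n = (n - 3) + 3" by linarith
    with * show thesis by blast
  qed
  then show ?case
  proof cases
    case (4 m)
    then show ?thesis using less.IH[of m] less.IH[of "m+1"] less.IH[of "m+2"] less.prems
      assms(1)[of m] assms(2) by (simp add: numeral_3_eq_3)
  qed (auto simp: numeral_2_eq_2)
qed

lemma ex_q_plus_inverse:
  fixes r :: complex
  obtains q where "q \<noteq> 0" "r = q + 1/q + 1"
proof -
  define w where "w = csqrt ((r-1)^2 - 4)"
  define q where "q = (r - 1 + w) / 2"
  have w: "w^2 = (r-1)^2 - 4" by (simp add: w_def)
  have "2 * q = r - 1 + w" by (simp add: q_def)
  with w have "4 * (q^2 - (r - 1) * q + 1) = 0" by algebra
  then have q: "q^2 - (r - 1) * q + 1 = 0" by (metis mult_eq_0_iff zero_neq_numeral)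
  then have "q \<noteq> 0" by auto
  moreover have "r = q + 1/q + 1"
  proof -
    have "(r - 1) * q = q * q + 1" using q by algebra
    then have "r - 1 = (q * q + 1) / q" using \<open>q \<noteq> 0\<close> by (simp add: eq_divide_eq)
    then show ?thesis using \<open>q \<noteq> 0\<close> by (simp add: add_divide_distrib diff_eq_eq)
  qed
  ultimately show ?thesis using that by blast
qed

text \<open>The exponent \<open>d + 1\<close> makes sure that \<open>q^2 \<noteq> 1\<close> is
  included even for \<open>d = 1\<close>, so that q, 1/q and 1 are distinct.\<close>

definition generic :: "nat \<Rightarrow> complex \<Rightarrow> bool" where
  "generic d q \<longleftrightarrow> q \<noteq> 0 \<and> (\<forall>l\<in>{1..d+1}. q^l \<noteq> 1)"

lemma eventually_generic: 
  assumes "q0 \<noteq> 0" shows "eventually (generic d) (at q0)"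
proof -
  have *: "eventually (\<lambda>q. q^l \<noteq> 1) (at q0)" if "l \<in> {1..d+1}" for l
  proof -
    \<comment> \<open>The filter \<open>at q0\<close> ignores \<open>q0\<close>, which may itself be
      a root of unity and is therefore taken out of the exceptional set.\<close>
    have "finite ({q::complex. q^l = 1} - {q0})"
      using that by (intro finite_Diff finite_roots_unity) auto
    then have "open (- ({q::complex. q^l = 1} - {q0}))"
      by (intro open_Compl finite_imp_closed)
    then show ?thesis
      unfolding eventually_at_topological by (intro exI[of _ "- ({q::complex. q^l = 1} - {q0})"]) auto
  qed
  have "eventually (\<lambda>q. \<forall>l\<in>{1..d+1}. q^l \<noteq> 1) (at q0)"
    using * by (intro eventually_ball_finite) auto
  moreover have "eventually (\<lambda>q. q \<noteq> 0) (at q0)"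
    unfolding eventually_at_topological using assms by (intro exI[of _ "-{0}"]) auto
  ultimately show ?thesis
    unfolding generic_def by eventually_elim auto
qed

text \<open>\<open>R\<close> collects the denominators of \<open>P\<close>. It stays nonzero near
  \<open>q0\<close>, so \<open>P\<close> vanishes at all generic points of a punctured
  neighbourhood.\<close>

lemma zero_by_generic_limit:
  fixes P R :: "complex \<Rightarrow> complex"
  assumes "q0 \<noteq> 0" "isCont P q0" "isCont R q0" "R q0 \<noteq> 0"
    and "\<And>q. generic d q \<Longrightarrow> R q \<noteq> 0 \<Longrightarrow> P q = 0"
  shows "P q0 = 0"
proof -
  have "eventually (\<lambda>q. R q \<noteq> 0) (at q0)"
    using assms(3,4) unfolding isCont_def by (rule tendsto_imp_eventually_ne)
  with eventually_generic[OF assms(1), of d] have "eventually (\<lambda>q. P q = 0) (at q0)"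
    by eventually_elim (use assms(5) in auto)
  then have "(P \<longlongrightarrow> 0) (at q0)" by (rule tendsto_eventually)
  moreover have "(P \<longlongrightarrow> P q0) (at q0)" using assms(2) by (simp add: isCont_def)
  ultimately show ?thesis using tendsto_unique[of "at q0"] by auto
qed

section \<open>Connection coefficients between the two Newton bases\<close>

definition vth :: "nat \<Rightarrow> (nat \<Rightarrow> complex) \<Rightarrow> nat \<Rightarrow> complex" where
  "vth d \<theta> i = (\<Sum>h<i. \<theta> h - \<theta> (d - h)) / (\<theta> 0 - \<theta> d)"

definition newton :: "(nat \<Rightarrow> complex) \<Rightarrow> nat \<Rightarrow> complex \<Rightarrow> complex" where
  "newton s k z = (\<Prod>h<k. z - s h)"

text \<open>Coefficients of the Newton polynomial with nodes \<open>s d, s (d-1), ...\<close> in the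
  Newton basis with nodes \<open>s 0, s 1, ...\<close>. The recursion multiplies by z - s(d - k),
  written as (z - s m) + (s m - s(d - k)) in front of the m-th basis element.\<close>

fun conn :: "(nat \<Rightarrow> complex) \<Rightarrow> nat \<Rightarrow> nat \<Rightarrow> nat \<Rightarrow> complex" where
  "conn s d 0 m = (if m = 0 then 1 else 0)"
| "conn s d (Suc k) m = (if m = 0 then 0 else conn s d k (m - 1)) + (s m - s (d - k)) * conn s d k m"

lemma conn_eq_0: "k < m \<Longrightarrow> conn s d k m = 0"
  by (induction k arbitrary: m) auto

lemma conn_self: "conn s d k k = 1"
  by (induction k) (auto simp: conn_eq_0)

lemma newton_rev_expand:
  "k \<le> n \<Longrightarrow> newton (\<lambda>h. s (d - h)) k z = (\<Sum>m\<le>n. conn s d k m * newton s m z)"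
proof (induction k)
  case 0
  have "(\<Sum>m\<le>n. conn s d 0 m * newton s m z) = (\<Sum>m\<in>{0}. conn s d 0 m * newton s m z)"
    by (rule sum.mono_neutral_right) auto
  then show ?case by (simp add: newton_def)
next
  case (Suc k)
  have "newton (\<lambda>h. s (d - h)) (Suc k) z = (\<Sum>m\<le>n. conn s d k m * newton s m z) * (z - s (d - k))"
    using Suc by (simp add: newton_def)
  also have "\<dots> = (\<Sum>m\<le>n. conn s d k m * newton s (Suc m) z + (s m - s (d - k)) * conn s d k m * newton s m z)"
    unfolding sum_distrib_right by (rule sum.cong) (auto simp: newton_def algebra_simps)
  also have "\<dots> = (\<Sum>m\<le>n. conn s d k m * newton s (Suc m) z)
       + (\<Sum>m\<le>n. (s m - s (d - k)) * conn s d k m * newton s m z)"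
    by (rule sum.distrib)
  also have "(\<Sum>m\<le>n. conn s d k m * newton s (Suc m) z) = (\<Sum>m<n. conn s d k m * newton s (Suc m) z)"
    using Suc.prems by (intro sum.mono_neutral_right) (auto simp: conn_eq_0)
  also have "\<dots> = (\<Sum>m\<le>n. (if m = 0 then 0 else conn s d k (m - 1)) * newton s m z)"
  proof -
    have "{..n} = insert 0 (Suc ` {..<n})"
      by (simp add: lessThan_Suc_eq_insert_0[symmetric] lessThan_Suc_atMost[symmetric])
    then show ?thesis by (simp add: sum.reindex image_iff)
  qed
  also have "\<dots> + (\<Sum>m\<le>n. (s m - s (d - k)) * conn s d k m * newton s m z)
     = (\<Sum>m\<le>n. conn s d (Suc k) m * newton s m z)"
    by (simp add: sum.distrib[symmetric] algebra_simps)
  finally show ?case .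
qed

section \<open>Explicit connection coefficients for generic q\<close>

locale q_form =
  fixes d :: nat and q a b c a' b' c' :: complex and \<theta> s :: "nat \<Rightarrow> complex"
  assumes gen: "generic d q" and d: "1 \<le> d"
    and th: "\<And>n. \<theta> n = a + b * q^n + c / q^n"
    and ths: "\<And>n. s n = a' + b' * q^n + c' / q^n"
    and ne: "\<theta> 0 \<noteq> \<theta> d"
begin

text \<open>The quotient \<open>V i / W\<close> is \<open>\<vartheta>\<^sub>i\<close>; the normalisation \<open>W\<close> cancels from the connection coefficients.\<close>

definition V :: "nat \<Rightarrow> complex" where "V i = (1 - q^i) * (1 - q^d * q / q^i)"
definition W :: complex where "W = (1 - q) * (1 - q^d)"

lemma q0: "q \<noteq> 0" and q_pow: "1 \<le> l \<Longrightarrow> l \<le> d + 1 \<Longrightarrow> q^l \<noteq> 1"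
  using gen by (auto simp: generic_def)

lemma q1: "q \<noteq> 1" using q_pow[of 1] d by simp

lemma W: "W \<noteq> 0" using q1 q_pow[of d] d by (simp add: W_def)

lemma q_power_diff: "k \<le> d \<Longrightarrow> q^(d - k) = q^d / q^k"
  using q0 by (simp add: power_diff)

lemma V_nonzero: assumes "1 \<le> i" "i \<le> d" shows "V i \<noteq> 0"
proof -
  have "q^d * q / q^i = q^(d + 1 - i)" using assms q0 by (simp add: power_diff)
  then show ?thesis using assms q_pow[of i] q_pow[of "d + 1 - i"] by (auto simp: V_def)
qed

text \<open>The coefficients of \<theta> separate: \<theta>_h - \<theta>_(d-h) = (b - c/q^d)(q^h -
  q^(d-h)). Up to the factor 1 - q the second factor is V(h + 1) - V h, so the sum telescopes, and b
  - c/q^d cancels against \<theta>_0 - \<theta>_d in vartheta.\<close>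

lemma sum_theta: "i \<le> d \<Longrightarrow> (\<Sum>h<i. \<theta> h - \<theta> (d - h)) * (1 - q) = (b - c / q^d) * V i"
proof (induction i)
  case (Suc i)
  have "(\<theta> i - \<theta> (d - i)) * (1 - q) = (b - c / q^d) * (V (Suc i) - V i)"
    using Suc.prems q0 unfolding th V_def by (simp add: q_power_diff divide_simps) algebra
  moreover have "(\<Sum>h<i. \<theta> h - \<theta> (d - h)) * (1 - q) = (b - c / q^d) * V i"
    using Suc by simp
  moreover have "(\<Sum>h<Suc i. \<theta> h - \<theta> (d - h)) = (\<Sum>h<i. \<theta> h - \<theta> (d - h)) + (\<theta> i - \<theta> (d - i))"
    by simp
  ultimately show ?case by algebra
qed (simp add: V_def)

lemma theta_0d: "\<theta> 0 - \<theta> d = (b - c / q^d) * (1 - q^d)"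
  using q0 by (simp add: th divide_simps) algebra

lemma vth_eq: assumes "i \<le> d" shows "vth d \<theta> i = V i / W"
proof -
  have n: "b - c / q^d \<noteq> 0" "1 - q^d \<noteq> 0" using ne theta_0d by auto
  have "(\<Sum>h<i. \<theta> h - \<theta> (d - h)) = (b - c / q^d) * V i / (1 - q)"
    using sum_theta[OF assms] q1 by (simp add: eq_divide_eq)
  then show ?thesis using n q1 unfolding vth_def theta_0d W_def by simp
qed

lemma V_sym: assumes "1 \<le> i" "i \<le> d" shows "V (d + 1 - i) = V i"
  using assms q0 by (simp add: V_def power_diff)

text \<open>What remains of the recursion for \<open>conn\<close> once the product formula is
  inserted and common factors are cancelled.\<close>

lemma V_diff:
  assumes "m \<le> k" "k < d"
  shows "(V (Suc k) - V m) * (s 0 - s (d - k + m)) = V (Suc k - m) * (s m - s (d - k))"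
proof -
  have e: "q^(Suc k - m) = q * q^k / q^m" "q^(d - k + m) = q^d * q^m / q^k"
    using assms q0 by (simp_all add: power_diff Suc_diff_le power_add)
  show ?thesis
    unfolding V_def ths e q_power_diff[OF less_imp_le[OF assms(2)]] using q0
    by (simp add: divide_simps) algebra
qed

text \<open>A binomial coefficient formed with the \<open>V i\<close>, as the Gaussian ones are with
  1 - q^i, times the value at \<open>s 0\<close> of a reversed Newton polynomial of degree
  \<open>k - m\<close>. For \<open>m = 0\<close> only that value is left.\<close>

lemma conn_closed_form:
  "k \<le> d \<Longrightarrow> m \<le> k \<Longrightarrow> conn s d k m =
     (\<Prod>l<k - m. V (Suc (m + l))) / (\<Prod>l<k - m. V (Suc l)) * (\<Prod>l<k - m. s 0 - s (d - l))"
proof (induction k arbitrary: m)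
  case (Suc k)
  have nz: "(\<Prod>l<n. V (Suc l)) \<noteq> 0" if "n \<le> d" for n
    using that by (auto simp: V_nonzero)
  consider "m = Suc k" | "m = 0" "m \<le> k" | "1 \<le> m" "m \<le> k" using Suc.prems by linarith
  then show ?case
  proof cases
    case 1
    then show ?thesis using conn_self[of s d "Suc k"] by simp
  next
    case 2
    then show ?thesis using Suc.IH[of 0] Suc.prems nz[of k] nz[of "Suc k"] by simp
  next
    case 3
    define A where "A = (\<Prod>l<k - m. V (Suc (m + l)))"
    define B where "B = (\<Prod>l<k - m. V (Suc l))"
    define C where "C = (\<Prod>l<k - m. s 0 - s (d - l))"
    define X where "X = s 0 - s (d - k + m)"
    have B0: "B \<noteq> 0" unfolding B_def using Suc.prems by (intro nz) auto
    have V0: "V (Suc (k - m)) \<noteq> 0" using Suc.prems by (intro V_nonzero) auto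
    have i1: "conn s d k m = A / B * C"
      using Suc.IH[of m] Suc.prems 3 by (simp add: A_def B_def C_def)
    have k1: "k - (m - 1) = Suc (k - m)" "Suc k - m = Suc (k - m)" using 3 by auto
    have k2: "d - (k - m) = d - k + m" using 3 Suc.prems by auto
    have "(\<Prod>l<Suc (k - m). V (Suc (m - 1 + l))) = V m * A"
      unfolding prod.lessThan_Suc_shift A_def using 3 by simp
    then have i2: "conn s d k (m - 1) = V m * A / (B * V (Suc (k - m))) * (C * X)"
      using Suc.IH[of "m - 1"] Suc.prems 3 unfolding k1
      by (simp add: B_def C_def X_def k2)
    have R: "(V (Suc k) - V m) * X = V (Suc (k - m)) * (s m - s (d - k))"
      using V_diff[of m k] 3 Suc.prems by (simp add: X_def k1)
    have "conn s d (Suc k) m = V m * A / (B * V (Suc (k - m))) * (C * X) + (s m - s (d - k)) * (A / B * C)"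
      using 3 i1 i2 by simp
    also have "\<dots> = A * C / (B * V (Suc (k - m))) * (V m * X + V (Suc (k - m)) * (s m - s (d - k)))"
      using B0 V0 by (simp add: field_simps)
    also have "V m * X + V (Suc (k - m)) * (s m - s (d - k)) = V (Suc k) * X"
      using R by (simp add: algebra_simps)
    also have "A * C / (B * V (Suc (k - m))) * (V (Suc k) * X) = (A * V (Suc k)) / (B * V (Suc (k - m))) * (C * X)"
      by simp
    finally show ?thesis unfolding k1 using 3
      by (simp add: A_def B_def C_def X_def k2)
  qed
qed simp

text \<open>\<open>Y p i\<close> is the cofactor of \<open>V i\<close> in varphi_i, and
  \<open>Z p k\<close> that of \<open>V k\<close> in phi_(d+1-k), where \<open>p\<close> stands for
  phi_1. The index reflection in the second case is absorbed by the symmetry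
  \<open>V_sym\<close>.\<close>

definition Y :: "complex \<Rightarrow> nat \<Rightarrow> complex" where
  "Y p i = p / W + (q^i / q) * (c' / q^i - b') * (b - c * q / (q^i * q^d))"

definition Z :: "complex \<Rightarrow> nat \<Rightarrow> complex" where
  "Z p k = p / W + (c' / q - b') * (b - c / q^d) + (c' * q^k / (q^d * q) - b') * (c / q^k - b)"

lemma fsplit_factor:
  assumes "1 \<le> i" "i \<le> d"
  shows "p * vth d \<theta> i + (s i - s 0) * (\<theta> (i - 1) - \<theta> d) = V i * Y p i"
proof -
  have e: "q^(i - 1) = q^i / q" using assms q0 by (simp add: power_diff)
  have "(s i - s 0) * (\<theta> (i - 1) - \<theta> d) = V i * ((q^i / q) * (c' / q^i - b') * (b - c * q / (q^i * q^d)))"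
    unfolding V_def ths th e using q0 by (simp add: divide_simps) algebra
  then show ?thesis using vth_eq[OF assms(2)] by (simp add: Y_def algebra_simps)
qed

lemma ssplit_factor:
  assumes "1 \<le> k" "k \<le> d"
  shows "(p + (s 1 - s 0) * (\<theta> 0 - \<theta> d)) * vth d \<theta> (d + 1 - k)
    + (s (d + 1 - k) - s 0) * (\<theta> k - \<theta> 0) = V k * Z p k"
proof -
  have e: "q^(d + 1 - k) = q^d * q / q^k" using assms q0 by (simp add: power_diff)
  have 1: "(s (d + 1 - k) - s 0) * (\<theta> k - \<theta> 0) = V k * ((c' * q^k / (q^d * q) - b') * (c / q^k - b))"
    unfolding V_def ths th e using q0 by (simp add: divide_simps) algebra
  have 2: "(s 1 - s 0) * (\<theta> 0 - \<theta> d) = W * ((c' / q - b') * (b - c / q^d))"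
    unfolding W_def ths th using q0 by (simp add: divide_simps) algebra
  have 3: "vth d \<theta> (d + 1 - k) = V k / W" using assms V_sym[of k] by (subst vth_eq) auto
  show ?thesis unfolding 1 2 3 Z_def using W by (simp add: field_simps)
qed

text \<open>Here \<open>p\<close> is the index gap and \<open>\<pi>\<close> is phi_1. The content
  lies in facts 1 and 2: the product of the two differences is \<open>V (p + 1) * U\<close>, and
  \<open>U + Y \<pi> (m + 1) = Z \<pi> k\<close>. The surplus factors \<open>V\<close> are the
  denominators that arise in the next lemma.\<close>

lemma split_factor_identity:
  assumes "k = m + p + 1" "k \<le> d"
  shows "V (m + 1) * V k * (s 0 - s (d - p)) * (\<theta> m - \<theta> k) + V (m + 1) * Y \<pi> (m + 1) * V (p + 1) * V k
    = V k * Z \<pi> k * V (m + 1) * V (p + 1)"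
proof -
  have e: "q^(d - p) = q^d / q^p" "q^k = q * q^m * q^p"
    using assms q0 by (simp_all add: power_diff power_add)
  define U where "U = q^m * (b' - c' * q^p / q^d) * (b - c / (q^m * q^k))"
  have 1: "(s 0 - s (d - p)) * (\<theta> m - \<theta> k) = V (p + 1) * (q^m * (b' - c' * q^p / q^d) * (b - c / (q^m * q^k)))"
    unfolding V_def ths th e using q0 by (simp add: divide_simps) algebra
  have 2: "q^m * (b' - c' * q^p / q^d) * (b - c / (q^m * q^k)) + Y \<pi> (m + 1) = Z \<pi> k"
    unfolding Y_def Z_def e using q0 W by (simp add: divide_simps) algebra
  show ?thesis using 1 2 unfolding U_def[symmetric] by algebra
qed

text \<open>Comparison of the coefficients of tau_m on the two sides of L eta_k = \<theta>_k eta_k +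
  phi_(d+1-k) eta_(k-1). All three connection coefficients contain the product AC/B, and cancelling
  it leaves \<open>split_factor_identity\<close>.\<close>

lemma conn_split_generic:
  assumes "m < k" "k \<le> d"
  shows "conn s d k m * (\<theta> m - \<theta> k)
     + (p * vth d \<theta> (m + 1) + (s (m + 1) - s 0) * (\<theta> m - \<theta> d)) * conn s d k (m + 1)
     = ((p + (s 1 - s 0) * (\<theta> 0 - \<theta> d)) * vth d \<theta> (d + 1 - k)
         + (s (d + 1 - k) - s 0) * (\<theta> k - \<theta> 0)) * conn s d (k - 1) m"
proof -
  define r where "r = k - m - 1"
  have k: "k = m + r + 1" using assms by (simp add: r_def)
  define A where "A = (\<Prod>l<r. V (Suc (Suc (m + l))))"
  define B where "B = (\<Prod>l<r. V (Suc l))"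
  define C where "C = (\<Prod>l<r. s 0 - s (d - l))"
  have nz: "B \<noteq> 0" "V (r + 1) \<noteq> 0" "V k \<noteq> 0"
    using assms k V_nonzero by (auto simp: B_def)
  have j: "k - (m + 1) = r" "k - m = Suc r" "k - 1 - m = r" "m + 1 \<le> k" "m \<le> k" "m \<le> k - 1" "k - 1 \<le> d"
    using assms k by auto
  have 1: "conn s d k (m + 1) = A / B * C"
    unfolding conn_closed_form[OF assms(2) j(4)] j by (simp add: A_def B_def C_def)
  have "(\<Prod>l<Suc r. V (Suc (m + l))) = V (m + 1) * A"
    unfolding prod.lessThan_Suc_shift A_def by simp
  then have 2: "conn s d k m = V (m + 1) * A / (B * V (r + 1)) * (C * (s 0 - s (d - r)))"
    and 3: "(\<Prod>l<r. V (Suc (m + l))) * V k = V (m + 1) * A"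
    unfolding conn_closed_form[OF assms(2) j(5)] j using k by (simp_all add: B_def C_def)
  have "conn s d (k - 1) m = (\<Prod>l<r. V (Suc (m + l))) / B * C"
    unfolding conn_closed_form[OF j(7) j(6)] j by (simp add: B_def C_def)
  also have "(\<Prod>l<r. V (Suc (m + l))) = V (m + 1) * A / V k" using 3 nz by (simp add: eq_divide_eq)
  finally have 4: "conn s d (k - 1) m = V (m + 1) * A / V k / B * C" .
  have 5: "p * vth d \<theta> (m + 1) + (s (m + 1) - s 0) * (\<theta> m - \<theta> d) = V (m + 1) * Y p (m + 1)"
    using fsplit_factor[of "m + 1"] assms by simp
  have 6: "(p + (s 1 - s 0) * (\<theta> 0 - \<theta> d)) * vth d \<theta> (d + 1 - k)
         + (s (d + 1 - k) - s 0) * (\<theta> k - \<theta> 0) = V k * Z p k"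
    using assms by (intro ssplit_factor) auto
  note yz = split_factor_identity[OF k assms(2), of p]
  have "V k * (V (m + 1) * ((s 0 - s (d - r)) * (\<theta> m - \<theta> k)) + V (m + 1) * Y p (m + 1) * V (r + 1))
    = V k * (Z p k * V (m + 1) * V (r + 1))"
    using yz by (simp only: distrib_left mult_ac)
  then have yz': "V (m + 1) * ((s 0 - s (d - r)) * (\<theta> m - \<theta> k)) + V (m + 1) * Y p (m + 1) * V (r + 1)
    = Z p k * V (m + 1) * V (r + 1)"
    using nz by simp
  have "V (m + 1) * A / (B * V (r + 1)) * (C * (s 0 - s (d - r))) * (\<theta> m - \<theta> k)
      + V (m + 1) * Y p (m + 1) * (A / B * C)
    = (V (m + 1) * ((s 0 - s (d - r)) * (\<theta> m - \<theta> k)) + V (m + 1) * Y p (m + 1) * V (r + 1))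
        * (A * C / (B * V (r + 1)))"
    using nz by (simp add: field_simps)
  also have "\<dots> = V k * Z p k * (V (m + 1) * A / V k / B * C)"
    unfolding yz' using nz by (simp add: field_simps)
  finally show ?thesis unfolding 1 2 4 5 6 .
qed

text \<open>The bracket on the left is phi_d - phi_1. The identity therefore says that the formula
  for varphi_i and its dual, in which \<theta> and s are exchanged and phi_d replaces phi_1, give
  the same number.\<close>

lemma dual_split_generic:
  assumes "1 \<le> i" "i \<le> d"
  shows "vth d \<theta> i * ((s 1 - s 0) * (\<theta> 0 - \<theta> d) + (s d - s 0) * (\<theta> 1 - \<theta> 0))
    = (s i - s 0) * (\<theta> (i - 1) - \<theta> d) - (\<theta> i - \<theta> 0) * (s (i - 1) - s d)"
proof -
  have e: "q^(i - 1) = q^i / q" using assms q0 by (simp add: power_diff)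
  have 1: "(s 1 - s 0) * (\<theta> 0 - \<theta> d) + (s d - s 0) * (\<theta> 1 - \<theta> 0) = W * ((c' * b - c * b') * (1/q - 1/q^d))"
    unfolding W_def ths th using q0 by (simp add: divide_simps) algebra
  have 2: "(s i - s 0) * (\<theta> (i - 1) - \<theta> d) - (\<theta> i - \<theta> 0) * (s (i - 1) - s d)
     = V i * ((c' * b - c * b') * (1/q - 1/q^d))"
    unfolding V_def ths th e using q0 by (simp add: divide_simps) algebra
  show ?thesis unfolding 1 2 vth_eq[OF assms(2)] using W by simp
qed

end

section \<open>From generic q to arbitrary recurrent sequences\<close>

lemma conn_cong:
  assumes "\<And>n. n \<le> d \<Longrightarrow> s n = s' n"
  shows "k \<le> d \<Longrightarrow> conn s d k m = conn s' d k m"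
proof (induction k arbitrary: m)
  case (Suc k)
  show ?case
  proof (cases "m \<le> d")
    case True
    then show ?thesis using Suc assms[of m] assms[of "d - k"] by simp
  next
    case False
    then show ?thesis using Suc.prems by (simp add: conn_eq_0 del: conn.simps)
  qed
qed simp

lemma isCont_conn:
  assumes "\<And>n. isCont (\<lambda>q. s q n) q0"
  shows "isCont (\<lambda>q. conn (s q) d k m) q0"
proof (induction k arbitrary: m)
  case (Suc k)
  show ?case
    by (cases "m = 0") (auto intro!: continuous_intros assms Suc)
qed simp

lemma isCont_vth:
  assumes "\<And>n. isCont (\<lambda>q. s q n) q0" "s q0 0 \<noteq> s q0 d"
  shows "isCont (\<lambda>q. vth d (s q) i) q0"
  unfolding vth_def using assms by (intro continuous_intros) auto

text \<open>The two inequalities are the nonvanishing of the denominators of \<open>vth\<close> for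
  \<theta> and for s, a condition that survives a small change of q.\<close>

locale recurrent_pair =
  fixes d :: nat and \<theta> s :: "nat \<Rightarrow> complex" and r :: complex
  assumes d: "1 \<le> d"
    and rec_th: "\<And>n. n + 3 \<le> d \<Longrightarrow> \<theta> (n + 3) = \<theta> n - r * (\<theta> (n + 1) - \<theta> (n + 2))"
    and rec_s: "\<And>n. n + 3 \<le> d \<Longrightarrow> s (n + 3) = s n - r * (s (n + 1) - s (n + 2))"
    and ne_th: "\<theta> 0 \<noteq> \<theta> d" and ne_s: "s 0 \<noteq> s d"
begin

definition \<Theta> :: "complex \<Rightarrow> nat \<Rightarrow> complex" where "\<Theta> q = rec3 q (\<theta> 0) (\<theta> 1) (\<theta> 2)"
definition S :: "complex \<Rightarrow> nat \<Rightarrow> complex" where "S q = rec3 q (s 0) (s 1) (s 2)"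

text \<open>
  A passage to the limit is needed: for \<open>q = -1\<close> and odd \<open>d\<close>, which does occur,
  \<open>\<vartheta>\<^sub>i = 0\<close> for even \<open>i\<close> and the product formula for the connection coefficients divides by zero.
\<close>

lemma zero_by_limit:
  fixes P :: "(nat \<Rightarrow> complex) \<Rightarrow> (nat \<Rightarrow> complex) \<Rightarrow> complex"
  assumes cong: "\<And>\<theta>' s'. (\<And>n. n \<le> d \<Longrightarrow> \<theta>' n = \<theta> n \<and> s' n = s n) \<Longrightarrow> P \<theta>' s' = P \<theta> s"
    and cont: "\<And>q. q \<noteq> 0 \<Longrightarrow> \<Theta> q 0 \<noteq> \<Theta> q d \<Longrightarrow> S q 0 \<noteq> S q d \<Longrightarrow> isCont (\<lambda>q. P (\<Theta> q) (S q)) q"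
    and gen: "\<And>q a b c a' b' c'. q_form d q a b c a' b' c' (\<Theta> q) (S q)
        \<Longrightarrow> q_form d q a' b' c' a b c (S q) (\<Theta> q) \<Longrightarrow> P (\<Theta> q) (S q) = 0"
  shows "P \<theta> s = 0"
proof -
  obtain q0 where q0: "q0 \<noteq> 0" "r = q0 + 1/q0 + 1" by (rule ex_q_plus_inverse)
  have eq: "\<Theta> q0 n = \<theta> n" "S q0 n = s n" if "n \<le> d" for n
    unfolding \<Theta>_def S_def
    using rec3_exists[of d \<theta> r q0 n, OF rec_th q0(2) that] rec3_exists[of d s r q0 n, OF rec_s q0(2) that] by simp_all
  have c: "isCont (\<lambda>q. \<Theta> q n) q0" "isCont (\<lambda>q. S q n) q0" for n
    unfolding \<Theta>_def S_def using q0(1) by (auto intro: isCont_rec3)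
  have "P (\<Theta> q0) (S q0) = 0"
  proof (rule zero_by_generic_limit[OF q0(1), where R = "\<lambda>q. (\<Theta> q 0 - \<Theta> q d) * (S q 0 - S q d)" and d = d])
    show "isCont (\<lambda>q. P (\<Theta> q) (S q)) q0"
      using q0 ne_th ne_s by (intro cont) (auto simp: eq)
    show "isCont (\<lambda>q. (\<Theta> q 0 - \<Theta> q d) * (S q 0 - S q d)) q0"
      by (intro continuous_intros c)
    show "(\<Theta> q0 0 - \<Theta> q0 d) * (S q0 0 - S q0 d) \<noteq> 0"
      using ne_th ne_s by (simp add: eq)
  next
    fix q assume g: "generic d q" and n: "(\<Theta> q 0 - \<Theta> q d) * (S q 0 - S q d) \<noteq> 0"
    have l: "l \<in> {1..d + 1} \<Longrightarrow> q^l \<noteq> 1" for l using g unfolding generic_def by blast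
    have q: "q \<noteq> 0" "q \<noteq> 1" "q^2 \<noteq> 1" using g l[of 1] l[of 2] d unfolding generic_def by simp_all
    obtain a b c where 1: "\<And>n. \<Theta> q n = a + b * q^n + c / q^n"
      unfolding \<Theta>_def using rec3_closed_form[OF q] by metis
    obtain a' b' c' where 2: "\<And>n. S q n = a' + b' * q^n + c' / q^n"
      unfolding S_def using rec3_closed_form[OF q] by metis
    have n': "\<Theta> q 0 \<noteq> \<Theta> q d" "S q 0 \<noteq> S q d" using n by simp_all
    show "P (\<Theta> q) (S q) = 0"
      by (rule gen; unfold_locales) (rule g d 1 2 n')+
  qed
  then show ?thesis using cong[of "\<Theta> q0" "S q0"] eq by simp
qed

lemma vth_cong: 
  assumes "\<And>n. n \<le> d \<Longrightarrow> \<theta>' n = \<theta> n" "i \<le> d + 1" shows "vth d \<theta>' i = vth d \<theta> i"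
  using assms by (auto simp: vth_def intro!: arg_cong2[where f = "(/)"] sum.cong)

lemma cont_ThS:
  assumes "q \<noteq> 0" shows "isCont (\<lambda>q. \<Theta> q n) q" "isCont (\<lambda>q. S q n) q"
  unfolding \<Theta>_def S_def using assms by (auto intro: isCont_rec3)

lemma vth_sym: assumes "1 \<le> i" "i \<le> d" shows "vth d \<theta> (d + 1 - i) = vth d \<theta> i"
proof -
  have "vth d \<theta> (d + 1 - i) - vth d \<theta> i = 0"
  proof (rule zero_by_limit[where P = "\<lambda>\<theta> s. vth d \<theta> (d + 1 - i) - vth d \<theta> i"])
    fix q a b c a' b' c' assume "q_form d q a b c a' b' c' (\<Theta> q) (S q)"
    then interpret q_form d q a b c a' b' c' "\<Theta> q" "S q" .
    show "vth d (\<Theta> q) (d + 1 - i) - vth d (\<Theta> q) i = 0"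
      using assms V_sym[of i] by (subst (1 2) vth_eq) auto
  next
    fix \<theta>' s' :: "nat \<Rightarrow> complex" assume "\<And>n. n \<le> d \<Longrightarrow> \<theta>' n = \<theta> n \<and> s' n = s n"
    then show "vth d \<theta>' (d + 1 - i) - vth d \<theta>' i = vth d \<theta> (d + 1 - i) - vth d \<theta> i"
      using assms vth_cong[of \<theta>'] by simp
  qed (intro continuous_intros isCont_vth cont_ThS; assumption)
  then show ?thesis by simp
qed

text \<open>For generic q both sides equal V i / W with the same q, since vartheta does not see the
  coefficients a, b, c of the sequence.\<close>

lemma vth_dual: assumes "i \<le> d" shows "vth d s i = vth d \<theta> i"
proof -
  have "vth d s i - vth d \<theta> i = 0"
  proof (rule zero_by_limit[where P = "\<lambda>\<theta> s. vth d s i - vth d \<theta> i"])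
    fix q a b c a' b' c' assume 1: "q_form d q a b c a' b' c' (\<Theta> q) (S q)" and 2: "q_form d q a' b' c' a b c (S q) (\<Theta> q)"
    show "vth d (S q) i - vth d (\<Theta> q) i = 0"
      using q_form.vth_eq[OF 1 assms] q_form.vth_eq[OF 2 assms]
      by (simp add: q_form.V_def[OF 1] q_form.V_def[OF 2] q_form.W_def[OF 1] q_form.W_def[OF 2])
  next
    fix \<theta>' s' assume "\<And>n. n \<le> d \<Longrightarrow> \<theta>' n = \<theta> n \<and> s' n = s n"
    then show "vth d s' i - vth d \<theta>' i = vth d s i - vth d \<theta> i"
      using assms by (auto simp: vth_def intro!: arg_cong2[where f = "(-)"] arg_cong2[where f = "(/)"] sum.cong)
  qed (intro continuous_intros isCont_vth cont_ThS; assumption)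
  then show ?thesis by simp
qed

lemma dual_split:
  assumes "1 \<le> i" "i \<le> d"
  shows "vth d \<theta> i * ((s 1 - s 0) * (\<theta> 0 - \<theta> d) + (s d - s 0) * (\<theta> 1 - \<theta> 0))
    = (s i - s 0) * (\<theta> (i - 1) - \<theta> d) - (\<theta> i - \<theta> 0) * (s (i - 1) - s d)"
proof -
  have "vth d \<theta> i * ((s 1 - s 0) * (\<theta> 0 - \<theta> d) + (s d - s 0) * (\<theta> 1 - \<theta> 0))
    - ((s i - s 0) * (\<theta> (i - 1) - \<theta> d) - (\<theta> i - \<theta> 0) * (s (i - 1) - s d)) = 0" (is "?P \<theta> s = 0")
  proof (rule zero_by_limit[where P = ?P])
    fix q a b c a' b' c' assume "q_form d q a b c a' b' c' (\<Theta> q) (S q)"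
    then show "?P (\<Theta> q) (S q) = 0"
      using q_form.dual_split_generic[OF _ assms] by fastforce
  next
    fix \<theta>' s' assume *: "\<And>n. n \<le> d \<Longrightarrow> \<theta>' n = \<theta> n \<and> s' n = s n"
    have "\<theta>' 0 = \<theta> 0" "s' 0 = s 0" "\<theta>' 1 = \<theta> 1" "s' 1 = s 1" "\<theta>' d = \<theta> d" "s' d = s d"
      "\<theta>' i = \<theta> i" "s' i = s i" "\<theta>' (i - 1) = \<theta> (i - 1)" "s' (i - 1) = s (i - 1)" "vth d \<theta>' i = vth d \<theta> i"
      using * d assms by (auto intro: vth_cong)
    then show "?P \<theta>' s' = ?P \<theta> s" by simp
  qed (intro continuous_intros isCont_vth cont_ThS; assumption)
  then show ?thesis by simp
qed

text \<open>The constant \<open>p\<close> stays fixed while q varies, so the bracketed split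
  sequences deform together with the eigenvalues and every term is continuous in q.\<close>

lemma conn_split:
  assumes "m < k" "k \<le> d"
  shows "conn s d k m * (\<theta> m - \<theta> k)
     + (p * vth d \<theta> (m + 1) + (s (m + 1) - s 0) * (\<theta> m - \<theta> d)) * conn s d k (m + 1)
     = ((p + (s 1 - s 0) * (\<theta> 0 - \<theta> d)) * vth d \<theta> (d + 1 - k)
         + (s (d + 1 - k) - s 0) * (\<theta> k - \<theta> 0)) * conn s d (k - 1) m"
proof -
  have "conn s d k m * (\<theta> m - \<theta> k)
     + (p * vth d \<theta> (m + 1) + (s (m + 1) - s 0) * (\<theta> m - \<theta> d)) * conn s d k (m + 1)
     - ((p + (s 1 - s 0) * (\<theta> 0 - \<theta> d)) * vth d \<theta> (d + 1 - k)
         + (s (d + 1 - k) - s 0) * (\<theta> k - \<theta> 0)) * conn s d (k - 1) m = 0" (is "?P \<theta> s = 0")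
  proof (rule zero_by_limit[where P = ?P])
    fix q a b c a' b' c' assume "q_form d q a b c a' b' c' (\<Theta> q) (S q)"
    from q_form.conn_split_generic[OF this assms, of p] show "?P (\<Theta> q) (S q) = 0" by simp
  next
    fix \<theta>' s' assume *: "\<And>n. n \<le> d \<Longrightarrow> \<theta>' n = \<theta> n \<and> s' n = s n"
    have "\<theta>' 0 = \<theta> 0" "s' 0 = s 0" "s' 1 = s 1" "\<theta>' d = \<theta> d" "\<theta>' k = \<theta> k" "\<theta>' m = \<theta> m"
      "s' (m + 1) = s (m + 1)" "s' (d + 1 - k) = s (d + 1 - k)"
      "vth d \<theta>' (m + 1) = vth d \<theta> (m + 1)" "vth d \<theta>' (d + 1 - k) = vth d \<theta> (d + 1 - k)"
      "conn s' d k m = conn s d k m" "conn s' d k (m + 1) = conn s d k (m + 1)"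
      "conn s' d (k - 1) m = conn s d (k - 1) m"
      using * d assms by (auto intro!: vth_cong conn_cong)
    then show "?P \<theta>' s' = ?P \<theta> s" by simp
  qed (intro continuous_intros isCont_vth cont_ThS isCont_conn; assumption)
  then show ?thesis by simp
qed

end

section \<open>Leonard pair theory of a parameter array\<close>

lemma prod_int_atLeast0: "(\<Prod>h\<in>{0..int n - 1}. F h) = (\<Prod>h<n. F (int h))"
  by (rule prod.reindex_bij_witness[of _ int nat]) auto

lemma sum_int_atLeast0: "(\<Sum>h\<in>{0..int n - 1}. F h) = (\<Sum>h<n. F (int h))"
  by (rule sum.reindex_bij_witness[of _ int nat]) auto

lemma sum_int_atLeastAtMost0: "(\<Sum>h\<in>{0..int n}. F h) = (\<Sum>h\<le>n. F (int h))"
  by (rule sum.reindex_bij_witness[of _ int nat]) auto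

lemma prod_int_atLeast1: "(\<Prod>h\<in>{1..int n}. F h) = (\<Prod>h<n. F (int (Suc h)))"
  by (rule prod.reindex_bij_witness[of _ "\<lambda>h. int (Suc h)" "\<lambda>h. nat (h - 1)"]) auto

text \<open>Back substitution, the last unknown first. With F k j = tau_k(j) it produces a row
  \<open>l\<close> of coefficients whose pairing with each tau_k is prescribed.\<close>

lemma triangular_system_solvable:
  fixes F :: "nat \<Rightarrow> nat \<Rightarrow> complex"
  assumes "\<And>k j. k \<le> n \<Longrightarrow> j < k \<Longrightarrow> F k j = 0" "\<And>k. k \<le> n \<Longrightarrow> F k k \<noteq> 0"
  shows "\<exists>l. \<forall>k\<le>n. (\<Sum>j\<le>n. l j * F k j) = v k"
  using assms
proof (induction n arbitrary: v)
  case 0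
  then show ?case by (intro exI[of _ "\<lambda>_. v 0 / F 0 0"]) auto
next
  case (Suc n)
  define c where "c = v (Suc n) / F (Suc n) (Suc n)"
  obtain l where l: "\<And>k. k \<le> n \<Longrightarrow> (\<Sum>j\<le>n. l j * F k j) = v k - c * F k (Suc n)"
    using Suc.IH[of "\<lambda>k. v k - c * F k (Suc n)"] Suc.prems by auto
  have "(\<Sum>j\<le>Suc n. (l(Suc n := c)) j * F k j) = v k" if k: "k \<le> Suc n" for k
  proof -
    have *: "(\<Sum>j\<le>n. (l(Suc n := c)) j * F k j) = (\<Sum>j\<le>n. l j * F k j)"
      by (intro sum.cong) auto
    show ?thesis
    proof (cases "k = Suc n")
      case True
      have "(\<Sum>j\<le>n. l j * F k j) = 0" using Suc.prems(1)[of k] True by (intro sum.neutral) auto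
      then show ?thesis unfolding sum.atMost_Suc * using Suc.prems(2)[of "Suc n"] True by (simp add: c_def)
    next
      case False
      then show ?thesis unfolding sum.atMost_Suc * using k l[of k] by simp
    qed
  qed
  then show ?case by blast
qed

locale leonard =
  fixes \<Phi> :: param_array
  assumes pa: "is_param_array \<Phi>"
begin

definition d :: nat where "d = nat (pa_diam \<Phi>)"
definition \<theta> :: "nat \<Rightarrow> complex" where "\<theta> n = pa_eig \<Phi> (int n)"
definition s :: "nat \<Rightarrow> complex" where "s n = pa_deig \<Phi> (int n)"
definition f :: "nat \<Rightarrow> complex" where "f n = pa_fsplit \<Phi> (int n)"
definition g :: "nat \<Rightarrow> complex" where "g n = pa_ssplit \<Phi> (int n)"

lemma diam: "pa_diam \<Phi> = int d"
  using pa by (auto simp: is_param_array_def Let_def d_def)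

lemma param_array_conditions:
  "\<forall>i\<in>{1..int d}. pa_fsplit \<Phi> i \<noteq> 0 \<and> pa_ssplit \<Phi> i \<noteq> 0"
  "inj_on (pa_eig \<Phi>) {0..int d}" "inj_on (pa_deig \<Phi>) {0..int d}"
  "\<forall>i\<in>{1..int d}.
      pa_fsplit \<Phi> i = pa_ssplit \<Phi> 1 * pa_vartheta \<Phi> i + (pa_deig \<Phi> i - pa_deig \<Phi> 0) * (pa_eig \<Phi> (i-1) - pa_eig \<Phi> (int d)) \<and>
      pa_ssplit \<Phi> i = pa_fsplit \<Phi> 1 * pa_vartheta \<Phi> i + (pa_deig \<Phi> i - pa_deig \<Phi> 0) * (pa_eig \<Phi> (int d - i + 1) - pa_eig \<Phi> 0)"
  "\<exists>r. \<forall>i\<in>{2..int d - 1}.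
      (pa_eig \<Phi> (i - 2) - pa_eig \<Phi> (i + 1)) / (pa_eig \<Phi> (i - 1) - pa_eig \<Phi> i) = r \<and>
      (pa_deig \<Phi> (i - 2) - pa_deig \<Phi> (i + 1)) / (pa_deig \<Phi> (i - 1) - pa_deig \<Phi> i) = r"
  by (insert pa; unfold is_param_array_def Let_def diam; elim conjE; assumption)+

lemma fg_nz: assumes "1 \<le> i" "i \<le> d" shows "f i \<noteq> 0" "g i \<noteq> 0"
  using param_array_conditions(1) assms by (auto simp: f_def g_def)

lemma th_inj: assumes "i \<le> d" "j \<le> d" "i \<noteq> j" shows "\<theta> i \<noteq> \<theta> j"
  using inj_onD[OF param_array_conditions(2), of "int i" "int j"] assms by (auto simp: \<theta>_def)

lemma s_inj: assumes "i \<le> d" "j \<le> d" "i \<noteq> j" shows "s i \<noteq> s j"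
  using inj_onD[OF param_array_conditions(3), of "int i" "int j"] assms by (auto simp: s_def)

lemma vartheta_eq: assumes "i \<le> d" shows "pa_vartheta \<Phi> (int i) = vth d \<theta> i"
  using assms unfolding pa_vartheta_def vth_def sum_int_atLeast0 sum_divide_distrib diam \<theta>_def
  by (intro sum.cong) (auto simp: of_nat_diff)

lemma f_eq: assumes "1 \<le> i" "i \<le> d"
  shows "f i = g 1 * vth d \<theta> i + (s i - s 0) * (\<theta> (i - 1) - \<theta> d)"
proof -
  have i: "int i \<in> {1..int d}" and e: "int i - 1 = int (i - 1)" using assms by auto
  show ?thesis
    using bspec[OF param_array_conditions(4) i] unfolding f_def g_def s_def \<theta>_def vartheta_eq[OF assms(2), symmetric] e
    by (simp only: of_nat_1 of_nat_0)
qed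

lemma g_eq: assumes "1 \<le> i" "i \<le> d"
  shows "g i = f 1 * vth d \<theta> i + (s i - s 0) * (\<theta> (d + 1 - i) - \<theta> 0)"
proof -
  have i: "int i \<in> {1..int d}" and e: "int d - int i + 1 = int (d + 1 - i)" using assms by auto
  show ?thesis
    using bspec[OF param_array_conditions(4) i] unfolding f_def g_def s_def \<theta>_def vartheta_eq[OF assms(2), symmetric] e
    by (simp only: of_nat_1 of_nat_0)
qed

lemma f_1: assumes "1 \<le> d" shows "f 1 = g 1 + (s 1 - s 0) * (\<theta> 0 - \<theta> d)"
proof -
  have "vth d \<theta> 1 = 1" using th_inj[of 0 d] assms by (simp add: vth_def)
  then show ?thesis using f_eq[of 1] assms by simp
qed

lemma recurrence: 
  obtains r where "\<And>n. n + 3 \<le> d \<Longrightarrow> \<theta> (n + 3) = \<theta> n - r * (\<theta> (n + 1) - \<theta> (n + 2))"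
    "\<And>n. n + 3 \<le> d \<Longrightarrow> s (n + 3) = s n - r * (s (n + 1) - s (n + 2))"
proof -
  obtain r where r: "\<And>i. i \<in> {2..int d - 1} \<Longrightarrow>
      (pa_eig \<Phi> (i - 2) - pa_eig \<Phi> (i + 1)) / (pa_eig \<Phi> (i - 1) - pa_eig \<Phi> i) = r \<and>
      (pa_deig \<Phi> (i - 2) - pa_deig \<Phi> (i + 1)) / (pa_deig \<Phi> (i - 1) - pa_deig \<Phi> i) = r"
    using param_array_conditions(5) by (elim exE) (rule that, erule (1) bspec)
  have "\<theta> (n + 3) = \<theta> n - r * (\<theta> (n + 1) - \<theta> (n + 2)) \<and> s (n + 3) = s n - r * (s (n + 1) - s (n + 2))"
    if n: "n + 3 \<le> d" for n
  proof -
    have e: "int (n + 2) - 2 = int n" "int (n + 2) + 1 = int (n + 3)" "int (n + 2) - 1 = int (n + 1)"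
      by auto
    have "int (n + 2) \<in> {2..int d - 1}" using n by auto
    from r[OF this] have "(\<theta> n - \<theta> (n + 3)) / (\<theta> (n + 1) - \<theta> (n + 2)) = r \<and>
      (s n - s (n + 3)) / (s (n + 1) - s (n + 2)) = r"
      unfolding e \<theta>_def s_def .
    then have "(\<theta> n - \<theta> (n + 3)) / (\<theta> (n + 1) - \<theta> (n + 2)) = r"
      "(s n - s (n + 3)) / (s (n + 1) - s (n + 2)) = r" by blast+
    moreover have "\<theta> (n + 1) - \<theta> (n + 2) \<noteq> 0" "s (n + 1) - s (n + 2) \<noteq> 0"
      using n th_inj[of "n + 1" "n + 2"] s_inj[of "n + 1" "n + 2"] by auto
    ultimately have "\<theta> n - \<theta> (n + 3) = r * (\<theta> (n + 1) - \<theta> (n + 2))" "s n - s (n + 3) = r * (s (n + 1) - s (n + 2))"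
      by (simp_all only: divide_eq_eq if_False if_True not_False_eq_True)
    then show ?thesis by (intro conjI; simp only: diff_eq_eq eq_diff_eq add.commute)
  qed
  then show ?thesis using that by blast
qed

lemma recurrent_pair: assumes "1 \<le> d" obtains r where "recurrent_pair d \<theta> s r"
proof -
  obtain r where "\<And>n. n + 3 \<le> d \<Longrightarrow> \<theta> (n + 3) = \<theta> n - r * (\<theta> (n + 1) - \<theta> (n + 2))"
    "\<And>n. n + 3 \<le> d \<Longrightarrow> s (n + 3) = s n - r * (s (n + 1) - s (n + 2))" using recurrence by blast
  then have "recurrent_pair d \<theta> s r"
    using assms th_inj[of 0 d] s_inj[of 0 d] by unfold_locales auto
  then show ?thesis using that by blast
qed

lemma split_identity:
  assumes "m < k" "k \<le> d"
  shows "conn s d k m * (\<theta> m - \<theta> k) + f (m + 1) * conn s d k (m + 1) = g (d + 1 - k) * conn s d (k - 1) m"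
proof -
  have d1: "1 \<le> d" using assms by simp
  then obtain r where "recurrent_pair d \<theta> s r" by (rule recurrent_pair)
  from recurrent_pair.conn_split[OF this assms, of "g 1"] show ?thesis
    using f_eq[of "m + 1"] g_eq[of "d + 1 - k"] f_1[OF d1] assms by simp
qed

text \<open>The first entry of the dual second split sequence is phi_d. The dual formula for
  varphi_i is then \<open>dual_split\<close>, and the one for phi_(d+1-i) is the original formula at
  the reflected index, by the symmetry of vartheta.\<close>

lemma dual_is_param_array: "is_param_array (pa_dual \<Phi>)"
proof -
  have *: "pa_fsplit \<Phi> i = pa_ssplit \<Phi> (int d) * pa_vartheta (pa_dual \<Phi>) i
        + (pa_eig \<Phi> i - pa_eig \<Phi> 0) * (pa_deig \<Phi> (i - 1) - pa_deig \<Phi> (int d)) \<and>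
      pa_ssplit \<Phi> (int d - i + 1) = pa_fsplit \<Phi> 1 * pa_vartheta (pa_dual \<Phi>) i
        + (pa_eig \<Phi> i - pa_eig \<Phi> 0) * (pa_deig \<Phi> (int d - i + 1) - pa_deig \<Phi> 0)"
    if "i \<in> {1..int d}" for i
  proof -
    define n where "n = nat i"
    have n: "i = int n" "1 \<le> n" "n \<le> d" "1 \<le> d" using that by (auto simp: n_def)
    have e: "int n - 1 = int (n - 1)" "int d - int n + 1 = int (d + 1 - n)"
      using n by auto
    obtain r where r: "recurrent_pair d \<theta> s r" using recurrent_pair n(4) .
    have v: "pa_vartheta (pa_dual \<Phi>) i = vth d \<theta> n"
    proof -
      have "pa_vartheta (pa_dual \<Phi>) i = vth d s n"
        using n unfolding pa_vartheta_def vth_def n(1) sum_int_atLeast0 sum_divide_distrib s_def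
        by (intro sum.cong) (auto simp: pa_dual_def diam of_nat_diff)
      then show ?thesis using recurrent_pair.vth_dual[OF r n(3)] by simp
    qed
    \<comment> \<open>The second split formula at i = d, where vartheta_d = vartheta_1 = 1 by
      symmetry.\<close>
    have gd: "g d = f 1 + (s d - s 0) * (\<theta> 1 - \<theta> 0)"
    proof -
      have "vth d \<theta> d = 1"
        using recurrent_pair.vth_sym[OF r, of 1] th_inj[of 0 d] n by (simp add: vth_def)
      then show ?thesis using g_eq[of d] n by simp
    qed
    have 1: "f n = g d * vth d \<theta> n + (\<theta> n - \<theta> 0) * (s (n - 1) - s d)"
      using f_eq[OF n(2,3)] recurrent_pair.dual_split[OF r n(2,3)]
      unfolding gd f_1[OF n(4)] by algebra
    have 2: "g (d + 1 - n) = f 1 * vth d \<theta> n + (\<theta> n - \<theta> 0) * (s (d + 1 - n) - s 0)"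
      using g_eq[of "d + 1 - n"] n recurrent_pair.vth_sym[OF r n(2,3)] by (simp add: mult.commute)
    show ?thesis
      unfolding v unfolding n(1) e using 1 2 unfolding f_def g_def s_def \<theta>_def of_nat_1 of_nat_0
      by (rule conjI)
  qed
  have diam': "pa_diam (pa_dual \<Phi>) = int d" "pa_eig (pa_dual \<Phi>) = pa_deig \<Phi>"
    "pa_deig (pa_dual \<Phi>) = pa_eig \<Phi>" "pa_fsplit (pa_dual \<Phi>) = pa_fsplit \<Phi>"
    "pa_ssplit (pa_dual \<Phi>) = (\<lambda>j. pa_ssplit \<Phi> (int d - j + 1))"
    by (simp_all add: pa_dual_def diam)
  have 5: "\<exists>r. \<forall>i\<in>{2..int d - 1}.
      (pa_deig \<Phi> (i - 2) - pa_deig \<Phi> (i + 1)) / (pa_deig \<Phi> (i - 1) - pa_deig \<Phi> i) = r \<and>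
      (pa_eig \<Phi> (i - 2) - pa_eig \<Phi> (i + 1)) / (pa_eig \<Phi> (i - 1) - pa_eig \<Phi> i) = r"
    using param_array_conditions(5) by blast
  have 1: "pa_fsplit \<Phi> i \<noteq> 0 \<and> pa_ssplit \<Phi> (int d - i + 1) \<noteq> 0" if "i \<in> {1..int d}" for i
    using param_array_conditions(1) that by auto
  show ?thesis
    unfolding is_param_array_def Let_def diam'
    using 1 * 5 param_array_conditions(2,3) by (intro conjI ballI) auto
qed

definition \<tau> :: "nat \<Rightarrow> nat \<Rightarrow> complex" where "\<tau> k i = newton s k (s i)"
definition \<eta> :: "nat \<Rightarrow> nat \<Rightarrow> complex" where "\<eta> k i = newton (\<lambda>h. s (d - h)) k (s i)"

lemma tau_0[simp]: "\<tau> 0 i = 1" and eta_0[simp]: "\<eta> 0 i = 1"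
  by (simp_all add: \<tau>_def \<eta>_def newton_def)

lemma tau_Suc: "\<tau> (Suc k) i = \<tau> k i * (s i - s k)" by (simp add: \<tau>_def newton_def)

lemma tau_eq_0: "i < k \<Longrightarrow> \<tau> k i = 0" by (auto simp: \<tau>_def newton_def)

lemma tau_nz: "k \<le> i \<Longrightarrow> i \<le> d \<Longrightarrow> \<tau> k i \<noteq> 0"
  using s_inj by (auto simp: \<tau>_def newton_def)

lemma eta_eq_0: assumes "d - k < i" "i \<le> d" shows "\<eta> k i = 0"
proof -
  have "d - i < k" "s i - s (d - (d - i)) = 0" using assms by auto
  then show ?thesis by (auto simp: \<eta>_def newton_def)
qed

lemma eta_nz: "k \<le> d - i \<Longrightarrow> i \<le> d \<Longrightarrow> \<eta> k i \<noteq> 0"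
  using s_inj by (force simp: \<eta>_def newton_def)

lemma eta_expand: "k \<le> d \<Longrightarrow> \<eta> k i = (\<Sum>m\<le>d. conn s d k m * \<tau> m i)"
  unfolding \<eta>_def \<tau>_def by (rule newton_rev_expand)

definition B :: "nat \<Rightarrow> complex" where
  "B i = (if i = d then 0 else f (i + 1) * \<tau> i i / \<tau> (i + 1) (i + 1))"
definition C :: "nat \<Rightarrow> complex" where
  "C i = (if i = 0 then 0 else g i * \<eta> (d - i) i / \<eta> (d - i + 1) (i - 1))"
definition A :: "nat \<Rightarrow> complex" where
  "A i = \<theta> i + (if i = 0 then 0 else f i / (s i - s (i - 1))) + (if i = d then 0 else f (i + 1) / (s i - s (i + 1)))"

text \<open>At i = 0 the truncated index i - 1 is harmless because \<open>C 0 = 0\<close>; at i = d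
  the value at i + 1 is harmless because \<open>B d = 0\<close>.\<close>

definition L :: "(nat \<Rightarrow> complex) \<Rightarrow> nat \<Rightarrow> complex" where
  "L F i = C i * F (i - 1) + A i * F i + B i * F (i + 1)"

text \<open>Since \<open>L\<close> is defined by its closed coefficients, the proof runs backwards:
  at a fixed \<open>i\<close>, a row \<open>l\<close> is built that acts on the tau_k as required,
  \<open>split_identity\<close> gives its action on the eta_k, and the row is then shown to be that
  of \<open>L\<close>.\<close>

lemma L_tau_eta:
  assumes i: "i \<le> d"
  shows "k \<le> d \<Longrightarrow> L (\<tau> k) i = \<theta> k * \<tau> k i + (if k = 0 then 0 else f k * \<tau> (k - 1) i)" (is "?a \<Longrightarrow> ?c")
    and "k \<le> d \<Longrightarrow> L (\<eta> k) i = \<theta> k * \<eta> k i + (if k = 0 then 0 else g (d + 1 - k) * \<eta> (k - 1) i)" (is "?b \<Longrightarrow> ?d")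
proof -
  define v where "v k = \<theta> k * \<tau> k i + (if k = 0 then 0 else f k * \<tau> (k - 1) i)" for k
  obtain l where l: "\<And>k. k \<le> d \<Longrightarrow> (\<Sum>j\<le>d. l j * \<tau> k j) = v k"
    using triangular_system_solvable[of d \<tau> v] tau_eq_0 tau_nz by blast
  have l': "(\<Sum>j\<le>d. l j * \<eta> k j) = \<theta> k * \<eta> k i + (if k = 0 then 0 else g (d + 1 - k) * \<eta> (k - 1) i)"
    if k: "k \<le> d" for k
  proof -
    have "(\<Sum>j\<le>d. l j * \<eta> k j) = (\<Sum>m\<le>d. conn s d k m * (\<Sum>j\<le>d. l j * \<tau> m j))"
      unfolding eta_expand[OF k] sum_distrib_left by (subst sum.swap) (simp add: mult_ac)
    also have "\<dots> = (\<Sum>m\<le>d. conn s d k m * \<theta> m * \<tau> m i) + (\<Sum>m\<le>d. if m = 0 then 0 else conn s d k m * f m * \<tau> (m - 1) i)"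
      unfolding sum.distrib[symmetric] by (rule sum.cong) (auto simp: l v_def algebra_simps)
    \<comment> \<open>The added term vanishes, as \<open>conn s d k (Suc d) = 0\<close>; it lets the
      shifted sum run up to \<open>d\<close> again.\<close>
    also have "(\<Sum>m\<le>d. if m = 0 then 0 else conn s d k m * f m * \<tau> (m - 1) i)
       = (\<Sum>m\<le>Suc d. if m = 0 then 0 else conn s d k m * f m * \<tau> (m - 1) i)"
      using k by (simp add: conn_eq_0)
    also have "\<dots> = (\<Sum>m\<le>d. conn s d k (m + 1) * f (m + 1) * \<tau> m i)"
      by (subst sum.atMost_Suc_shift) simp
    also have "(\<Sum>m\<le>d. conn s d k m * \<theta> m * \<tau> m i) + \<dots>
       = (\<Sum>m\<le>d. \<theta> k * (conn s d k m * \<tau> m i) + (if k = 0 then 0 else g (d + 1 - k) * (conn s d (k - 1) m * \<tau> m i)))"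
      unfolding sum.distrib[symmetric]
    proof (rule sum.cong)
      fix m assume "m \<in> {..d}"
      have "conn s d k m * \<theta> m + conn s d k (m + 1) * f (m + 1) = \<theta> k * conn s d k m + (if k = 0 then 0 else g (d + 1 - k) * conn s d (k - 1) m)"
      proof (cases "m < k")
        case True
        then show ?thesis using split_identity[OF True k] by (simp add: algebra_simps)
      next
        case False
        then show ?thesis by (cases "m = k") (auto simp: conn_eq_0)
      qed
      then show "conn s d k m * \<theta> m * \<tau> m i + conn s d k (m + 1) * f (m + 1) * \<tau> m i =
         \<theta> k * (conn s d k m * \<tau> m i) + (if k = 0 then 0 else g (d + 1 - k) * (conn s d (k - 1) m * \<tau> m i))"
        by (cases "k = 0") (auto simp flip: distrib_right simp: mult.assoc[symmetric])
    qed simp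
    also have "\<dots> = \<theta> k * \<eta> k i + (if k = 0 then 0 else g (d + 1 - k) * \<eta> (k - 1) i)"
      using k by (auto simp: sum.distrib eta_expand sum_distrib_left)
    finally show ?thesis .
  qed
  \<comment> \<open>Downward induction from j = d: tau_j vanishes to the left of j, so testing on it
    isolates \<open>l j\<close>.\<close>
  have up: "l j = 0" if "i + 1 < j" "j \<le> d" for j
    using that
  proof (induction "d - j" arbitrary: j rule: less_induct)
    case less
    have "(\<Sum>j'\<le>d. l j' * \<tau> j j') = (\<Sum>j'\<in>{j}. l j' * \<tau> j j')"
    proof (rule sum.mono_neutral_right)
      show "\<forall>j'\<in>{..d} - {j}. l j' * \<tau> j j' = 0"
      proof
        fix j' assume j': "j' \<in> {..d} - {j}"
        show "l j' * \<tau> j j' = 0"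
          by (cases "j' < j") (use j' less in \<open>auto simp: tau_eq_0\<close>)
      qed
    qed (use less in auto)
    then have "l j * \<tau> j j = v j" using l[of j] less by simp
    moreover have "v j = 0" using less by (simp add: v_def tau_eq_0)
    ultimately show ?case using tau_nz[of j j] less by simp
  qed
  \<comment> \<open>The mirror image, upwards from j = 0, with eta_(d-j), which vanishes to the
    right of j.\<close>
  have lo: "l j = 0" if "j + 1 < i" for j
    using that
  proof (induction j rule: less_induct)
    case (less j)
    have "(\<Sum>j'\<le>d. l j' * \<eta> (d - j) j') = (\<Sum>j'\<in>{j}. l j' * \<eta> (d - j) j')"
    proof (rule sum.mono_neutral_right)
      show "\<forall>j'\<in>{..d} - {j}. l j' * \<eta> (d - j) j' = 0"
      proof
        fix j' assume j': "j' \<in> {..d} - {j}"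
        show "l j' * \<eta> (d - j) j' = 0"
          by (cases "j' < j") (use j' less i in \<open>auto simp: eta_eq_0\<close>)
      qed
    qed (use less i in auto)
    then have "l j * \<eta> (d - j) j = 0"
      using l'[of "d - j"] less i by (simp add: eta_eq_0)
    then show ?case using eta_nz[of "d - j" j] less i by simp
  qed
  have sum3: "(\<Sum>j\<le>d. l j * F j) = (if i = 0 then 0 else l (i - 1) * F (i - 1)) + l i * F i
      + (if i = d then 0 else l (i + 1) * F (i + 1))" for F
  proof -
    have "(\<Sum>j\<le>d. l j * F j) = (\<Sum>j\<in>(if i = 0 then {} else {i - 1}) \<union> {i} \<union> (if i = d then {} else {i + 1}). l j * F j)"
    proof (rule sum.mono_neutral_right)
      show "\<forall>j\<in>{..d} - ((if i = 0 then {} else {i - 1}) \<union> {i} \<union> (if i = d then {} else {i + 1})). l j * F j = 0"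
      proof
        fix j assume j: "j \<in> {..d} - ((if i = 0 then {} else {i - 1}) \<union> {i} \<union> (if i = d then {} else {i + 1}))"
        then have "i + 1 < j \<or> j + 1 < i" using i by (auto split: if_splits)
        then show "l j * F j = 0" using up lo j by auto
      qed
    qed (use i in auto)
    then show ?thesis by (simp add: add.assoc)
  qed
  \<comment> \<open>Each remaining entry is read off a basis function adapted to it: the upper one
    from tau_(i+1), the lower one from eta_(d-i+1), and the diagonal one from tau_i once the upper
    one is known.\<close>
  have lB: "l (i + 1) = B i" if "i < d"
  proof -
    have "\<tau> (i + 1) (i - 1) = 0" "\<tau> (i + 1) i = 0" by (rule tau_eq_0; linarith)+
    then have "l (i + 1) * \<tau> (i + 1) (i + 1) = f (i + 1) * \<tau> i i"
      using l[of "i + 1"] that unfolding sum3 v_def by (cases "i = 0") simp_all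
    then show ?thesis using that tau_nz[of "i+1" "i+1"] by (simp add: B_def eq_divide_eq)
  qed
  have lC: "l (i - 1) = C i" if "0 < i"
  proof -
    have "l (i - 1) * \<eta> (d - i + 1) (i - 1) = g i * \<eta> (d - i) i"
    proof -
      have k: "d - i + 1 \<le> d" "d + 1 - (d - i + 1) = i" using that i by auto
      have "\<eta> (d - i + 1) i = 0" "i < d \<Longrightarrow> \<eta> (d - i + 1) (i + 1) = 0"
        using that i by (auto intro: eta_eq_0)
      then show ?thesis using l'[OF k(1)] that i unfolding sum3 k by (cases "i = d") simp_all
    qed
    then show ?thesis using that i eta_nz[of "d - i + 1" "i - 1"] by (simp add: C_def eq_divide_eq)
  qed
  have lA: "l i = A i"
  proof -
    have nz: "\<tau> i i \<noteq> 0" using tau_nz i by simp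
    have e1: "l i * \<tau> i i + (if i = d then 0 else B i * \<tau> i (i + 1)) = \<theta> i * \<tau> i i + (if i = 0 then 0 else f i * \<tau> (i - 1) i)"
      using l[of i] i lB unfolding sum3 v_def by (auto simp: tau_eq_0)
    have e2: "(if i = d then 0 else B i * \<tau> i (i + 1)) = - (if i = d then 0 else f (i + 1) / (s i - s (i + 1))) * \<tau> i i"
    proof (cases "i = d")
      case False
      then have "s (i + 1) - s i \<noteq> 0" "s i - s (i + 1) \<noteq> 0" using i s_inj[of "i + 1" i] by auto
      moreover have "\<tau> i (i + 1) \<noteq> 0" using False i tau_nz by simp
      ultimately show ?thesis using False by (simp add: B_def tau_Suc divide_simps) (simp add: algebra_simps)
    qed simp
    have e3: "(if i = 0 then 0 else f i * \<tau> (i - 1) i) = (if i = 0 then 0 else f i / (s i - s (i - 1))) * \<tau> i i"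
    proof (cases "i = 0")
      case False
      then have "i - 1 \<noteq> i" "i - 1 \<le> d" using i by auto
      then have "s i - s (i - 1) \<noteq> 0" using i s_inj[of "i - 1" i] by auto
      then show ?thesis using False tau_Suc[of "i - 1" i] by simp
    qed simp
    have "l i * \<tau> i i = A i * \<tau> i i"
      using e1 unfolding e2 e3 A_def by (simp add: algebra_simps)
    then show ?thesis using nz by simp
  qed
  have LF: "L F i = (\<Sum>j\<le>d. l j * F j)" for F
    unfolding sum3 L_def using lA lB lC i by (auto simp: B_def C_def)
  show "?a \<Longrightarrow> ?c" unfolding LF using l by (simp add: v_def)
  show "?b \<Longrightarrow> ?d" unfolding LF using l' by simp
qed

end

section \<open>Eigenvectors, weights and univariate orthogonality\<close>

context leonard
begin

text \<open>These are the values u_i(\<theta>_x). Summing up to \<open>d\<close> instead of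
  \<open>i\<close> adds only zeros, and makes \<open>U x\<close> a combination of the tau_k with
  coefficients free of i, to which \<open>L\<close> can be applied termwise.\<close>

definition U :: "nat \<Rightarrow> nat \<Rightarrow> complex" where
  "U x i = (\<Sum>k\<le>d. (\<Prod>j<k. (\<theta> x - \<theta> j) / f (j + 1)) * \<tau> k i)"

definition weight :: "nat \<Rightarrow> complex" where "weight i = pa_k \<Phi> (int i)"

lemma pa_u_eq: assumes "i \<le> d" shows "pa_u \<Phi> (int i) (\<theta> x) = U x i"
proof -
  have "pa_u \<Phi> (int i) (\<theta> x) = (\<Sum>k\<le>i. (\<Prod>j<k. (\<theta> x - \<theta> j) / f (j + 1)) * \<tau> k i)"
    unfolding pa_u_def sum_int_atLeastAtMost0 prod_int_atLeast0 \<tau>_def newton_def prod.distrib[symmetric]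
    by (auto intro!: sum.cong prod.cong simp: \<theta>_def s_def f_def add.commute)
  also have "\<dots> = U x i"
    unfolding U_def using assms by (intro sum.mono_neutral_left) (auto simp: tau_eq_0)
  finally show ?thesis .
qed

lemma L_U: assumes "x \<le> d" "i \<le> d" shows "L (U x) i = \<theta> x * U x i"
proof -
  define T where "T k = (\<Prod>j<k. (\<theta> x - \<theta> j) / f (j + 1))" for k
  have TS: "f (k + 1) * T (Suc k) = (\<theta> x - \<theta> k) * T k" if "k < d" for k
    using fg_nz[of "k + 1"] that by (simp add: T_def)
  \<comment> \<open>The series terminates: for x < d the product \<open>T d\<close> contains the
    factor \<theta>_x - \<theta>_x.\<close>
  have Td: "(\<theta> x - \<theta> d) * T d = 0"
    using assms by (cases "x = d") (auto simp: T_def)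
  have "L (U x) i = (\<Sum>k\<le>d. T k * L (\<tau> k) i)"
    unfolding L_def U_def T_def sum_distrib_left sum.distrib[symmetric]
    by (rule sum.cong) (auto simp: algebra_simps)
  also have "\<dots> = (\<Sum>k\<le>d. T k * (\<theta> k * \<tau> k i)) + (\<Sum>k\<le>d. if k = 0 then 0 else T k * (f k * \<tau> (k - 1) i))"
    unfolding sum.distrib[symmetric] using assms by (intro sum.cong) (auto simp: L_tau_eta distrib_left)
  also have "(\<Sum>k\<le>d. if k = 0 then 0 else T k * (f k * \<tau> (k - 1) i)) = (\<Sum>k\<le>d. (\<theta> x - \<theta> k) * T k * \<tau> k i)"
  proof (cases d)
    case (Suc n)
    have "(\<Sum>k\<le>d. if k = 0 then 0 else T k * (f k * \<tau> (k - 1) i)) = (\<Sum>k\<le>n. T (Suc k) * (f (Suc k) * \<tau> k i))"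
      unfolding Suc by (subst sum.atMost_Suc_shift) simp
    also have "\<dots> = (\<Sum>k\<le>n. (\<theta> x - \<theta> k) * T k * \<tau> k i)"
    proof (rule sum.cong)
      fix k assume "k \<in> {..n}"
      then show "T (Suc k) * (f (Suc k) * \<tau> k i) = (\<theta> x - \<theta> k) * T k * \<tau> k i"
        using TS[of k] Suc by (simp add: mult_ac)
    qed simp
    finally show ?thesis using Td by (simp add: Suc)
  qed (use Td in simp)
  also have "(\<Sum>k\<le>d. T k * (\<theta> k * \<tau> k i)) + \<dots> = \<theta> x * U x i"
    unfolding sum.distrib[symmetric] U_def T_def sum_distrib_left by (rule sum.cong) (auto simp: algebra_simps)
  finally show ?thesis .
qed

lemma U_0: "U 0 i = 1" "U x 0 = 1"
proof -
  have "U 0 i = (\<Sum>k\<in>{0}. (\<Prod>j<k. (\<theta> 0 - \<theta> j) / f (j + 1)) * \<tau> k i)"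
    unfolding U_def by (rule sum.mono_neutral_right) auto
  then show "U 0 i = 1" by simp
  have "U x 0 = (\<Sum>k\<in>{0}. (\<Prod>j<k. (\<theta> x - \<theta> j) / f (j + 1)) * \<tau> k 0)"
    unfolding U_def by (rule sum.mono_neutral_right) (auto simp: tau_eq_0)
  then show "U x 0 = 1" by simp
qed

lemma prod_eta: 
  assumes "i \<le> d" "k \<le> d"
  shows "(\<Prod>h\<in>{0..int k - 1}. pa_deig \<Phi> (int i) - pa_deig \<Phi> (int d - h)) = \<eta> k i"
  unfolding prod_int_atLeast0 \<eta>_def newton_def using assms by (auto simp: s_def of_nat_diff intro!: prod.cong)

lemma prod_tau: "(\<Prod>h\<in>{0..int k - 1}. pa_deig \<Phi> (int i) - pa_deig \<Phi> h) = \<tau> k i"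
  unfolding prod_int_atLeast0 \<tau>_def newton_def by (simp add: s_def)

lemma pa_b_eq: assumes "i \<le> d" shows "pa_b \<Phi> (int i) = B i"
proof -
  have e: "int i + 1 = int (i + 1)" "{0..int i} = {0..int (i + 1) - 1}" by auto
  show ?thesis unfolding pa_b_def B_def diam e prod_tau by (simp add: f_def)
qed

lemma pa_c_eq: assumes "i \<le> d" shows "pa_c \<Phi> (int i) = C i"
proof (cases "i = 0")
  case False
  have e: "int d - int i = int (d - i)" "int i - 1 = int (i - 1)" "{0..int (d - i)} = {0..int (d - i + 1) - 1}"
    using assms False by auto
  show ?thesis
    unfolding pa_c_def Let_def C_def diam e using False assms prod_eta[of i "d - i"] prod_eta[of "i - 1" "d - i + 1"]
    by (simp add: g_def)
qed (simp add: pa_c_def C_def Let_def)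

lemma pa_a_eq: assumes "i \<le> d" shows "pa_a \<Phi> (int i) = A i"
proof -
  have e: "int i + 1 = int (i + 1)" "i \<noteq> 0 \<Longrightarrow> int i - 1 = int (i - 1)" by auto
  show ?thesis unfolding pa_a_def A_def diam using e by (auto simp: f_def s_def \<theta>_def of_nat_diff add.commute)
qed

lemma three_term:
  assumes "x \<in> {0..pa_diam \<Phi>}" "i \<in> {0..pa_diam \<Phi>}"
  shows "pa_eig \<Phi> x * pa_u \<Phi> i (pa_eig \<Phi> x)
    = pa_c \<Phi> i * pa_u \<Phi> (i - 1) (pa_eig \<Phi> x) + pa_a \<Phi> i * pa_u \<Phi> i (pa_eig \<Phi> x)
      + pa_b \<Phi> i * pa_u \<Phi> (i + 1) (pa_eig \<Phi> x)"
proof -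
  define y n where "y = nat x" and "n = nat i"
  then have e: "x = int y" "i = int n" "y \<le> d" "n \<le> d"
    using assms unfolding diam by auto
  have x: "pa_eig \<Phi> x = \<theta> y" by (simp add: e \<theta>_def)
  have 1: "pa_c \<Phi> i * pa_u \<Phi> (i - 1) (pa_eig \<Phi> x) = C n * U y (n - 1)"
  proof (cases "n = 0")
    case False
    then have i1: "i - 1 = int (n - 1)" "n - 1 \<le> d" using e by auto
    show ?thesis unfolding x i1(1) pa_u_eq[OF i1(2)] unfolding e(2) pa_c_eq[OF e(4)] ..
  qed (simp add: e pa_c_def C_def Let_def)
  have 2: "pa_b \<Phi> i * pa_u \<Phi> (i + 1) (pa_eig \<Phi> x) = B n * U y (n + 1)"
  proof (cases "n = d")
    case True
    then show ?thesis using e pa_b_eq[of n] by (simp add: B_def)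
  next
    case False
    then have i1: "i + 1 = int (n + 1)" "n + 1 \<le> d" using e by auto
    show ?thesis unfolding x i1(1) pa_u_eq[OF i1(2)] unfolding e(2) pa_b_eq[OF e(4)] ..
  qed
  show ?thesis unfolding 1 2 unfolding x unfolding e(2) pa_u_eq[OF e(4)] pa_a_eq[OF e(4)]
    using L_U[of y n] e by (simp add: L_def)
qed

lemma pa_k_nz: assumes "i \<in> {0..pa_diam \<Phi>}" shows "pa_k \<Phi> i \<noteq> 0"
proof -
  have "pa_deig \<Phi> h \<noteq> pa_deig \<Phi> h'" if "h \<in> {0..int d}" "h' \<in> {0..int d}" "h \<noteq> h'" for h h'
    using inj_onD[OF param_array_conditions(3)] that by blast
  then show ?thesis
    using assms param_array_conditions(1) unfolding pa_k_def diam by (auto simp: prod_zero_iff)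
qed

lemma pa_k_0: "pa_k \<Phi> 0 = 1"
proof -
  have nz: "(\<Prod>h\<in>{1..int d}. pa_deig \<Phi> 0 - pa_deig \<Phi> h) \<noteq> 0"
    using inj_onD[OF param_array_conditions(3), of 0] by (force simp: prod_zero_iff)
  have e: "{0..int d} - {0} = {1..int d}" by auto
  show ?thesis unfolding pa_k_def diam e using nz by simp
qed

text \<open>Detailed balance. The denominator of k_i splits at h = i into \<open>a * b\<close>; here
  \<open>a\<close> is the numerator in b_i and \<open>b\<close> the denominator in c_(i+1), and
  likewise for \<open>a'\<close> and \<open>b'\<close>.\<close>

lemma pa_k_pa_b_eq:
  assumes "i \<in> {0..<pa_diam \<Phi>}"
  shows "pa_k \<Phi> i * pa_b \<Phi> i = pa_k \<Phi> (i + 1) * pa_c \<Phi> (i + 1)"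
proof -
  let ?s = "pa_deig \<Phi>"
  have i: "0 \<le> i" "i < int d" using assms by (auto simp: diam)
  have ne: "?s h \<noteq> ?s h'" if "h \<in> {0..int d}" "h' \<in> {0..int d}" "h \<noteq> h'" for h h'
    using inj_onD[OF param_array_conditions(3)] that by blast
  define a where "a = (\<Prod>h\<in>{0..i-1}. ?s i - ?s h)"
  define b where "b = (\<Prod>h\<in>{i+1..int d}. ?s i - ?s h)"
  define a' where "a' = (\<Prod>h\<in>{0..i}. ?s (i + 1) - ?s h)"
  define b' where "b' = (\<Prod>h\<in>{i+2..int d}. ?s (i + 1) - ?s h)"
  define R where "R = (\<Prod>h\<in>{1..i}. pa_fsplit \<Phi> h / pa_ssplit \<Phi> h)"
  define M where "M = (\<Prod>h\<in>{1..int d}. ?s 0 - ?s h)"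
  have nz: "a \<noteq> 0" "b \<noteq> 0" "a' \<noteq> 0" "b' \<noteq> 0" "pa_ssplit \<Phi> (i + 1) \<noteq> 0"
    using i ne param_array_conditions(1) unfolding a_def b_def a'_def b'_def by (auto simp: prod_zero_iff)
  have s1: "{0..int d} - {i} = {0..i-1} \<union> {i+1..int d}" "{0..int d} - {i + 1} = {0..i} \<union> {i+2..int d}"
    using i by auto
  have p1: "(\<Prod>h\<in>{0..int d} - {i}. ?s i - ?s h) = a * b"
    unfolding s1 a_def b_def by (rule prod.union_disjoint) auto
  have p2: "(\<Prod>h\<in>{0..int d} - {i + 1}. ?s (i + 1) - ?s h) = a' * b'"
    unfolding s1 a'_def b'_def by (rule prod.union_disjoint) auto
  have s2: "{1..i + 1} = insert (i + 1) {1..i}" using i by auto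
  have R': "(\<Prod>h\<in>{1..i + 1}. pa_fsplit \<Phi> h / pa_ssplit \<Phi> h) = pa_fsplit \<Phi> (i + 1) / pa_ssplit \<Phi> (i + 1) * R"
    unfolding s2 R_def by (subst prod.insert) auto
  have q1: "(\<Prod>h\<in>{0..int d - (i + 1) - 1}. ?s (i + 1) - ?s (int d - h)) = b'"
    unfolding b'_def using i by (intro prod.reindex_bij_witness[of _ "\<lambda>h. int d - h" "\<lambda>h. int d - h"]) auto
  have q2: "(\<Prod>h\<in>{0..int d - (i + 1)}. ?s (i + 1 - 1) - ?s (int d - h)) = b"
    unfolding b_def using i by (intro prod.reindex_bij_witness[of _ "\<lambda>h. int d - h" "\<lambda>h. int d - h"]) auto
  have c: "pa_c \<Phi> (i + 1) = pa_ssplit \<Phi> (i + 1) * b' / b"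
    unfolding pa_c_def Let_def diam q1 q2 using i by simp
  have b: "pa_b \<Phi> i = pa_fsplit \<Phi> (i + 1) * a / a'"
    unfolding pa_b_def diam a_def a'_def using i by simp
  show ?thesis
    unfolding b c unfolding pa_k_def diam p1 p2 R' R_def[symmetric] M_def[symmetric] using nz
    by (simp add: field_simps)
qed

lemma weight_balance: "i < d \<Longrightarrow> weight i * B i = weight (i + 1) * C (i + 1)"
  using pa_k_pa_b_eq[of "int i"] pa_b_eq[of i] pa_c_eq[of "i + 1"] by (simp add: weight_def diam add.commute)

lemma sum_shift_CB: "(\<Sum>i\<le>d. weight i * C i * F (i - 1) * H i) = (\<Sum>i\<le>d. weight i * B i * F i * H (i + 1))"
proof (cases d)
  case 0
  then show ?thesis by (simp add: B_def C_def)
next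
  case (Suc n)
  have "(\<Sum>i\<le>d. weight i * C i * F (i - 1) * H i) = (\<Sum>i\<le>n. weight (Suc i) * C (Suc i) * F i * H (Suc i))"
    unfolding Suc by (subst sum.atMost_Suc_shift) (simp add: C_def)
  also have "\<dots> = (\<Sum>i\<le>n. weight i * B i * F i * H (i + 1))"
    using weight_balance Suc by (intro sum.cong) auto
  also have "\<dots> = (\<Sum>i\<le>d. weight i * B i * F i * H (i + 1))"
    unfolding Suc by (simp add: B_def Suc)
  finally show ?thesis .
qed

lemma L_selfadjoint: "(\<Sum>i\<le>d. weight i * L F i * H i) = (\<Sum>i\<le>d. weight i * F i * L H i)"
proof -
  have "(\<Sum>i\<le>d. weight i * L F i * H i) = (\<Sum>i\<le>d. weight i * C i * F (i - 1) * H i)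
     + (\<Sum>i\<le>d. weight i * A i * F i * H i) + (\<Sum>i\<le>d. weight i * B i * H i * F (i + 1))"
    unfolding sum.distrib[symmetric] by (rule sum.cong) (auto simp: L_def algebra_simps)
  also have "\<dots> = (\<Sum>i\<le>d. weight i * B i * F i * H (i + 1))
     + (\<Sum>i\<le>d. weight i * A i * F i * H i) + (\<Sum>i\<le>d. weight i * C i * H (i - 1) * F i)"
    unfolding sum_shift_CB ..
  also have "\<dots> = (\<Sum>i\<le>d. weight i * F i * L H i)"
    unfolding sum.distrib[symmetric] by (rule sum.cong) (auto simp: L_def algebra_simps)
  finally show ?thesis .
qed

text \<open>The constant function is tau_0, hence an eigenfunction for \<theta>_0. Moving L from it
  onto eta_(n+1) relates the weighted sums of eta_(n+1) and eta_n. The chain is useful because eta_d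
  is supported at 0.\<close>

lemma sum_weight_eta:
  assumes "n \<le> d"
  shows "(\<Sum>i\<le>d. weight i) = (\<Prod>l<n. (\<theta> 0 - \<theta> (Suc l)) / g (d - l)) * (\<Sum>i\<le>d. weight i * \<eta> n i)"
  using assms
proof (induction n)
  case (Suc n)
  let ?Z = "\<lambda>F. \<Sum>i\<le>d. weight i * F i"
  have L1: "L (\<lambda>_. 1) i = \<theta> 0" if "i \<le> d" for i
    using L_tau_eta(1)[OF that, of 0] by (simp add: L_def)
  have "\<theta> 0 * ?Z (\<eta> (Suc n)) = (\<Sum>i\<le>d. weight i * \<eta> (Suc n) i * L (\<lambda>_. 1) i)"
    unfolding sum_distrib_left by (rule sum.cong) (auto simp: L1)
  also have "\<dots> = (\<Sum>i\<le>d. weight i * L (\<eta> (Suc n)) i * 1)" by (rule L_selfadjoint[symmetric])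
  also have "\<dots> = (\<Sum>i\<le>d. \<theta> (Suc n) * (weight i * \<eta> (Suc n) i) + g (d - n) * (weight i * \<eta> n i))"
    using Suc.prems by (intro sum.cong) (auto simp: L_tau_eta algebra_simps)
  also have "\<dots> = \<theta> (Suc n) * ?Z (\<eta> (Suc n)) + g (d - n) * ?Z (\<eta> n)"
    by (simp add: sum.distrib sum_distrib_left)
  finally have "g (d - n) * ?Z (\<eta> n) = (\<theta> 0 - \<theta> (Suc n)) * ?Z (\<eta> (Suc n))" by (simp add: algebra_simps)
  then have "?Z (\<eta> n) = (\<theta> 0 - \<theta> (Suc n)) / g (d - n) * ?Z (\<eta> (Suc n))"
    using fg_nz[of "d - n"] Suc.prems by (simp add: field_simps)
  then show ?case using Suc by simp
qed simp

lemma sum_weight: "(\<Sum>i\<le>d. weight i) = pa_nu \<Phi>"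
proof -
  have "(\<Sum>i\<le>d. weight i * \<eta> d i) = (\<Sum>i\<in>{0}. weight i * \<eta> d i)"
    by (rule sum.mono_neutral_right) (auto simp: eta_eq_0)
  then have 1: "(\<Sum>i\<le>d. weight i * \<eta> d i) = (\<Prod>h<d. s 0 - s (d - h))"
    using pa_k_0 by (simp add: weight_def \<eta>_def newton_def)
  have r: "(\<Prod>l<d. F (d - l)) = (\<Prod>l<d. F (Suc l))" for F :: "nat \<Rightarrow> complex"
    by (rule prod.reindex_bij_witness[of _ "\<lambda>l. d - Suc l" "\<lambda>l. d - Suc l"]) (auto simp: Suc_diff_Suc)
  have "pa_nu \<Phi> = (\<Prod>l<d. (\<theta> 0 - \<theta> (Suc l)) * (s 0 - s (Suc l)) / g (Suc l))"
    unfolding pa_nu_def diam prod_int_atLeast1 by (simp add: \<theta>_def s_def g_def)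
  also have "\<dots> = (\<Prod>l<d. \<theta> 0 - \<theta> (Suc l)) * (\<Prod>l<d. s 0 - s (Suc l)) / (\<Prod>l<d. g (Suc l))"
    by (simp add: prod.distrib prod_dividef)
  also have "\<dots> = (\<Prod>l<d. (\<theta> 0 - \<theta> (Suc l)) / g (d - l)) * (\<Prod>h<d. s 0 - s (d - h))"
    by (simp add: prod.distrib prod_dividef r[of "\<lambda>h. s 0 - s h"] r[of g])
  finally show ?thesis using sum_weight_eta[of d] 1 by simp
qed

lemma U_orthogonal:
  assumes "x \<le> d" "y \<le> d" "x \<noteq> y" shows "(\<Sum>i\<le>d. weight i * U x i * U y i) = 0"
proof -
  have "\<theta> x * (\<Sum>i\<le>d. weight i * U x i * U y i) = (\<Sum>i\<le>d. weight i * L (U x) i * U y i)"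
    unfolding sum_distrib_left using assms by (intro sum.cong) (auto simp: L_U)
  also have "\<dots> = (\<Sum>i\<le>d. weight i * U x i * L (U y) i)" by (rule L_selfadjoint)
  also have "\<dots> = \<theta> y * (\<Sum>i\<le>d. weight i * U x i * U y i)"
    unfolding sum_distrib_left using assms by (intro sum.cong) (auto simp: L_U)
  finally show ?thesis using th_inj[OF assms] by simp
qed

end

lemma pa_dual_dual: "pa_dual (pa_dual \<Phi>) = \<Phi>"
  by (simp add: pa_dual_def)

text \<open>Askey-Wilson duality: the k-th term is symmetric under the exchange and contains a zero
  factor as soon as k exceeds i or x, so both sums stop at min i x.\<close>

lemma pa_u_duality:
  assumes "0 \<le> i" "0 \<le> x"
  shows "pa_u \<Phi> i (pa_eig \<Phi> x) = pa_u (pa_dual \<Phi>) x (pa_deig \<Phi> i)"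
proof -
  let ?t = "\<lambda>k. \<Prod>j\<in>{0..k-1}. (pa_eig \<Phi> x - pa_eig \<Phi> j) * (pa_deig \<Phi> i - pa_deig \<Phi> j) / pa_fsplit \<Phi> (j+1)"
  have z: "?t k = 0" if "min i x < k" for k
  proof -
    have "min i x \<in> {0..k-1}" using that assms by auto
    then show ?thesis by (intro prod_zero) (auto simp: min_def split: if_splits)
  qed
  have 1: "(\<Sum>k\<in>{0..i}. ?t k) = (\<Sum>k\<in>{0..min i x}. ?t k)" using z by (intro sum.mono_neutral_right) auto
  have 2: "(\<Sum>k\<in>{0..x}. ?t k) = (\<Sum>k\<in>{0..min i x}. ?t k)" using z by (intro sum.mono_neutral_right) auto
  have "pa_u \<Phi> i (pa_eig \<Phi> x) = (\<Sum>k\<in>{0..x}. ?t k)" unfolding pa_u_def 1 2 ..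
  also have "\<dots> = pa_u (pa_dual \<Phi>) x (pa_deig \<Phi> i)" by (simp add: pa_u_def pa_dual_def mult_ac)
  finally show ?thesis .
qed

lemma pa_nu_dual: "pa_nu (pa_dual \<Phi>) = pa_nu \<Phi>"
proof -
  have "(\<Prod>h\<in>{1..pa_diam \<Phi>}. pa_ssplit \<Phi> (pa_diam \<Phi> - h + 1)) = (\<Prod>h\<in>{1..pa_diam \<Phi>}. pa_ssplit \<Phi> h)"
    by (rule prod.reindex_bij_witness[of _ "\<lambda>h. pa_diam \<Phi> - h + 1" "\<lambda>h. pa_diam \<Phi> - h + 1"]) auto
  then show ?thesis by (simp add: pa_nu_def pa_dual_def prod.distrib prod_dividef mult_ac)
qed

section \<open>Orthogonality and inverted compatibility relations\<close>

lemma pa_diam_dual [simp]: "pa_diam (pa_dual \<Phi>) = pa_diam \<Phi>"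
  and pa_eig_dual [simp]: "pa_eig (pa_dual \<Phi>) = pa_deig \<Phi>"
  and pa_deig_dual [simp]: "pa_deig (pa_dual \<Phi>) = pa_eig \<Phi>"
  by (simp_all add: pa_dual_def)

lemma is_param_array_dual: "is_param_array \<Phi> \<Longrightarrow> is_param_array (pa_dual \<Phi>)"
  using leonard.dual_is_param_array leonard_def by blast

lemma pa_p_duality:
  assumes "0 \<le> i" "0 \<le> x"
  shows "pa_p \<Phi> x i * pa_k (pa_dual \<Phi>) x = pa_p (pa_dual \<Phi>) i x * pa_k \<Phi> i"
  using pa_u_duality[OF assms, of \<Phi>] by (simp add: pa_p_def)

lemma pa_nu_nz:
  assumes "is_param_array \<Phi>" shows "pa_nu \<Phi> \<noteq> 0"
proof -
  interpret leonard \<Phi> by unfold_locales fact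
  have "pa_eig \<Phi> 0 - pa_eig \<Phi> h \<noteq> 0" "pa_deig \<Phi> 0 - pa_deig \<Phi> h \<noteq> 0" "pa_ssplit \<Phi> h \<noteq> 0"
    if "h \<in> {1..int d}" for h
    using inj_onD[OF param_array_conditions(2), of 0 h] inj_onD[OF param_array_conditions(3), of 0 h] param_array_conditions(1) that by auto
  then show ?thesis unfolding pa_nu_def diam by (auto simp: prod_zero_iff)
qed

text \<open>Off the diagonal the eigenvalues differ. The squared norms need no separate computation:
  by duality the columns of U are the eigenvectors of the dual array, so summing all pairings
  against the dual weights leaves nu.\<close>

lemma pa_orthogonality:
  assumes "is_param_array \<Phi>" "x \<in> {0..pa_diam \<Phi>}" "x' \<in> {0..pa_diam \<Phi>}"
  shows "(\<Sum>i\<in>{0..pa_diam \<Phi>}. pa_p \<Phi> x i * pa_p (pa_dual \<Phi>) i x') = (if x = x' then pa_nu \<Phi> else 0)"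
proof -
  interpret leonard \<Phi> by unfold_locales fact
  interpret D: leonard "pa_dual \<Phi>" by unfold_locales (rule dual_is_param_array)
  have Dd: "D.d = d" by (simp add: D.d_def d_def)
  have DU: "D.U i y = U y i" if "i \<le> d" "y \<le> d" for i y
    using pa_u_duality[of "int i" "int y" \<Phi>] pa_u_eq[of i y] D.pa_u_eq[of y i] that
    by (simp add: Dd D.\<theta>_def \<theta>_def)
  define n m where "n = nat x" and "m = nat x'"
  then have e: "x = int n" "x' = int m" "n \<le> d" "m \<le> d" using assms(2,3) unfolding diam by auto
  have p: "pa_p \<Phi> x (int i) * pa_p (pa_dual \<Phi>) (int i) x' = D.weight m * (weight i * U n i * U m i)" if "i \<le> d" for i
    using pa_u_eq[OF that, of n] D.pa_u_eq[of m i] DU[OF that, of m] that e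
    by (simp add: pa_p_def weight_def D.weight_def D.\<theta>_def \<theta>_def Dd)
  have "(\<Sum>i\<in>{0..pa_diam \<Phi>}. pa_p \<Phi> x i * pa_p (pa_dual \<Phi>) i x') = D.weight m * (\<Sum>i\<le>d. weight i * U n i * U m i)"
    unfolding diam sum_int_atLeastAtMost0 sum_distrib_left by (rule sum.cong) (use p in auto)
  also have "\<dots> = (if x = x' then pa_nu \<Phi> else 0)"
  proof (cases "n = m")
    case False
    then show ?thesis using U_orthogonal[of n m] e by simp
  next
    case True
    \<comment> \<open>Orthogonality in the dual array between its eigenvectors i and 0, the latter
      being constant.\<close>
    have col: "(\<Sum>y\<le>d. D.weight y * U y i) = (if i = 0 then pa_nu \<Phi> else 0)" if "i \<le> d" for i
    proof -
      have "(\<Sum>y\<le>d. D.weight y * U y i) = (\<Sum>y\<le>d. D.weight y * D.U i y * D.U 0 y)"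
        using that by (intro sum.cong) (auto simp: DU D.U_0)
      also have "\<dots> = (if i = 0 then pa_nu \<Phi> else 0)"
        using D.U_orthogonal[of i 0] D.sum_weight that by (auto simp: Dd D.U_0 pa_nu_dual)
      finally show ?thesis .
    qed
    have "(\<Sum>y\<le>d. D.weight y * (\<Sum>i\<le>d. weight i * U n i * U y i)) = (\<Sum>y\<in>{n}. D.weight y * (\<Sum>i\<le>d. weight i * U n i * U y i))"
      using e by (intro sum.mono_neutral_right) (auto simp: U_orthogonal)
    then have "D.weight n * (\<Sum>i\<le>d. weight i * U n i * U n i) = (\<Sum>y\<le>d. D.weight y * (\<Sum>i\<le>d. weight i * U n i * U y i))" by simp
    also have "\<dots> = (\<Sum>i\<le>d. weight i * U n i * (\<Sum>y\<le>d. D.weight y * U y i))"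
      unfolding sum_distrib_left by (subst sum.swap) (simp add: mult_ac)
    also have "\<dots> = (\<Sum>i\<in>{0}. weight i * U n i * (\<Sum>y\<le>d. D.weight y * U y i))"
      by (rule sum.mono_neutral_right) (auto simp: col)
    also have "\<dots> = pa_nu \<Phi>" using pa_k_0 col[of 0] by (simp add: U_0 weight_def)
    finally show ?thesis using True e by simp
  qed
  finally show ?thesis .
qed

text \<open>The three-term recurrence of the dual array read through duality. The factor k_i does
  not involve x, so it carries over from u to p.\<close>

lemma pa_p_dual_three_term:
  assumes "is_param_array \<Phi>" "x \<in> {0..pa_diam \<Phi>}" "i \<in> {0..pa_diam \<Phi>}"
  shows "pa_deig \<Phi> i * pa_p \<Phi> x i = pa_c (pa_dual \<Phi>) x * pa_p \<Phi> (x - 1) i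
     + pa_a (pa_dual \<Phi>) x * pa_p \<Phi> x i + pa_b (pa_dual \<Phi>) x * pa_p \<Phi> (x + 1) i"
proof -
  interpret D: leonard "pa_dual \<Phi>" by unfold_locales (rule is_param_array_dual[OF assms(1)])
  have u: "pa_u (pa_dual \<Phi>) y (pa_deig \<Phi> i) = pa_u \<Phi> i (pa_eig \<Phi> y)" if "0 \<le> y" for y
    using pa_u_duality[of i y \<Phi>] that assms by simp
  have 1: "pa_c (pa_dual \<Phi>) x * pa_u (pa_dual \<Phi>) (x - 1) (pa_deig \<Phi> i)
    = pa_c (pa_dual \<Phi>) x * pa_u \<Phi> i (pa_eig \<Phi> (x - 1))"
    using u[of "x - 1"] assms by (cases "x = 0") (auto simp: pa_c_def Let_def)
  have "pa_deig \<Phi> i * pa_u \<Phi> i (pa_eig \<Phi> x) = pa_c (pa_dual \<Phi>) x * pa_u \<Phi> i (pa_eig \<Phi> (x - 1))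
     + pa_a (pa_dual \<Phi>) x * pa_u \<Phi> i (pa_eig \<Phi> x) + pa_b (pa_dual \<Phi>) x * pa_u \<Phi> i (pa_eig \<Phi> (x + 1))"
    using D.three_term[of i x] assms 1 u[of x] u[of "x + 1"] by simp
  then show ?thesis unfolding pa_p_def by algebra
qed

text \<open>In matrices, with P' the matrix of the dual array, \<open>rel\<close> reads W P'(B) =
  (nu B / nu A) P'(A) K. Multiplying by P(A) on the left and P(B) on the right gives P(A) W = K
  P(B). The diameters may differ: \<open>w0\<close> covers indices beyond that of B, the conditional
  in the conclusion those beyond that of A.\<close>

lemma inverted_relation:
  assumes A: "is_param_array A" and B: "is_param_array B" and S: "finite S"
    and rel: "\<And>y' j. y' \<in> {0..pa_diam B} \<Longrightarrow> j \<in> {0..pa_diam A} \<Longrightarrow>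
      w j * pa_p (pa_dual B) j y' = pa_nu B / pa_nu A * (\<Sum>e\<in>S. K e y' * pa_p (pa_dual A) j (y' + e))"
    and w0: "\<And>j. j \<in> {0..pa_diam A} \<Longrightarrow> pa_diam B < j \<Longrightarrow> w j = 0"
    and K0: "\<And>e y'. e \<in> S \<Longrightarrow> y' \<in> {0..pa_diam B} \<Longrightarrow> y' + e \<notin> {0..pa_diam A} \<Longrightarrow> K e y' = 0"
    and y: "y \<in> {0..pa_diam A}" and j: "j \<in> {0..pa_diam B}"
  shows "(if j \<le> pa_diam A then w j * pa_p A y j else 0)
    = (\<Sum>e\<in>S. if y - e \<in> {0..pa_diam B} then K e (y - e) * pa_p B (y - e) j else 0)"
proof -
  let ?a = "{0..pa_diam A}" and ?b = "{0..pa_diam B}"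
  define g where "g j = (if j \<le> pa_diam A then w j * pa_p A y j else 0)" for j
  have nz: "pa_nu A \<noteq> 0" "pa_nu B \<noteq> 0" using A B pa_nu_nz by auto
  have s1: "(\<Sum>j\<in>?b. g j * pa_p (pa_dual B) j y') = pa_nu B * (\<Sum>e\<in>S. if y = y' + e then K e y' else 0)"
    if y': "y' \<in> ?b" for y'
  proof -
    have "(\<Sum>j\<in>?b. g j * pa_p (pa_dual B) j y') = (\<Sum>j\<in>?a \<inter> ?b. g j * pa_p (pa_dual B) j y')"
      by (rule sum.mono_neutral_right) (auto simp: g_def)
    also have "\<dots> = (\<Sum>j\<in>?a. pa_p A y j * (w j * pa_p (pa_dual B) j y'))"
      by (rule sum.mono_neutral_cong_left) (auto simp: g_def w0)
    also have "\<dots> = (\<Sum>j\<in>?a. pa_nu B / pa_nu A * (\<Sum>e\<in>S. K e y' * (pa_p A y j * pa_p (pa_dual A) j (y' + e))))"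
      using rel[OF y'] by (intro sum.cong) (auto simp: sum_distrib_left mult_ac)
    also have "\<dots> = pa_nu B / pa_nu A * (\<Sum>e\<in>S. K e y' * (\<Sum>j\<in>?a. pa_p A y j * pa_p (pa_dual A) j (y' + e)))"
      unfolding sum_distrib_left[symmetric] by (subst sum.swap) (simp add: sum_distrib_left)
    also have "(\<Sum>e\<in>S. K e y' * (\<Sum>j\<in>?a. pa_p A y j * pa_p (pa_dual A) j (y' + e)))
       = (\<Sum>e\<in>S. pa_nu A * (if y = y' + e then K e y' else 0))"
    proof (rule sum.cong)
      fix e assume e: "e \<in> S"
      show "K e y' * (\<Sum>j\<in>?a. pa_p A y j * pa_p (pa_dual A) j (y' + e)) = pa_nu A * (if y = y' + e then K e y' else 0)"
      proof (cases "y' + e \<in> ?a")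
        case True
        show ?thesis unfolding pa_orthogonality[OF A y True] by simp
      next
        case False
        then show ?thesis using K0[OF e y' False] by simp
      qed
    qed simp
    also have "pa_nu B / pa_nu A * \<dots> = pa_nu B * (\<Sum>e\<in>S. if y = y' + e then K e y' else 0)"
      unfolding sum_distrib_left[symmetric] using nz by simp
    finally show ?thesis .
  qed
  have "pa_nu B * g j = (\<Sum>j'\<in>?b. g j' * (\<Sum>y'\<in>?b. pa_p (pa_dual B) j' y' * pa_p (pa_dual (pa_dual B)) y' j))"
  proof -
    have "(\<Sum>j'\<in>?b. g j' * (\<Sum>y'\<in>?b. pa_p (pa_dual B) j' y' * pa_p (pa_dual (pa_dual B)) y' j))
       = (\<Sum>j'\<in>?b. if j' = j then pa_nu B * g j' else 0)"
      using pa_orthogonality[OF is_param_array_dual[OF B]] j by (intro sum.cong) (auto simp: pa_nu_dual)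
    then show ?thesis using j by simp
  qed
  also have "\<dots> = (\<Sum>y'\<in>?b. (\<Sum>j'\<in>?b. g j' * pa_p (pa_dual B) j' y') * pa_p B y' j)"
    unfolding pa_dual_dual sum_distrib_left sum_distrib_right by (subst sum.swap) (simp add: mult_ac)
  also have "\<dots> = (\<Sum>y'\<in>?b. \<Sum>e\<in>S. pa_nu B * (if y' = y - e then K e y' * pa_p B y' j else 0))"
    by (rule sum.cong) (auto simp: s1 sum_distrib_left sum_distrib_right intro!: sum.cong)
  also have "\<dots> = pa_nu B * (\<Sum>e\<in>S. \<Sum>y'\<in>?b. if y' = y - e then K e y' * pa_p B y' j else 0)"
    by (subst sum.swap) (simp add: sum_distrib_left)
  also have "\<dots> = pa_nu B * (\<Sum>e\<in>S. if y - e \<in> ?b then K e (y - e) * pa_p B (y - e) j else 0)"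
    by (simp add: sum.delta)
  finally show ?thesis using nz by (simp add: g_def)
qed

section \<open>Difference relations for two families of arrays\<close>

lemma sum_A2:
  "(\<Sum>(e,e')\<in>A2. X e e') = (\<Sum>e'\<in>{-1,0}. X 1 e') + (\<Sum>e'\<in>{-1,0,1}. X 0 e') + (\<Sum>e'\<in>{0,1}. X (-1) e')"
  for X :: "int \<Rightarrow> int \<Rightarrow> complex"
  by (simp add: A2_def)

text \<open>The locale fixes no coefficients: it is instantiated a second time with the dual
  families in exchanged roles, where \<open>difference_relation\<close> is applied to other
  coefficients.\<close>

locale array_families =
  fixes N :: int and \<Phi> \<Psi> :: "int \<Rightarrow> param_array"
  assumes \<Phi>: "\<And>j. j \<in> {0..N} \<Longrightarrow> is_param_array (\<Phi> j)" "\<And>j. j \<in> {0..N} \<Longrightarrow> pa_diam (\<Phi> j) = N - j"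
    and \<Psi>: "\<And>x. x \<in> {0..N} \<Longrightarrow> is_param_array (\<Psi> x)" "\<And>x. x \<in> {0..N} \<Longrightarrow> pa_diam (\<Psi> x) = N - x"
begin

abbreviation "T \<equiv> biv_T N \<Phi> \<Psi>"

lemma shifted_terms:
  assumes S: "finite S" and ij: "(i,j) \<in> triangle N" and xy: "(x,y) \<in> triangle N" and x': "x' \<in> {0..N}"
    and rel: "\<And>y' j. y' \<in> {0..N - x'} \<Longrightarrow> j \<in> {0..N - x} \<Longrightarrow>
      w j * pa_p (pa_dual (\<Psi> x')) j y'
        = pa_nu (\<Psi> x') / pa_nu (\<Psi> x) * (\<Sum>e\<in>S. K e y' * pa_p (pa_dual (\<Psi> x)) j (y' + e))"
    and w0: "\<And>j. j \<in> {0..N - x} \<Longrightarrow> N - x' < j \<Longrightarrow> w j = 0"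
    and K0: "\<And>e y'. e \<in> S \<Longrightarrow> y' \<in> {0..N - x'} \<Longrightarrow> y' + e \<notin> {0..N - x} \<Longrightarrow> K e y' = 0"
  shows "(\<Sum>e\<in>S. K e (y - e) * T i j x' (y - e))
    = (if x + j \<le> N then w j * pa_p (\<Phi> j) x' i * pa_p (\<Psi> x) y j else 0)"
proof (cases "x' + j \<le> N")
  case True
  have r: "x \<in> {0..N}" "y \<in> {0..N - x}" "j \<in> {0..N - x'}" using xy ij True by (auto simp: triangle_def)
  have "(\<Sum>e\<in>S. K e (y - e) * T i j x' (y - e))
      = pa_p (\<Phi> j) x' i * (\<Sum>e\<in>S. if y - e \<in> {0..N - x'} then K e (y - e) * pa_p (\<Psi> x') (y - e) j else 0)"
    unfolding sum_distrib_left using ij x' True by (intro sum.cong) (auto simp: biv_T_def triangle_def)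
  also have "(\<Sum>e\<in>S. if y - e \<in> {0..N - x'} then K e (y - e) * pa_p (\<Psi> x') (y - e) j else 0)
      = (if j \<le> N - x then w j * pa_p (\<Psi> x) y j else 0)"
    using inverted_relation[OF \<Psi>(1)[OF r(1)] \<Psi>(1)[OF x'] S, of w K y j] rel w0 K0 r x' \<Psi>(2) by simp
  finally show ?thesis by (auto simp: algebra_simps)
next
  case False
  \<comment> \<open>Here T vanishes at x' although (x, j) may be admissible; the zero of
    \<open>w\<close> at the end of its range accounts for that.\<close>
  have "w j = 0" if "x + j \<le> N" using w0[of j] that False ij by (auto simp: triangle_def)
  moreover have "(\<Sum>e\<in>S. K e (y - e) * T i j x' (y - e)) = 0"
    using False by (intro sum.neutral) (auto simp: biv_T_def)
  ultimately show ?thesis by auto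
qed

text \<open>For each first superscript, the inverted relation between two Psi collapses the sum over
  the second one into a single term of the three-term relation of \<Phi>_j in x.\<close>

lemma difference_relation:
  assumes D: "D_relations N \<Phi> \<Psi> D" "zero_outside N D"
    and ij: "(i,j) \<in> triangle N" and xy: "(x,y) \<in> triangle N"
  shows "pa_deig (\<Phi> j) i * T i j x y = (\<Sum>(e,e')\<in>A2. D e e' (x-e) (y-e') * T i j (x-e) (y-e'))"
proof -
  have z: "D e e' x y = 0" if "(e,e') \<in> A2" "(x,y) \<in> triangle N" "(x+e,y+e') \<notin> triangle N" for e e' x y
    using D(2) that unfolding zero_outside_def by blast
  have rng: "0 \<le> i" "0 \<le> j" "i + j \<le> N" "0 \<le> x" "0 \<le> y" "x + y \<le> N" using ij xy by (auto simp: triangle_def)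
  have dj: "pa_diam (\<Phi> j) = N - j" using \<Phi>(2) rng by simp
  have rel: "(\<forall>j\<in>{0..N-x-1}.
           pa_c (pa_dual (\<Phi> j)) (x+1) * pa_p (pa_dual (\<Psi> x)) j y
             = pa_nu (\<Psi> x) / pa_nu (\<Psi> (x+1))
               * (\<Sum>e'\<in>{-1,0}. D 1 e' x y * pa_p (pa_dual (\<Psi> (x+1))) j (y+e')))"
    "(\<forall>j\<in>{0..N-x}.
           pa_a (pa_dual (\<Phi> j)) x * pa_p (pa_dual (\<Psi> x)) j y
             = (\<Sum>e'\<in>{-1,0,1}. D 0 e' x y * pa_p (pa_dual (\<Psi> x)) j (y+e')))"
    "(1 \<le> x \<longrightarrow> (\<forall>j\<in>{0..N-x+1}.
           pa_b (pa_dual (\<Phi> j)) (x-1) * pa_p (pa_dual (\<Psi> x)) j y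
             = pa_nu (\<Psi> x) / pa_nu (\<Psi> (x-1))
               * (\<Sum>e'\<in>{0,1}. D (-1) e' x y * pa_p (pa_dual (\<Psi> (x-1))) j (y+e'))))"
    if "(x,y) \<in> triangle N" for x y
    using D(1) that unfolding D_relations_def by blast+
  have 1: "(\<Sum>e'\<in>{-1,0}. D 1 e' (x-1) (y-e') * T i j (x-1) (y-e'))
     = (if x + j \<le> N then pa_c (pa_dual (\<Phi> j)) x * pa_p (\<Phi> j) (x-1) i * pa_p (\<Psi> x) y j else 0)"
  proof (cases "x = 0")
    case True
    then show ?thesis by (simp add: biv_T_def triangle_def pa_c_def Let_def)
  next
    case False
    show ?thesis
    proof (rule shifted_terms[OF _ ij xy, where w = "\<lambda>j. pa_c (pa_dual (\<Phi> j)) x"])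
      fix y' j assume "y' \<in> {0..N - (x - 1)}" "j \<in> {0..N - x}"
      then show "pa_c (pa_dual (\<Phi> j)) x * pa_p (pa_dual (\<Psi> (x-1))) j y' =
         pa_nu (\<Psi> (x-1)) / pa_nu (\<Psi> x) * (\<Sum>e\<in>{-1,0}. D 1 e (x-1) y' * pa_p (pa_dual (\<Psi> x)) j (y' + e))"
        using rel(1)[of "x - 1" y'] rng False by (simp add: triangle_def)
    next
      fix e y' assume "e \<in> {- 1, 0::int}" "y' \<in> {0..N - (x - 1)}" "y' + e \<notin> {0..N - x}"
      then show "D 1 e (x - 1) y' = 0"
        using rng False by (intro z) (auto simp: A2_def triangle_def)
    qed (use rng False in auto)
  qed
  have 2: "(\<Sum>e'\<in>{-1,0,1}. D 0 e' x (y-e') * T i j x (y-e'))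
     = (if x + j \<le> N then pa_a (pa_dual (\<Phi> j)) x * pa_p (\<Phi> j) x i * pa_p (\<Psi> x) y j else 0)"
  proof (rule shifted_terms[OF _ ij xy, where w = "\<lambda>j. pa_a (pa_dual (\<Phi> j)) x"])
    fix y' j assume "y' \<in> {0..N - x}" "j \<in> {0..N - x}"
    then show "pa_a (pa_dual (\<Phi> j)) x * pa_p (pa_dual (\<Psi> x)) j y' =
         pa_nu (\<Psi> x) / pa_nu (\<Psi> x) * (\<Sum>e\<in>{-1,0,1}. D 0 e x y' * pa_p (pa_dual (\<Psi> x)) j (y' + e))"
      using rel(2)[of "x" y'] rng pa_nu_nz[OF \<Psi>(1)[of x]] by (simp add: triangle_def)
  next
    fix e y' assume "e \<in> {- 1, 0, 1::int}" "y' \<in> {0..N - x}" "y' + e \<notin> {0..N - x}"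
    then show "D 0 e x y' = 0"
      using rng by (intro z) (auto simp: A2_def triangle_def)
  qed (use rng in auto)
  have 3: "(\<Sum>e'\<in>{0,1}. D (-1) e' (x+1) (y-e') * T i j (x+1) (y-e'))
     = (if x + j \<le> N then pa_b (pa_dual (\<Phi> j)) x * pa_p (\<Phi> j) (x+1) i * pa_p (\<Psi> x) y j else 0)"
  proof (cases "x = N")
    case True
    \<comment> \<open>Then \<Phi>_j has diameter N = x, and the coefficient b vanishes as the last
      entry.\<close>
    have "j = 0" if "x + j \<le> N" using True that rng by auto
    then show ?thesis using True dj by (auto simp: biv_T_def triangle_def pa_b_def)
  next
    case False
    show ?thesis
    proof (rule shifted_terms[OF _ ij xy, where w = "\<lambda>j. pa_b (pa_dual (\<Phi> j)) x"])
      fix y' j assume "y' \<in> {0..N - (x + 1)}" "j \<in> {0..N - x}"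
      then show "pa_b (pa_dual (\<Phi> j)) x * pa_p (pa_dual (\<Psi> (x+1))) j y' =
         pa_nu (\<Psi> (x+1)) / pa_nu (\<Psi> x) * (\<Sum>e\<in>{0,1}. D (-1) e (x+1) y' * pa_p (pa_dual (\<Psi> x)) j (y' + e))"
        using rel(3)[of "x + 1" y'] rng False by (simp add: triangle_def)
    next
      fix e y' assume "e \<in> {0,1::int}" "y' \<in> {0..N - (x + 1)}" "y' + e \<notin> {0..N - x}"
      then show "D (-1) e (x + 1) y' = 0"
        using rng False by (intro z) (auto simp: A2_def triangle_def)
    next
      fix j assume "j \<in> {0..N - x}" "N - (x + 1) < j"
      \<comment> \<open>For this j the diameter N - j equals x, so x is again the last
        index.\<close>
      then have "j = N - x" by auto
      then show "pa_b (pa_dual (\<Phi> j)) x = 0" using rng \<Phi>(2)[of j] by (simp add: pa_b_def)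
    qed (use rng False in auto)
  qed
  have "(\<Sum>(e,e')\<in>A2. D e e' (x-e) (y-e') * T i j (x-e) (y-e')) =
     (if x + j \<le> N then (pa_c (pa_dual (\<Phi> j)) x * pa_p (\<Phi> j) (x-1) i + pa_a (pa_dual (\<Phi> j)) x * pa_p (\<Phi> j) x i
        + pa_b (pa_dual (\<Phi> j)) x * pa_p (\<Phi> j) (x+1) i) * pa_p (\<Psi> x) y j else 0)"
    unfolding sum_A2 using 1 2 3 by (simp add: distrib_right)
  also have "\<dots> = pa_deig (\<Phi> j) i * T i j x y"
    using pa_p_dual_three_term[of "\<Phi> j" x i] \<Phi> rng ij xy by (auto simp: biv_T_def)
  finally show ?thesis by simp
qed

lemma difference_y:
  assumes ij: "(i,j) \<in> triangle N" and xy: "(x,y) \<in> triangle N"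
  shows "pa_deig (\<Psi> x) j * T i j x y
          = pa_b (pa_dual (\<Psi> x)) y * T i j x (y+1)
            + pa_a (pa_dual (\<Psi> x)) y * T i j x y
            + pa_c (pa_dual (\<Psi> x)) y * T i j x (y-1)"
proof (cases "x + j \<le> N")
  case True
  have r: "x \<in> {0..N}" "j \<in> {0..N - x}" "y \<in> {0..N - x}" using ij xy True by (auto simp: triangle_def)
  note d = \<Psi>(2)[OF r(1)]
  have "pa_deig (\<Psi> x) j * pa_p (\<Psi> x) y j = pa_c (pa_dual (\<Psi> x)) y * pa_p (\<Psi> x) (y - 1) j
     + pa_a (pa_dual (\<Psi> x)) y * pa_p (\<Psi> x) y j + pa_b (pa_dual (\<Psi> x)) y * pa_p (\<Psi> x) (y + 1) j"
    using pa_p_dual_three_term[OF \<Psi>(1)[OF r(1)], of y j] r d by simp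
  moreover have "pa_c (pa_dual (\<Psi> x)) y * T i j x (y - 1) = pa_c (pa_dual (\<Psi> x)) y * (pa_p (\<Phi> j) x i * pa_p (\<Psi> x) (y - 1) j)"
    using r True ij by (cases "y = 0") (auto simp: pa_c_def Let_def biv_T_def triangle_def)
  moreover have "pa_b (pa_dual (\<Psi> x)) y * T i j x (y + 1) = pa_b (pa_dual (\<Psi> x)) y * (pa_p (\<Phi> j) x i * pa_p (\<Psi> x) (y + 1) j)"
    using r True ij d by (cases "y = N - x") (auto simp: pa_b_def biv_T_def triangle_def)
  moreover have "T i j x y = pa_p (\<Phi> j) x i * pa_p (\<Psi> x) y j"
    using ij xy True by (simp add: biv_T_def)
  ultimately show ?thesis by algebra
qed (simp add: biv_T_def)

end

section \<open>Bivariate polynomials and compatible families\<close>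

lemma newton_basis_poly:
  fixes c :: "nat \<Rightarrow> complex"
  assumes "c n \<noteq> 0"
  obtains p where "degree p = n" "\<And>z. poly p z = (\<Sum>k\<le>n. c k * (\<Prod>j<k. z - a j))"
proof -
  define q where "q k = (\<Prod>j<k. [:- a j, 1:])" for k
  have dq: "degree (q k) = k" for k
    unfolding q_def by (subst degree_prod_eq_sum_degree) auto
  define p where "p = (\<Sum>k\<le>n. smult (c k) (q k))"
  have "degree p = n"
  proof (cases n)
    case 0
    then show ?thesis by (simp add: p_def q_def)
  next
    case (Suc m)
    have "degree (\<Sum>k\<le>m. smult (c k) (q k)) \<le> m"
      by (rule degree_sum_le) (auto simp: dq intro: order_trans[OF degree_smult_le])
    then have "degree ((\<Sum>k\<le>m. smult (c k) (q k)) + smult (c n) (q n)) = n"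
      using assms Suc by (subst degree_add_eq_right) (auto simp: dq)
    then show ?thesis by (simp add: p_def Suc)
  qed
  moreover have "poly p z = (\<Sum>k\<le>n. c k * (\<Prod>j<k. z - a j))" for z
    by (simp add: p_def q_def poly_sum poly_prod)
  ultimately show ?thesis using that by blast
qed

lemma pa_p_polynomial:
  assumes "is_param_array \<Phi>" "i \<in> {0..pa_diam \<Phi>}"
  obtains p where "degree p = nat i" "p \<noteq> 0" "\<And>x. pa_p \<Phi> x i = poly p (pa_eig \<Phi> x)"
proof -
  interpret leonard \<Phi> by unfold_locales fact
  define n where "n = nat i"
  have i: "i = int n" "n \<le> d" using assms(2) by (auto simp: n_def diam)
  define c where "c k = (\<Prod>j<k. (s n - s j) / f (j + 1))" for k
  have c: "c n \<noteq> 0" unfolding c_def using s_inj fg_nz i by auto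
  then obtain p where p: "degree p = n" "\<And>z. poly p z = (\<Sum>k\<le>n. c k * (\<Prod>j<k. z - \<theta> j))"
    using newton_basis_poly[of c n \<theta>] by blast
  have u: "pa_u \<Phi> i z = poly p z" for z
    unfolding pa_u_def i(1) sum_int_atLeastAtMost0 prod_int_atLeast0 p c_def prod.distrib[symmetric]
    by (auto intro!: sum.cong prod.cong simp: \<theta>_def s_def f_def add.commute)
  \<comment> \<open>For i = 0 the degree alone does not exclude the zero polynomial; the value at
    \<theta>_0 is \<open>c 0 = 1\<close>.\<close>
  have "p \<noteq> 0"
  proof
    assume "p = 0"
    then have 0: "(\<Sum>k\<le>n. c k * (\<Prod>j<k. \<theta> 0 - \<theta> j)) = 0" using p(2)[of "\<theta> 0"] by simp
    have "(\<Sum>k\<le>n. c k * (\<Prod>j<k. \<theta> 0 - \<theta> j)) = (\<Sum>k\<in>{0}. c k * (\<Prod>j<k. \<theta> 0 - \<theta> j))"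
      by (rule sum.mono_neutral_right) auto
    with 0 show False by (simp add: c_def)
  qed
  then show ?thesis using pa_k_nz[OF assms(2)] p(1) u that[of "smult (pa_k \<Phi> i) p"]
    by (simp add: pa_p_def n_def)
qed

lemma pa_p_0:
  assumes "is_param_array \<Phi>" shows "pa_p \<Phi> x 0 = 1"
proof -
  interpret leonard \<Phi> by unfold_locales fact
  show ?thesis using pa_k_0 by (simp add: pa_p_def pa_u_def)
qed

lemma pa_b_nz:
  assumes "is_param_array \<Phi>" "i \<in> {0..<pa_diam \<Phi>}" shows "pa_b \<Phi> i \<noteq> 0"
proof -
  interpret leonard \<Phi> by unfold_locales fact
  have i: "i = int (nat i)" "nat i < d" using assms(2) diam by auto
  show ?thesis
    using pa_b_eq[of "nat i"] i fg_nz[of "nat i + 1"] tau_nz[of "nat i" "nat i"] tau_nz[of "nat i + 1" "nat i + 1"]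
    by (simp add: B_def)
qed

text \<open>The two degree bounds are carried together through the induction on j. Zero coefficients
  are exempt since \<open>degree 0 = 0\<close> would otherwise force b \<le> n for every b.\<close>

definition bideg_le :: "complex poly poly \<Rightarrow> nat \<Rightarrow> nat \<Rightarrow> bool" where
  "bideg_le P n j \<longleftrightarrow> degree P \<le> j \<and> (\<forall>b. coeff P b \<noteq> 0 \<longrightarrow> b + degree (coeff P b) \<le> n)"

lemma bideg_le_mono: "bideg_le P n j \<Longrightarrow> n \<le> n' \<Longrightarrow> j \<le> j' \<Longrightarrow> bideg_le P n' j'"
  unfolding bideg_le_def by (meson order_trans)

lemma bideg_le_0: "bideg_le 0 n j"
  by (simp add: bideg_le_def)

lemma bideg_le_add:
  assumes "bideg_le P n j" "bideg_le Q n j" shows "bideg_le (P + Q) n j"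
  unfolding bideg_le_def
proof (intro conjI allI impI)
  show "degree (P + Q) \<le> j" using assms by (auto simp: bideg_le_def degree_add_le)
  fix b assume b: "coeff (P + Q) b \<noteq> 0"
  have *: "degree (coeff R b) \<le> n - b \<and> (coeff R b \<noteq> 0 \<longrightarrow> b \<le> n)" if "bideg_le R n j" for R
    using that unfolding bideg_le_def by (cases "coeff R b = 0") force+
  have "coeff P b \<noteq> 0 \<or> coeff Q b \<noteq> 0" using b by auto
  then have "b \<le> n" using *[OF assms(1)] *[OF assms(2)] by auto
  moreover have "degree (coeff P b + coeff Q b) \<le> n - b"
    using *[OF assms(1)] *[OF assms(2)] by (intro degree_add_le) auto
  ultimately show "b + degree (coeff (P + Q) b) \<le> n" by simp
qed

lemma bideg_le_smult:
  assumes "bideg_le P n j" "degree p \<le> m" shows "bideg_le (smult p P) (m + n) j"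
  unfolding bideg_le_def
proof (intro conjI allI impI)
  show "degree (smult p P) \<le> j" using assms order_trans[OF degree_smult_le] by (auto simp: bideg_le_def)
  fix b assume "coeff (smult p P) b \<noteq> 0"
  then have "coeff P b \<noteq> 0" by auto
  then have "b + degree (coeff P b) \<le> n" using assms by (auto simp: bideg_le_def)
  moreover have "degree (p * coeff P b) \<le> degree p + degree (coeff P b)" by (rule degree_mult_le)
  ultimately show "b + degree (coeff (smult p P) b) \<le> m + n" using assms(2) by simp
qed

lemma bideg_le_pCons:
  assumes "bideg_le P n j" shows "bideg_le (pCons 0 P) (Suc n) (Suc j)"
  unfolding bideg_le_def
proof (intro conjI allI impI)
  show "degree (pCons 0 P) \<le> Suc j"
    using assms degree_pCons_le[of 0 P] by (auto simp: bideg_le_def)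
  fix b assume "coeff (pCons 0 P) b \<noteq> 0"
  then show "b + degree (coeff (pCons 0 P) b) \<le> Suc n"
    using assms by (cases b) (auto simp: bideg_le_def)
qed

lemma bipoly_simps:
  "bipoly (P + Q) u v = bipoly P u v + bipoly Q u v"
  "bipoly (smult p P) u v = poly p u * bipoly P u v"
  "bipoly (pCons 0 P) u v = v * bipoly P u v"
  "bipoly 0 u v = 0" "bipoly 1 u v = 1"
  by (simp_all add: bipoly_def)

lemma total_degree_eq:
  assumes "bideg_le P n j" "coeff (coeff P b) a \<noteq> 0" "a + b = n"
  shows "total_degree P = n"
  unfolding total_degree_def
proof (rule Max_eqI)
  have le: "a + b \<le> n" if "coeff (coeff P b) a \<noteq> 0" for a b
  proof -
    have "coeff P b \<noteq> 0" "a \<le> degree (coeff P b)" using that by (auto intro: le_degree)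
    then show ?thesis using assms(1) unfolding bideg_le_def by fastforce
  qed
  have "insert 0 {a + b |a b. coeff (coeff P b) a \<noteq> 0} \<subseteq> {..n}" using le by auto
  then show "finite (insert 0 {a + b |a b. coeff (coeff P b) a \<noteq> 0})" by (rule finite_subset) simp
  show "n \<in> insert 0 {a + b |a b. coeff (coeff P b) a \<noteq> 0}" using assms by blast
  show "k \<le> n" if "k \<in> insert 0 {a + b |a b. coeff (coeff P b) a \<noteq> 0}" for k
    using that le by auto
qed

section \<open>Duality for T and the recurrence relations\<close>

locale compatible_families = array_families +
  fixes C :: "int \<Rightarrow> int \<Rightarrow> int \<Rightarrow> int \<Rightarrow> complex" and F G :: "int \<Rightarrow> int \<Rightarrow> complex"
    and t :: "int \<Rightarrow> complex"
  assumes N: "1 \<le> N"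
    and eig: "\<And>j x. j \<in> {0..N} \<Longrightarrow> pa_eig (\<Phi> j) x = t x"
    and zC: "zero_outside N C"
    and relC: "C_relations N \<Phi> \<Psi> C"
    and FG: "FG_relation N \<Phi> \<Psi> F G"
begin

sublocale dual: array_families N "\<lambda>x. pa_dual (\<Psi> x)" "\<lambda>j. pa_dual (\<Phi> j)"
  using \<Phi> \<Psi> by unfold_locales (auto simp: is_param_array_dual)

text \<open>Passing to the dual families reverses the four indices: degrees and variables trade
  places, and so do \<Phi> and \<Psi>. The condition x + j \<le> N is preserved.\<close>

definition T_dual :: "int \<Rightarrow> int \<Rightarrow> int \<Rightarrow> int \<Rightarrow> complex" where
  "T_dual i j x y = dual.T y x j i"

lemma T_dual_eq: "T_dual i j x y = (if (i,j) \<in> triangle N \<and> (x,y) \<in> triangle N \<and> x + j \<le> N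
    then pa_p (pa_dual (\<Psi> x)) j y * pa_p (pa_dual (\<Phi> j)) i x else 0)"
  by (auto simp: T_dual_def biv_T_def triangle_def add.commute)

definition nu_prod :: "int \<Rightarrow> int \<Rightarrow> complex" where "nu_prod x j = pa_nu (\<Psi> x) * pa_nu (\<Phi> j)"

lemma nu_nz: "j \<in> {0..N} \<Longrightarrow> pa_nu (\<Phi> j) \<noteq> 0" "x \<in> {0..N} \<Longrightarrow> pa_nu (\<Psi> x) \<noteq> 0"
  using \<Phi> \<Psi> pa_nu_nz by auto

lemma F_nz: "(x,y) \<in> triangle N \<Longrightarrow> F x y \<noteq> 0"
  using FG unfolding FG_relation_def by blast

lemma k_nz:
  assumes "(i,j) \<in> triangle N" "(x,y) \<in> triangle N" "x + j \<le> N"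
  shows "pa_k (\<Phi> j) i \<noteq> 0" "pa_k (pa_dual (\<Phi> j)) x \<noteq> 0" "pa_k (\<Psi> x) j \<noteq> 0" "pa_k (pa_dual (\<Psi> x)) y \<noteq> 0"
proof -
  have r: "j \<in> {0..N}" "x \<in> {0..N}" using assms by (auto simp: triangle_def)
  interpret P: leonard "\<Phi> j" by unfold_locales (rule \<Phi>(1)[OF r(1)])
  interpret P': leonard "pa_dual (\<Phi> j)" by unfold_locales (rule P.dual_is_param_array)
  interpret Q: leonard "\<Psi> x" by unfold_locales (rule \<Psi>(1)[OF r(2)])
  interpret Q': leonard "pa_dual (\<Psi> x)" by unfold_locales (rule Q.dual_is_param_array)
  show "pa_k (\<Phi> j) i \<noteq> 0" "pa_k (pa_dual (\<Phi> j)) x \<noteq> 0" "pa_k (\<Psi> x) j \<noteq> 0" "pa_k (pa_dual (\<Psi> x)) y \<noteq> 0"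
    using assms r \<Phi>(2) \<Psi>(2)
    by (auto intro!: P.pa_k_nz P'.pa_k_nz Q.pa_k_nz Q'.pa_k_nz simp: triangle_def)
qed

lemma FG_eq:
  assumes "(i,j) \<in> triangle N" "(x,y) \<in> triangle N" "x + j \<le> N"
  shows "pa_k (\<Phi> j) i / pa_k (pa_dual (\<Phi> j)) x * (pa_k (\<Psi> x) j / pa_k (pa_dual (\<Psi> x)) y) * F x y
          = G i j / nu_prod x j"
  using FG assms unfolding FG_relation_def nu_prod_def by blast

lemma nu_prod_nz: "x \<in> {0..N} \<Longrightarrow> j \<in> {0..N} \<Longrightarrow> nu_prod x j \<noteq> 0"
  using nu_nz by (simp add: nu_prod_def)

lemma G_nz: assumes "(i,j) \<in> triangle N" shows "G i j \<noteq> 0"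
proof -
  \<comment> \<open>The point (0,0) satisfies x + j \<le> N for every j, so it tests every
    \<open>G i j\<close>.\<close>
  have a: "(0,0) \<in> triangle N" "0 + j \<le> N" using assms by (auto simp: triangle_def)
  show ?thesis using FG_eq[OF assms a] k_nz[OF assms a] F_nz[OF a(1)] by auto
qed

text \<open>The FG relation is precisely what is needed to exchange p for its dual in both factors;
  the two nu stay behind as \<open>nu_prod\<close>. Allowing (i,j) outside the triangle, where both
  sides are 0, covers the shifted terms without any knowledge of G there.\<close>

lemma T_div_G:
  assumes "(x,y) \<in> triangle N"
  shows "T i j x y / G i j = T_dual i j x y / (nu_prod x j * F x y)"
proof (cases "(i,j) \<in> triangle N \<and> x + j \<le> N")
  case True
  then have a: "(i,j) \<in> triangle N" "(x,y) \<in> triangle N" "x + j \<le> N" using assms by auto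
  note nz = k_nz[OF a] F_nz[OF a(2)] G_nz[OF a(1)]
  have r: "0 \<le> i" "0 \<le> j" "0 \<le> x" "0 \<le> y" "x \<in> {0..N}" "j \<in> {0..N}" using a by (auto simp: triangle_def)
  note nz' = nu_prod_nz[OF r(5,6)]
  have 1: "pa_p (\<Phi> j) x i = pa_p (pa_dual (\<Phi> j)) i x * pa_k (\<Phi> j) i / pa_k (pa_dual (\<Phi> j)) x"
    using pa_p_duality[OF r(1,3), of "\<Phi> j"] nz by (simp add: eq_divide_eq)
  have 2: "pa_p (\<Psi> x) y j = pa_p (pa_dual (\<Psi> x)) j y * pa_k (\<Psi> x) j / pa_k (pa_dual (\<Psi> x)) y"
    using pa_p_duality[OF r(2,4), of "\<Psi> x"] nz by (simp add: eq_divide_eq)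
  have "T i j x y * F x y = pa_p (pa_dual (\<Psi> x)) j y * pa_p (pa_dual (\<Phi> j)) i x *
     (pa_k (\<Phi> j) i / pa_k (pa_dual (\<Phi> j)) x * (pa_k (\<Psi> x) j / pa_k (pa_dual (\<Psi> x)) y) * F x y)"
    using a by (simp add: biv_T_def 1 2)
  also have "\<dots> = T_dual i j x y * (G i j / nu_prod x j)"
    unfolding FG_eq[OF a] using a by (simp add: T_dual_eq)
  finally show ?thesis using nz nz' by (simp add: field_simps)
next
  case False
  then show ?thesis by (auto simp: biv_T_def T_dual_eq)
qed

text \<open>The coefficients \<open>C\<close> in the normalisation of the \<open>D\<close>-relations of the dual families.\<close>

definition D' :: "int \<Rightarrow> int \<Rightarrow> int \<Rightarrow> int \<Rightarrow> complex" where
  "D' e' e j i = pa_nu (\<Phi> (j + e')) / pa_nu (\<Phi> j) * C e e' i j"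

text \<open>The quotient of nu in \<open>D'\<close> cancels the prefactor in the definition of the
  D-relations, which leaves the C-relations.\<close>

lemma dual_D_relations: "D_relations N (\<lambda>x. pa_dual (\<Psi> x)) (\<lambda>j. pa_dual (\<Phi> j)) D'"
  unfolding D_relations_def
proof (intro ballI, clarify)
  fix j i assume ji: "(j,i) \<in> triangle N"
  then have ij: "(i,j) \<in> triangle N" and r: "0 \<le> j" "j \<le> N" by (auto simp: triangle_def)
  have c: "(\<forall>x\<in>{0..N-j-1}.
           pa_c (\<Psi> x) (j+1) * pa_p (\<Phi> j) x i
             = (\<Sum>e\<in>{-1,0}. C e 1 i j * pa_p (\<Phi> (j+1)) x (i+e)))"
      "(\<forall>x\<in>{0..N-j}.
           pa_a (\<Psi> x) j * pa_p (\<Phi> j) x i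
             = (\<Sum>e\<in>{-1,0,1}. C e 0 i j * pa_p (\<Phi> j) x (i+e)))"
      "(1 \<le> j \<longrightarrow> (\<forall>x\<in>{0..N-j+1}.
           pa_b (\<Psi> x) (j-1) * pa_p (\<Phi> j) x i
             = (\<Sum>e\<in>{0,1}. C e (-1) i j * pa_p (\<Phi> (j-1)) x (i+e))))"
    using relC ij unfolding C_relations_def by blast+
  have s: "pa_nu (\<Phi> j) / pa_nu (\<Phi> (j + e')) * (\<Sum>e\<in>S. D' e' e j i * P e) = (\<Sum>e\<in>S. C e e' i j * P e)"
    if "j + e' \<in> {0..N}" for e' S P
    unfolding sum_distrib_left D'_def using nu_nz(1)[of j] nu_nz(1)[OF that] r
    by (intro sum.cong) auto
  show "(\<forall>x\<in>{0..N - j - 1}. pa_c (pa_dual (pa_dual (\<Psi> x))) (j + 1) * pa_p (pa_dual (pa_dual (\<Phi> j))) x i =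
           pa_nu (pa_dual (\<Phi> j)) / pa_nu (pa_dual (\<Phi> (j + 1))) *
           (\<Sum>e'\<in>{- 1, 0}. D' 1 e' j i * pa_p (pa_dual (pa_dual (\<Phi> (j + 1)))) x (i + e'))) \<and>
       (\<forall>x\<in>{0..N - j}. pa_a (pa_dual (pa_dual (\<Psi> x))) j * pa_p (pa_dual (pa_dual (\<Phi> j))) x i =
           (\<Sum>e'\<in>{- 1, 0, 1}. D' 0 e' j i * pa_p (pa_dual (pa_dual (\<Phi> j))) x (i + e'))) \<and>
       (1 \<le> j \<longrightarrow> (\<forall>x\<in>{0..N - j + 1}. pa_b (pa_dual (pa_dual (\<Psi> x))) (j - 1) * pa_p (pa_dual (pa_dual (\<Phi> j))) x i =
           pa_nu (pa_dual (\<Phi> j)) / pa_nu (pa_dual (\<Phi> (j - 1))) *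
           (\<Sum>e'\<in>{0, 1}. D' (- 1) e' j i * pa_p (pa_dual (pa_dual (\<Phi> (j - 1)))) x (i + e'))))"
    unfolding pa_dual_dual pa_nu_dual
  proof (intro conjI impI ballI)
    fix x assume x: "x \<in> {0..N - j - 1}"
    then show "pa_c (\<Psi> x) (j + 1) * pa_p (\<Phi> j) x i =
           pa_nu (\<Phi> j) / pa_nu (\<Phi> (j + 1)) * (\<Sum>e'\<in>{- 1, 0}. D' 1 e' j i * pa_p (\<Phi> (j + 1)) x (i + e'))"
      using c(1) r by (subst s) auto
  next
    fix x assume x: "x \<in> {0..N - j}"
    have "(\<Sum>e'\<in>{- 1, 0, 1}. D' 0 e' j i * pa_p (\<Phi> j) x (i + e')) = (\<Sum>e'\<in>{- 1, 0, 1}. C e' 0 i j * pa_p (\<Phi> j) x (i + e'))"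
      using nu_nz(1)[of j] r by (intro sum.cong) (auto simp: D'_def)
    then show "pa_a (\<Psi> x) j * pa_p (\<Phi> j) x i = (\<Sum>e'\<in>{- 1, 0, 1}. D' 0 e' j i * pa_p (\<Phi> j) x (i + e'))"
      using c(2) x by simp
  next
    fix x assume j: "1 \<le> j" and x: "x \<in> {0..N - j + 1}"
    show "pa_b (\<Psi> x) (j - 1) * pa_p (\<Phi> j) x i =
           pa_nu (\<Phi> j) / pa_nu (\<Phi> (j - 1)) * (\<Sum>e'\<in>{0, 1}. D' (- 1) e' j i * pa_p (\<Phi> (j - 1)) x (i + e'))"
      using c(3) r j x s[where e' = "-1" and S = "{0,1}" and P = "\<lambda>e. pa_p (\<Phi> (j - 1)) x (i + e)"] by simp
  qed
qed

lemma A2_swap: "(e', e) \<in> A2 \<longleftrightarrow> (e, e') \<in> A2"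
  by (auto simp: A2_def)

lemma dual_zero: "zero_outside N D'"
  unfolding zero_outside_def
proof (intro ballI, clarify)
  fix e' e j i assume "(e', e) \<in> A2" "(j, i) \<in> triangle N" "(j + e', i + e) \<notin> triangle N"
  then have "(e, e') \<in> A2" "(i, j) \<in> triangle N" "(i + e, j + e') \<notin> triangle N"
    by (auto simp: A2_swap triangle_def)
  then have "C e e' i j = 0" using zC unfolding zero_outside_def by blast
  then show "D' e' e j i = 0" by (simp add: D'_def)
qed

lemma recurrence_y:
  assumes ij: "(i,j) \<in> triangle N" and xy: "(x,y) \<in> triangle N"
  shows "pa_eig (\<Psi> x) y * T i j x y
    = (\<Sum>(e,e')\<in>A2. G i j / G (i-e) (j-e') * C e e' (i-e) (j-e') * T (i-e) (j-e') x y)"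
proof -
  have r: "(y,x) \<in> triangle N" "(j,i) \<in> triangle N" "x \<in> {0..N}" "j \<in> {0..N}" using ij xy by (auto simp: triangle_def)
  let ?c = "G i j / (nu_prod x j * F x y)"
  have nz: "F x y \<noteq> 0" "G i j \<noteq> 0" "nu_prod x j \<noteq> 0" using F_nz G_nz nu_prod_nz ij xy r by auto
  have "(\<Sum>(e,e')\<in>A2. G i j / G (i-e) (j-e') * C e e' (i-e) (j-e') * T (i-e) (j-e') x y)
    = (\<Sum>(e,e')\<in>A2. ?c * (D' e' e (j - e') (i - e) * T_dual (i-e) (j-e') x y))"
  proof (rule sum.cong)
    fix p assume "p \<in> A2"
    obtain e e' where p: "p = (e,e')" by (cases p)
    have "G i j / G (i-e) (j-e') * C e e' (i-e) (j-e') * T (i-e) (j-e') x y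
       = G i j * C e e' (i-e) (j-e') * (T (i-e) (j-e') x y / G (i-e) (j-e'))" by simp
    also have "\<dots> = G i j * C e e' (i-e) (j-e') * (T_dual (i-e) (j-e') x y / (nu_prod x (j - e') * F x y))"
      unfolding T_div_G[OF xy] ..
    \<comment> \<open>The quotient of nu in \<open>D'\<close> replaces nu(\<Phi>_(j-e')) by
      nu(\<Phi>_j), so the constant in front becomes independent of the shift.\<close>
    also have "\<dots> = ?c * (D' e' e (j - e') (i - e) * T_dual (i-e) (j-e') x y)"
      using nu_nz(1)[OF r(4)] nz by (simp add: D'_def nu_prod_def mult_ac)
    finally show "(case p of (e, e') \<Rightarrow> G i j / G (i-e) (j-e') * C e e' (i-e) (j-e') * T (i-e) (j-e') x y)
       = (case p of (e, e') \<Rightarrow> ?c * (D' e' e (j - e') (i - e) * T_dual (i-e) (j-e') x y))"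
      by (simp add: p)
  qed simp
  also have "\<dots> = ?c * (\<Sum>(e,e')\<in>A2. D' e' e (j - e') (i - e) * T_dual (i-e) (j-e') x y)"
    by (simp add: sum_distrib_left case_prod_beta)
  also have "(\<Sum>(e,e')\<in>A2. D' e' e (j - e') (i - e) * T_dual (i-e) (j-e') x y)
     = (\<Sum>(e',e)\<in>A2. D' e' e (j - e') (i - e) * dual.T y x (j - e') (i - e))"
    by (rule sum.reindex_bij_witness[of _ prod.swap prod.swap]) (auto simp: A2_swap T_dual_def)
  also have "\<dots> = pa_eig (\<Psi> x) y * T_dual i j x y"
    using dual.difference_relation[OF dual_D_relations dual_zero r(1,2)] by (simp add: T_dual_def)
  also have "?c * (pa_eig (\<Psi> x) y * T_dual i j x y) = pa_eig (\<Psi> x) y * G i j * (T i j x y / G i j)"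
    unfolding T_div_G[OF xy] by simp
  also have "\<dots> = pa_eig (\<Psi> x) y * T i j x y" using nz by simp
  finally show ?thesis by simp
qed

text \<open>Only i is shifted, so the factor \<open>nu_prod x j * F x y\<close> is common to all
  terms and the recurrence is a three-term relation for \<open>T_dual\<close>.\<close>

lemma recurrence_x:
  assumes ij: "(i,j) \<in> triangle N" and xy: "(x,y) \<in> triangle N"
  shows "t x * T i j x y
          = G i j / G (i+1) j * pa_b (\<Phi> j) i * T (i+1) j x y
            + pa_a (\<Phi> j) i * T i j x y
            + G i j / G (i-1) j * pa_c (\<Phi> j) i * T (i-1) j x y"
proof -
  have r: "x \<in> {0..N}" "j \<in> {0..N}" "i \<in> {0..N-j}" "0 \<le> y" "x + y \<le> N" using ij xy by (auto simp: triangle_def)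
  have nz: "F x y \<noteq> 0" "G i j \<noteq> 0" "nu_prod x j \<noteq> 0" using F_nz G_nz nu_prod_nz ij xy r by auto
  have T_dual: "t x * T_dual i j x y = pa_c (\<Phi> j) i * T_dual (i - 1) j x y + pa_a (\<Phi> j) i * T_dual i j x y + pa_b (\<Phi> j) i * T_dual (i + 1) j x y"
  proof (cases "x + j \<le> N")
    case True
    have "t x * pa_p (pa_dual (\<Phi> j)) i x = pa_c (\<Phi> j) i * pa_p (pa_dual (\<Phi> j)) (i - 1) x
       + pa_a (\<Phi> j) i * pa_p (pa_dual (\<Phi> j)) i x + pa_b (\<Phi> j) i * pa_p (pa_dual (\<Phi> j)) (i + 1) x"
      using pa_p_dual_three_term[of "pa_dual (\<Phi> j)" i x] r True \<Phi> by (simp add: pa_dual_dual is_param_array_dual eig)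
    moreover have "pa_c (\<Phi> j) i * T_dual (i - 1) j x y = pa_c (\<Phi> j) i * (pa_p (pa_dual (\<Psi> x)) j y * pa_p (pa_dual (\<Phi> j)) (i - 1) x)"
      using r True xy by (cases "i = 0") (auto simp: pa_c_def T_dual_eq triangle_def Let_def)
    moreover have "pa_b (\<Phi> j) i * T_dual (i + 1) j x y = pa_b (\<Phi> j) i * (pa_p (pa_dual (\<Psi> x)) j y * pa_p (pa_dual (\<Phi> j)) (i + 1) x)"
      using r True xy \<Phi>(2)[OF r(2)] by (cases "i = N - j") (auto simp: pa_b_def T_dual_eq triangle_def)
    moreover have "T_dual i j x y = pa_p (pa_dual (\<Psi> x)) j y * pa_p (pa_dual (\<Phi> j)) i x"
      using ij xy True by (simp add: T_dual_eq)
    ultimately show ?thesis by algebra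
  qed (simp add: T_dual_eq)
  have "G i j / G (i+1) j * pa_b (\<Phi> j) i * T (i+1) j x y + pa_a (\<Phi> j) i * T i j x y + G i j / G (i-1) j * pa_c (\<Phi> j) i * T (i-1) j x y
    = G i j * (pa_c (\<Phi> j) i * (T (i-1) j x y / G (i-1) j) + pa_a (\<Phi> j) i * (T i j x y / G i j) + pa_b (\<Phi> j) i * (T (i+1) j x y / G (i+1) j))"
    using nz by (simp add: algebra_simps)
  also have "\<dots> = G i j / (nu_prod x j * F x y) * (t x * T_dual i j x y)"
    unfolding T_div_G[OF xy] T_dual by (simp add: add_divide_distrib distrib_left)
  also have "\<dots> = G i j * t x * (T i j x y / G i j)"
    unfolding T_div_G[OF xy] by simp
  also have "\<dots> = t x * T i j x y" using nz by simp
  finally show ?thesis by simp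
qed

end

section \<open>Degree and orthogonality of the T\<close>

context compatible_families
begin

text \<open>In the inverted b-relation at row 0 the term e = 1 would need the index -1. What is left
  equates b_j(Psi_0), which is nonzero, with a multiple of this coefficient.\<close>

lemma lowering_coeff_nz:
  assumes "j \<in> {0..<N}" shows "C 0 (-1) 0 (j + 1) \<noteq> 0"
proof -
  have r: "j \<in> {0..N}" "j + 1 \<in> {0..N}" using assms by auto
  let ?A = "pa_dual (\<Phi> j)" and ?B = "pa_dual (\<Phi> (j + 1))"
  let ?K = "\<lambda>e i. pa_nu (\<Phi> j) / pa_nu (\<Phi> (j + 1)) * C e (-1) i (j + 1)"
  have d: "pa_diam (\<Phi> j) = N - j" "pa_diam (\<Phi> (j + 1)) = N - (j + 1)" using \<Phi>(2) r by auto
  have "(if 0 \<le> pa_diam ?A then pa_b (\<Psi> 0) j * pa_p ?A 0 0 else 0)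
    = (\<Sum>e\<in>{0,1}. if 0 - e \<in> {0..pa_diam ?B} then ?K e (0 - e) * pa_p ?B (0 - e) 0 else 0)"
  proof (rule inverted_relation)
    fix i x assume *: "i \<in> {0..pa_diam ?B}" "x \<in> {0..pa_diam ?A}"
    then have "(i, j + 1) \<in> triangle N" "x \<in> {0..N - (j + 1) + 1}" using r d by (auto simp: triangle_def)
    then have "pa_b (\<Psi> x) j * pa_p (\<Phi> (j + 1)) x i = (\<Sum>e\<in>{0,1}. C e (-1) i (j + 1) * pa_p (\<Phi> j) x (i + e))"
      using relC r unfolding C_relations_def by fastforce
    then show "pa_b (\<Psi> x) j * pa_p (pa_dual ?B) x i =
       pa_nu ?B / pa_nu ?A * (\<Sum>e\<in>{0,1}. ?K e i * pa_p (pa_dual ?A) x (i + e))"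
      using nu_nz(1)[OF r(1)] nu_nz(1)[OF r(2)] by (simp add: pa_dual_dual pa_nu_dual field_simps)
  next
    fix x assume "x \<in> {0..pa_diam ?A}" "pa_diam ?B < x"
    then have "x = N - j" using d by simp
    then show "pa_b (\<Psi> x) j = 0" using r \<Psi>(2)[of "N - j"] by (simp add: pa_b_def)
  qed (use r d assms in \<open>auto simp: is_param_array_dual \<Phi>(1)\<close>)
  then have "pa_b (\<Psi> 0) j * pa_p ?A 0 0 = ?K 0 0 * pa_p ?B 0 0"
    using assms d by simp
  moreover have "pa_b (\<Psi> 0) j \<noteq> 0" using assms \<Psi>[of 0] by (intro pa_b_nz) auto
  moreover have "pa_p ?A 0 0 = 1" using \<Phi>(1)[OF r(1)] by (intro pa_p_0 is_param_array_dual)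
  ultimately show ?thesis by auto
qed

definition represents :: "complex poly poly \<Rightarrow> int \<Rightarrow> int \<Rightarrow> bool" where
  "represents P i j \<longleftrightarrow> (\<forall>(x,y)\<in>triangle N. T i j x y = bipoly P (t x) (pa_eig (\<Psi> x) y))"

lemma represents_outside: "(i,j) \<notin> triangle N \<Longrightarrow> represents 0 i j"
  by (auto simp: represents_def biv_T_def bipoly_simps)

text \<open>As p_(x,0) = 1, T_(i,j) is T_(0,j) times p_(x,i) of \<Phi>_j, a polynomial of degree i
  in t_x.\<close>

lemma T_factor:
  assumes "(i,j) \<in> triangle N" "represents P 0 j" "degree P = nat j" "bideg_le P (nat j) (nat j)"
  obtains Q where "represents Q i j" "degree Q = nat j" "bideg_le Q (nat (i + j)) (nat j)"
    "coeff (coeff Q (nat j)) (nat i) \<noteq> 0 \<or> P = 0"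
proof -
  have r: "j \<in> {0..N}" "i \<in> {0..N - j}" using assms by (auto simp: triangle_def)
  obtain p where p: "degree p = nat i" "p \<noteq> 0" "\<And>x. pa_p (\<Phi> j) x i = poly p (pa_eig (\<Phi> j) x)"
    using pa_p_polynomial[OF \<Phi>(1)[OF r(1)]] r \<Phi>(2)[OF r(1)] by metis
  have "represents (smult p P) i j"
    unfolding represents_def
  proof (intro ballI, clarify)
    fix x y assume xy: "(x,y) \<in> triangle N"
    have "T i j x y = poly p (t x) * T 0 j x y"
      using assms(1) p(3)[of x] eig[OF r(1), of x] pa_p_0[OF \<Phi>(1)[OF r(1)], of x]
      by (auto simp: biv_T_def triangle_def)
    then show "T i j x y = bipoly (smult p P) (t x) (pa_eig (\<Psi> x) y)"
      using assms(2) xy by (auto simp: represents_def bipoly_simps)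
  qed
  moreover have "degree (smult p P) = nat j" using p assms(3) by simp
  moreover have "bideg_le (smult p P) (nat (i + j)) (nat j)"
    using bideg_le_smult[OF assms(4), of p "nat i"] p r by (simp add: nat_add_distrib)
  moreover have "coeff (coeff (smult p P) (nat j)) (nat i) \<noteq> 0 \<or> P = 0"
  proof (cases "P = 0")
    case False
    then have nz: "coeff P (nat j) \<noteq> 0" using assms(3) by (metis leading_coeff_0_iff)
    \<comment> \<open>Total degree j leaves only a constant in front of v^j, so the product contains
      the monomial u^i v^j, which makes the total degree exact.\<close>
    then have "degree (coeff P (nat j)) = 0" using assms(4) by (auto simp: bideg_le_def)
    then have "coeff (p * coeff P (nat j)) (nat i) \<noteq> 0"
      using nz p by (metis add.right_neutral coeff_mult_degree_sum leading_coeff_0_iff mult_eq_0_iff)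
    then show ?thesis by simp
  qed simp
  ultimately show ?thesis using that by blast
qed

text \<open>The recurrence for \<theta>_y(x) at (0,j) is solved for T_(0,j+1). As (-1,-1) is not in
  \<open>A2\<close>, T_(1,j+1) does not occur: all other terms have total degree at most j + 1 and
  degree at most j in the second variable, so the leading term comes from \<theta>_y(x)
  T_(0,j).\<close>

lemma T_0_polynomial:
  "int n \<le> N \<Longrightarrow> \<exists>P. represents P 0 (int n) \<and> degree P = n \<and> P \<noteq> 0 \<and> bideg_le P n n"
proof (induction n rule: less_induct)
  case (less n)
  show ?case
  proof (cases n)
    case 0
    have "T 0 0 x y = 1" if "(x,y) \<in> triangle N" for x y
    proof -
      have x: "x \<in> {0..N}" using that by (auto simp: triangle_def)
      have "pa_p (\<Phi> 0) x 0 = 1" using N \<Phi>(1)[of 0] by (intro pa_p_0) auto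
      then show ?thesis
        using that N pa_p_0[OF \<Psi>(1)[OF x], of y] by (auto simp: biv_T_def triangle_def)
    qed
    then have "represents 1 0 0" by (auto simp: represents_def bipoly_simps)
    moreover have "bideg_le 1 0 0" by (auto simp: bideg_le_def)
    ultimately show ?thesis using 0 by (intro exI[of _ 1]) auto
  next
    case (Suc m)
    define j where "j = int m"
    have j: "0 \<le> j" "j < N" "j + 1 = int n" using less.prems Suc by (auto simp: j_def)
    obtain P0 where P0: "represents P0 0 j" "degree P0 = m" "P0 \<noteq> 0" "bideg_le P0 m m"
      using less.IH[of m] Suc j by (auto simp: j_def)
    obtain P1 where P1: "represents P1 1 j" "bideg_le P1 n m"
    proof -
      have "(1, j) \<in> triangle N" using j by (auto simp: triangle_def)
      then obtain Q where "represents Q 1 j" "bideg_le Q (nat (1 + j)) (nat j)"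
        using T_factor[of 1 j P0] P0 by (auto simp: j_def)
      moreover have "nat (1 + j) = n" "nat j = m" using Suc by (auto simp: j_def)
      ultimately show ?thesis using that by auto
    qed
    obtain R0 R1 where R: "represents R0 0 (j - 1)" "bideg_le R0 n m" "represents R1 1 (j - 1)" "bideg_le R1 n m"
    proof (cases m)
      case 0
      then have "represents 0 0 (j - 1)" "represents 0 1 (j - 1)"
        by (auto intro!: represents_outside simp: j_def triangle_def)
      then show ?thesis using that bideg_le_0 by blast
    next
      case (Suc l)
      have l: "j - 1 = int l" "(1, j - 1) \<in> triangle N" using Suc j by (auto simp: j_def triangle_def)
      obtain R0 where R0: "represents R0 0 (j - 1)" "degree R0 = l" "bideg_le R0 l l"
        using less.IH[of l] Suc \<open>n = Suc m\<close> less.prems l by auto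
      obtain Q where Q: "represents Q 1 (j - 1)" "bideg_le Q (nat (1 + (j - 1))) (nat (j - 1))"
        using T_factor[OF l(2) R0(1)] R0 l(1) by auto
      have e: "nat (1 + (j - 1)) = m" "nat (j - 1) = l" using Suc by (auto simp: j_def)
      show ?thesis
        using that[OF R0(1) _ Q(1)] bideg_le_mono[OF R0(3), of n m] bideg_le_mono[OF Q(2), of n m] Suc \<open>n = Suc m\<close>
        unfolding e by auto
    qed
    define g where "g i' j' e e' = G 0 j / G i' j' * C e e' i' j'" for i' j' e e'
    define \<alpha> where "\<alpha> = g 0 (j + 1) 0 (-1)"
    have tri: "(0, j) \<in> triangle N" "(0, j + 1) \<in> triangle N" using j by (auto simp: triangle_def)
    have \<alpha>: "\<alpha> \<noteq> 0"
      using lowering_coeff_nz[of j] G_nz[OF tri(1)] G_nz[OF tri(2)] j by (simp add: \<alpha>_def g_def)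
    define Q where "Q = smult [: - g 0 j 0 0 :] P0 + (smult [: - g 0 (j - 1) 0 1 :] R0
       + (smult [: - g 1 j (-1) 0 :] P1 + smult [: - g 1 (j - 1) (-1) 1 :] R1))"
    define P where "P = smult [: 1 / \<alpha> :] (pCons 0 P0 + Q)"
    have "represents P 0 (int n)"
      unfolding represents_def
    proof (intro ballI, clarify)
      fix x y assume xy: "(x,y) \<in> triangle N"
      have neg: "T (-1) k x y = 0" for k by (simp add: biv_T_def triangle_def)
      have ev: "T 0 j x y = bipoly P0 (t x) (pa_eig (\<Psi> x) y)" "T 1 j x y = bipoly P1 (t x) (pa_eig (\<Psi> x) y)"
        "T 0 (j-1) x y = bipoly R0 (t x) (pa_eig (\<Psi> x) y)" "T 1 (j-1) x y = bipoly R1 (t x) (pa_eig (\<Psi> x) y)"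
        using P0(1) P1(1) R(1,3) xy by (auto simp: represents_def)
      have "pa_eig (\<Psi> x) y * T 0 j x y = \<alpha> * T 0 (j + 1) x y + g 0 j 0 0 * T 0 j x y + g 0 (j - 1) 0 1 * T 0 (j - 1) x y
         + g 1 j (-1) 0 * T 1 j x y + g 1 (j - 1) (-1) 1 * T 1 (j - 1) x y"
        using recurrence_y[OF tri(1) xy] by (simp add: sum_A2 neg g_def \<alpha>_def)
      then have "\<alpha> * T 0 (j + 1) x y = bipoly (pCons 0 P0 + Q) (t x) (pa_eig (\<Psi> x) y)"
        unfolding Q_def bipoly_simps ev by (simp add: algebra_simps)
      then have "T 0 (j + 1) x y = bipoly P (t x) (pa_eig (\<Psi> x) y)"
        using \<alpha> unfolding P_def bipoly_simps(2) by (simp add: field_simps)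
      then show "T 0 (int n) x y = bipoly P (t x) (pa_eig (\<Psi> x) y)" using j by simp
    qed
    moreover have Q: "bideg_le Q n m"
    proof -
      have s: "bideg_le (smult [:c:] X) n m" if "bideg_le X n m" for c X
        using bideg_le_smult[OF that, of "[:c:]" 0] by simp
      have "bideg_le P0 n m" using bideg_le_mono[OF P0(4)] Suc by simp
      then show ?thesis unfolding Q_def using P1 R by (intro bideg_le_add s) auto
    qed
    have dQ: "degree Q < degree (pCons 0 P0)" using Q P0 by (auto simp: bideg_le_def)
    have "degree (pCons 0 P0 + Q) = n" using dQ P0 Suc by (subst degree_add_eq_left) auto
    then have deg: "degree P = n" unfolding P_def using \<alpha> by simp
    moreover have "P \<noteq> 0" using deg Suc by auto
    moreover have "bideg_le P n n"
    proof -
      have "bideg_le (pCons 0 P0) n n" using bideg_le_pCons[OF P0(4)] Suc by simp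
      moreover have "bideg_le Q n n" using bideg_le_mono[OF Q] Suc by simp
      ultimately show ?thesis unfolding P_def
        using bideg_le_smult[OF bideg_le_add, of "pCons 0 P0" n n Q "[:1 / \<alpha>:]" 0] by simp
    qed
    ultimately show ?thesis by blast
  qed
qed

lemma T_polynomial:
  assumes "(i,j) \<in> triangle N"
  obtains P where "int (total_degree P) = i + j" "int (degree P) = j"
    "\<And>x y. (x,y) \<in> triangle N \<Longrightarrow> T i j x y = bipoly P (t x) (pa_eig (\<Psi> x) y)"
proof -
  have j: "0 \<le> i" "0 \<le> j" "int (nat j) \<le> N" "int (nat j) = j" using assms by (auto simp: triangle_def)
  obtain P where P: "represents P 0 j" "degree P = nat j" "P \<noteq> 0" "bideg_le P (nat j) (nat j)"
    using T_0_polynomial[OF j(3)] j(4) by auto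
  obtain Q where Q: "represents Q i j" "degree Q = nat j" "bideg_le Q (nat (i + j)) (nat j)"
    "coeff (coeff Q (nat j)) (nat i) \<noteq> 0"
    using T_factor[OF assms P(1,2,4)] P(3) by metis
  have "total_degree Q = nat (i + j)"
    by (rule total_degree_eq[OF Q(3,4)]) (simp only: nat_add_distrib[OF j(1,2)])
  then show ?thesis using that[of Q] Q j by (auto simp: represents_def)
qed

lemma dual_orthogonality:
  assumes j: "j \<in> {0..N}" and "i \<in> {0..N - j}" "i' \<in> {0..N - j}"
  shows "(\<Sum>x\<in>{0..N - j}. pa_p (pa_dual (\<Phi> j)) i x * pa_p (\<Phi> j) x i') = (if i = i' then pa_nu (\<Phi> j) else 0)"
  using pa_orthogonality[OF is_param_array_dual[OF \<Phi>(1)[OF j]], of i i'] assms \<Phi>(2)[OF j]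
  by (simp add: pa_dual_dual pa_nu_dual)

text \<open>Rewriting one of the two T by \<open>T_div_G\<close> uncouples the sums: the inner one
  is orthogonality for \<Phi>_j and forces x = x'. The outer range is then the full range of Psi_x,
  whose orthogonality gives y = y'.\<close>

lemma orthogonality_G:
  assumes xy: "(x,y) \<in> triangle N" and xy': "(x',y') \<in> triangle N"
  shows "(\<Sum>j\<in>{0..min (N-x) (N-x')}. \<Sum>i\<in>{0..N-j}. 1 / G i j * T i j x y * T i j x' y')
          = (if x = x' \<and> y = y' then 1 / F x y else 0)"
proof -
  have r: "x \<in> {0..N}" "y \<in> {0..N - x}" "x' \<in> {0..N}" "y' \<in> {0..N - x'}" using xy xy' by (auto simp: triangle_def)
  have inner: "(\<Sum>i\<in>{0..N-j}. 1 / G i j * T i j x y * T i j x' y')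
      = (if x = x' then pa_p (pa_dual (\<Psi> x)) j y * pa_p (\<Psi> x') y' j / (pa_nu (\<Psi> x) * F x y) else 0)"
    if j: "j \<in> {0..min (N-x) (N-x')}" for j
  proof -
    have jr: "j \<in> {0..N}" "x \<in> {0..N - j}" "x' \<in> {0..N - j}" using j r by auto
    have "(\<Sum>i\<in>{0..N-j}. 1 / G i j * T i j x y * T i j x' y')
       = (\<Sum>i\<in>{0..N-j}. pa_p (pa_dual (\<Psi> x)) j y * pa_p (\<Psi> x') y' j / (nu_prod x j * F x y)
             * (pa_p (\<Phi> j) x' i * pa_p (pa_dual (\<Phi> j)) i x))"
    proof (rule sum.cong)
      fix i assume i: "i \<in> {0..N-j}"
      then have ij: "(i,j) \<in> triangle N" using jr by (auto simp: triangle_def)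
      have "1 / G i j * T i j x y * T i j x' y' = T i j x y / G i j * T i j x' y'" by simp
      also have "\<dots> = T_dual i j x y / (nu_prod x j * F x y) * T i j x' y'" unfolding T_div_G[OF xy] ..
      also have "\<dots> = pa_p (pa_dual (\<Psi> x)) j y * pa_p (\<Psi> x') y' j / (nu_prod x j * F x y)
             * (pa_p (\<Phi> j) x' i * pa_p (pa_dual (\<Phi> j)) i x)"
        using ij xy xy' jr by (simp add: T_dual_eq biv_T_def)
      finally show "1 / G i j * T i j x y * T i j x' y' = \<dots>" .
    qed simp
    also have "\<dots> = pa_p (pa_dual (\<Psi> x)) j y * pa_p (\<Psi> x') y' j / (nu_prod x j * F x y) * (if x' = x then pa_nu (\<Phi> j) else 0)"
      unfolding sum_distrib_left[symmetric]
      using pa_orthogonality[OF \<Phi>(1)[OF jr(1)], of x' x] jr \<Phi>(2)[OF jr(1)] by simp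
    finally show ?thesis using nu_nz(1)[OF jr(1)] by (auto simp: nu_prod_def)
  qed
  have "(\<Sum>j\<in>{0..min (N-x) (N-x')}. \<Sum>i\<in>{0..N-j}. 1 / G i j * T i j x y * T i j x' y')
     = (\<Sum>j\<in>{0..min (N-x) (N-x')}. if x = x' then pa_p (pa_dual (\<Psi> x)) j y * pa_p (\<Psi> x') y' j / (pa_nu (\<Psi> x) * F x y) else 0)"
    by (rule sum.cong) (use inner in auto)
  also have "\<dots> = (if x = x' \<and> y = y' then 1 / F x y else 0)"
  proof (cases "x = x'")
    case True
    have "(\<Sum>j\<in>{0..N - x}. pa_p (\<Psi> x) y' j * pa_p (pa_dual (\<Psi> x)) j y) = (if y' = y then pa_nu (\<Psi> x) else 0)"
      using pa_orthogonality[OF \<Psi>(1)[OF r(1)], of y' y] r True \<Psi>(2)[OF r(1)] by simp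
    then show ?thesis using True nu_nz(2)[OF r(1)]
      by (auto simp: sum_divide_distrib[symmetric] mult.commute)
  qed simp
  finally show ?thesis .
qed

text \<open>The same uncoupling in the other order: the sum over y forces j = j' by the dual of
  Psi_x, then the sum over x forces i = i' by the dual of \<Phi>_j.\<close>

lemma orthogonality_F:
  assumes ij: "(i,j) \<in> triangle N" and ij': "(i',j') \<in> triangle N"
  shows "(\<Sum>x\<in>{0..min (N-j) (N-j')}. \<Sum>y\<in>{0..N-x}. F x y * T i j x y * T i' j' x y)
          = (if i = i' \<and> j = j' then G i j else 0)"
proof -
  have r: "j \<in> {0..N}" "i \<in> {0..N - j}" "j' \<in> {0..N}" "i' \<in> {0..N - j'}" using ij ij' by (auto simp: triangle_def)
  have inner: "(\<Sum>y\<in>{0..N-x}. F x y * T i j x y * T i' j' x y)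
      = (if j = j' then G i j * (pa_p (pa_dual (\<Phi> j)) i x * pa_p (\<Phi> j) x i') / pa_nu (\<Phi> j) else 0)"
    if x: "x \<in> {0..min (N-j) (N-j')}" for x
  proof -
    have xr: "x \<in> {0..N}" "j \<in> {0..N - x}" "j' \<in> {0..N - x}" using x r by auto
    have "(\<Sum>y\<in>{0..N-x}. F x y * T i j x y * T i' j' x y)
       = (\<Sum>y\<in>{0..N-x}. G i j * (pa_p (pa_dual (\<Phi> j)) i x * pa_p (\<Phi> j') x i') / nu_prod x j
             * (pa_p (pa_dual (\<Psi> x)) j y * pa_p (\<Psi> x) y j'))"
    proof (rule sum.cong)
      fix y assume y: "y \<in> {0..N-x}"
      then have xy: "(x,y) \<in> triangle N" using xr by (auto simp: triangle_def)
      have "F x y * T i j x y * T i' j' x y = F x y * G i j * (T i j x y / G i j) * T i' j' x y"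
        using G_nz[OF ij] by simp
      also have "\<dots> = F x y * G i j * (T_dual i j x y / (nu_prod x j * F x y)) * T i' j' x y" unfolding T_div_G[OF xy] ..
      also have "\<dots> = G i j * (pa_p (pa_dual (\<Phi> j)) i x * pa_p (\<Phi> j') x i') / nu_prod x j
             * (pa_p (pa_dual (\<Psi> x)) j y * pa_p (\<Psi> x) y j')"
        using ij ij' xy xr F_nz[OF xy] by (simp add: T_dual_eq biv_T_def)
      finally show "F x y * T i j x y * T i' j' x y = \<dots>" .
    qed simp
    also have "\<dots> = G i j * (pa_p (pa_dual (\<Phi> j)) i x * pa_p (\<Phi> j') x i') / nu_prod x j * (if j = j' then pa_nu (\<Psi> x) else 0)"
      unfolding sum_distrib_left[symmetric]
      using pa_orthogonality[OF is_param_array_dual[OF \<Psi>(1)[OF xr(1)]], of j j'] xr \<Psi>(2)[OF xr(1)]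
      by (simp add: pa_dual_dual pa_nu_dual)
    finally show ?thesis using nu_nz(2)[OF xr(1)] by (auto simp: nu_prod_def)
  qed
  have "(\<Sum>x\<in>{0..min (N-j) (N-j')}. \<Sum>y\<in>{0..N-x}. F x y * T i j x y * T i' j' x y)
     = (\<Sum>x\<in>{0..min (N-j) (N-j')}. if j = j' then G i j * (pa_p (pa_dual (\<Phi> j)) i x * pa_p (\<Phi> j) x i') / pa_nu (\<Phi> j) else 0)"
    by (rule sum.cong) (use inner in auto)
  also have "\<dots> = (if i = i' \<and> j = j' then G i j else 0)"
  proof (cases "j = j'")
    case True
    then show ?thesis using dual_orthogonality[OF r(1,2), of i'] r nu_nz(1)[OF r(1)]
      by (simp add: sum_divide_distrib[symmetric] sum_distrib_left[symmetric])
  qed simp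
  finally show ?thesis .
qed

end

theorem mainTheorem2:
  fixes N :: int
    and \<Phi> \<Psi> :: "int \<Rightarrow> param_array"
    and t :: "int \<Rightarrow> complex" and tst f g :: "int \<Rightarrow> int \<Rightarrow> complex"
    and th :: "int \<Rightarrow> int \<Rightarrow> complex" and thst :: "int \<Rightarrow> complex"
    and vphi phi :: "int \<Rightarrow> int \<Rightarrow> complex"
    and C D :: "int \<Rightarrow> int \<Rightarrow> int \<Rightarrow> int \<Rightarrow> complex"
    and F G :: "int \<Rightarrow> int \<Rightarrow> complex"
    and T :: "int \<Rightarrow> int \<Rightarrow> int \<Rightarrow> int \<Rightarrow> complex"
  assumes N: "1 \<le> N"
    and \<Phi>: "\<And>j. j \<in> {0..N} \<Longrightarrow>
      \<Phi> j = \<lparr> pa_diam = N - j, pa_eig = t, pa_deig = (\<lambda>x. tst x j),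
              pa_fsplit = (\<lambda>x. f x j), pa_ssplit = (\<lambda>x. g x j) \<rparr>"
    and \<Psi>: "\<And>x. x \<in> {0..N} \<Longrightarrow>
      \<Psi> x = \<lparr> pa_diam = N - x, pa_eig = (\<lambda>j. th j x), pa_deig = thst,
              pa_fsplit = (\<lambda>j. vphi j x), pa_ssplit = (\<lambda>j. phi j x) \<rparr>"
    and compat: "compatible_via N \<Phi> \<Psi> C D F G"
    and T: "T = biv_T N \<Phi> \<Psi>"
  shows
    \<comment> \<open>difference relations\<close>
    "(\<forall>(i,j)\<in>triangle N. \<forall>(x,y)\<in>triangle N.
        tst i j * T i j x y
          = (\<Sum>(e,e')\<in>A2. D e e' (x-e) (y-e') * T i j (x-e) (y-e')) \<and>
        thst j * T i j x y
          = pa_b (pa_dual (\<Psi> x)) y * T i j x (y+1)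
            + pa_a (pa_dual (\<Psi> x)) y * T i j x y
            + pa_c (pa_dual (\<Psi> x)) y * T i j x (y-1))
   \<and> \<comment> \<open>recurrence relations\<close>
     (\<forall>(i,j)\<in>triangle N. \<forall>(x,y)\<in>triangle N.
        t x * T i j x y
          = G i j / G (i+1) j * pa_b (\<Phi> j) i * T (i+1) j x y
            + pa_a (\<Phi> j) i * T i j x y
            + G i j / G (i-1) j * pa_c (\<Phi> j) i * T (i-1) j x y \<and>
        th y x * T i j x y
          = (\<Sum>(e,e')\<in>A2. G i j / G (i-e) (j-e') * C e e' (i-e) (j-e') * T (i-e) (j-e') x y))
   \<and> \<comment> \<open>degree\<close>
     (\<forall>(i,j)\<in>triangle N. \<exists>P :: complex poly poly.
        int (total_degree P) = i + j \<and> int (degree P) = j \<and>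
        (\<forall>(x,y)\<in>triangle N. T i j x y = bipoly P (t x) (th y x)))
   \<and> \<comment> \<open>orthogonality\<close>
     (\<forall>(x,y)\<in>triangle N. \<forall>(x',y')\<in>triangle N.
        (\<Sum>j\<in>{0..min (N-x) (N-x')}. \<Sum>i\<in>{0..N-j}. 1 / G i j * T i j x y * T i j x' y')
          = (if x = x' \<and> y = y' then 1 / F x y else 0))
   \<and> (\<forall>(i,j)\<in>triangle N. \<forall>(i',j')\<in>triangle N.
        (\<Sum>x\<in>{0..min (N-j) (N-j')}. \<Sum>y\<in>{0..N-x}. F x y * T i j x y * T i' j' x y)
          = (if i = i' \<and> j = j' then G i j else 0))"
proof -
  have c: "\<forall>j\<in>{0..N}. is_param_array (\<Phi> j) \<and> pa_diam (\<Phi> j) = N - j"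
    "\<forall>x\<in>{0..N}. is_param_array (\<Psi> x) \<and> pa_diam (\<Psi> x) = N - x"
    "zero_outside N C" "zero_outside N D" "C_relations N \<Phi> \<Psi> C" "D_relations N \<Phi> \<Psi> D" "FG_relation N \<Phi> \<Psi> F G"
    using compat unfolding compatible_via_def by blast+
  have e: "pa_eig (\<Phi> j) = t" "pa_deig (\<Phi> j) = (\<lambda>x. tst x j)" if "j \<in> {0..N}" for j
    unfolding \<Phi>[OF that] by simp_all
  have e': "pa_eig (\<Psi> x) = (\<lambda>j. th j x)" "pa_deig (\<Psi> x) = thst" if "x \<in> {0..N}" for x
    unfolding \<Psi>[OF that] by simp_all
  interpret compatible_families N \<Phi> \<Psi> C F G t
    using c N e by unfold_locales auto
  have rng: "a \<in> {0..N}" "b \<in> {0..N}" if "(a,b) \<in> triangle N" for a b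
    using that by (auto simp: triangle_def)
  show ?thesis
    unfolding T
  proof (intro conjI ballI; clarify)
    fix i j x y assume ij: "(i,j) \<in> triangle N" and xy: "(x,y) \<in> triangle N"
    show "tst i j * biv_T N \<Phi> \<Psi> i j x y
          = (\<Sum>(e,e')\<in>A2. D e e' (x-e) (y-e') * biv_T N \<Phi> \<Psi> i j (x-e) (y-e')) \<and>
        thst j * biv_T N \<Phi> \<Psi> i j x y
          = pa_b (pa_dual (\<Psi> x)) y * biv_T N \<Phi> \<Psi> i j x (y+1)
            + pa_a (pa_dual (\<Psi> x)) y * biv_T N \<Phi> \<Psi> i j x y
            + pa_c (pa_dual (\<Psi> x)) y * biv_T N \<Phi> \<Psi> i j x (y-1)"
      using difference_relation[OF c(6,4) ij xy] difference_y[OF ij xy] e(2)[OF rng(2)[OF ij]] e'(2)[OF rng(1)[OF xy]]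
      by simp
  next
    fix i j x y assume ij: "(i,j) \<in> triangle N" and xy: "(x,y) \<in> triangle N"
    show "t x * biv_T N \<Phi> \<Psi> i j x y
          = G i j / G (i+1) j * pa_b (\<Phi> j) i * biv_T N \<Phi> \<Psi> (i+1) j x y
            + pa_a (\<Phi> j) i * biv_T N \<Phi> \<Psi> i j x y
            + G i j / G (i-1) j * pa_c (\<Phi> j) i * biv_T N \<Phi> \<Psi> (i-1) j x y \<and>
        th y x * biv_T N \<Phi> \<Psi> i j x y
          = (\<Sum>(e,e')\<in>A2. G i j / G (i-e) (j-e') * C e e' (i-e) (j-e') * biv_T N \<Phi> \<Psi> (i-e) (j-e') x y)"
      using recurrence_x[OF ij xy] recurrence_y[OF ij xy] e'(1)[OF rng(1)[OF xy]] by simp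
  next
    fix i j assume ij: "(i,j) \<in> triangle N"
    obtain P where "int (total_degree P) = i + j" "int (degree P) = j"
      "\<And>x y. (x,y) \<in> triangle N \<Longrightarrow> biv_T N \<Phi> \<Psi> i j x y = bipoly P (t x) (pa_eig (\<Psi> x) y)"
      using T_polynomial[OF ij] by blast
    then show "\<exists>P. int (total_degree P) = i + j \<and> int (degree P) = j \<and>
        (\<forall>(x,y)\<in>triangle N. biv_T N \<Phi> \<Psi> i j x y = bipoly P (t x) (th y x))"
      using e'(1)[OF rng(1)] by (intro exI[of _ P]) auto
  next
    fix x y x' y' assume xy: "(x,y) \<in> triangle N" and xy': "(x',y') \<in> triangle N"
    show "(\<Sum>j\<in>{0..min (N-x) (N-x')}. \<Sum>i\<in>{0..N-j}. 1 / G i j * biv_T N \<Phi> \<Psi> i j x y * biv_T N \<Phi> \<Psi> i j x' y')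
          = (if x = x' \<and> y = y' then 1 / F x y else 0)"
      by (rule orthogonality_G[OF xy xy'])
  next
    fix i j i' j' assume ij: "(i,j) \<in> triangle N" and ij': "(i',j') \<in> triangle N"
    show "(\<Sum>x\<in>{0..min (N-j) (N-j')}. \<Sum>y\<in>{0..N-x}. F x y * biv_T N \<Phi> \<Psi> i j x y * biv_T N \<Phi> \<Psi> i' j' x y)
          = (if i = i' \<and> j = j' then G i j else 0)"
      by (rule orthogonality_F[OF ij ij'])
  qed
qed

end
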